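(* Let $\Phi$ be an irreducible root system with Coxeter number $h$, and let $n\ge1$, $k\ge0$ be integers. Then $$\chi_{\mathrm{quasi}}(\mathcal{A}_\Phi^{[1-k,n+k]},q)=\chi_{\mathrm{quasi}}(\mathcal{A}_\Phi^{[1,n]},q-kh).$$
   Context: Let $V=\mathbb{R}^\ell$ with inner product $(\cdot,\cdot)$, $\Phi\subset V$ an irreducible crystallographic root system of rank $\ell$ with positive system $\Phi^+$, simple roots $\alpha_1,\dots,\alpha_\ell$ and Coxeter number $h$. For $\alpha\in\Phi^+$, $k\in\mathbb{Z}$, $H_{\alpha,k}=\{x\in V\mid(\alpha,x)=k\}$; for integers $a\le b$, $\mathcal{A}_\Phi^{[a,b]}=\{H_{\alpha,k}\mid\alpha\in\Phi^+,a\le k\le b\}$. Coweight lattice $Z(\Phi)=\{x\mid(\alpha_i,x)\in\mathbb{Z}\ \forall i\}$. The characteristic quasi-polynomial $\chi_{\mathrm{quasi}}(\mathcal{A}_\Phi^{[a,b]},q)$ is the quasi-polynomial (function $\mathbb{Z}\to\mathbb{Z}$ that is polynomial on each residue class modulo a period) which equals, for all sufficiently large positive integers $q$, the number of $\bar x\in Z(\Phi)/qZ(\Phi)$ with $(\alpha,x)\not\equiv k\pmod q$ for all $\alpha\in\Phi^+$ and $a\le k\le b$. *)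

theory Defs
  imports
    "HOL-Analysis.Analysis"
    "HOL-Computational_Algebra.Polynomial"
    "HOL-Library.Real_Mod"
begin

section \<open>Root systems\<close>

definition reflection :: "'a::euclidean_space \<Rightarrow> 'a \<Rightarrow> 'a" where
  "reflection \<alpha> x = x - (2 * (\<alpha> \<bullet> x) / (\<alpha> \<bullet> \<alpha>)) *\<^sub>R \<alpha>"

text \<open>Crystallographic and reduced; the rank is the dimension of the ambient space.\<close>

definition root_system :: "'a::euclidean_space set \<Rightarrow> bool" where
  "root_system \<Phi> \<longleftrightarrow>
     finite \<Phi> \<and> 0 \<notin> \<Phi> \<and> span \<Phi> = UNIV \<and>
     (\<forall>\<alpha>\<in>\<Phi>. \<Phi> \<inter> span {\<alpha>} = {\<alpha>, - \<alpha>}) \<and>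
     (\<forall>\<alpha>\<in>\<Phi>. reflection \<alpha> ` \<Phi> = \<Phi>) \<and>
     (\<forall>\<alpha>\<in>\<Phi>. \<forall>\<beta>\<in>\<Phi>. 2 * (\<alpha> \<bullet> \<beta>) / (\<alpha> \<bullet> \<alpha>) \<in> \<int>)"

definition irreducible_root_system :: "'a::euclidean_space set \<Rightarrow> bool" where
  "irreducible_root_system \<Phi> \<longleftrightarrow>
     root_system \<Phi> \<and> \<Phi> \<noteq> {} \<and>
     \<not> (\<exists>\<Phi>\<^sub>1 \<Phi>\<^sub>2. \<Phi>\<^sub>1 \<noteq> {} \<and> \<Phi>\<^sub>2 \<noteq> {} \<and> \<Phi>\<^sub>1 \<inter> \<Phi>\<^sub>2 = {} \<and> \<Phi>\<^sub>1 \<union> \<Phi>\<^sub>2 = \<Phi> \<and>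
          (\<forall>\<alpha>\<in>\<Phi>\<^sub>1. \<forall>\<beta>\<in>\<Phi>\<^sub>2. \<alpha> \<bullet> \<beta> = 0))"

definition nonneg_combinations :: "'a::euclidean_space set \<Rightarrow> 'a set" where
  "nonneg_combinations \<Delta> = {\<Sum>\<alpha>\<in>\<Delta>. real (c \<alpha>) *\<^sub>R \<alpha> | c :: 'a \<Rightarrow> nat. True}"

text \<open>A positive system is given by its simple roots: a basis of the space, contained in
  the root system, in which every root has integer coefficients of a single sign.\<close>

definition simple_roots :: "'a::euclidean_space set \<Rightarrow> 'a set \<Rightarrow> bool" where
  "simple_roots \<Phi> \<Delta> \<longleftrightarrow>
     \<Delta> \<subseteq> \<Phi> \<and> independent \<Delta> \<and> span \<Delta> = UNIV \<and>
     (\<forall>\<beta>\<in>\<Phi>. \<beta> \<in> nonneg_combinations \<Delta> \<or> - \<beta> \<in> nonneg_combinations \<Delta>)"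

definition positive_roots :: "'a::euclidean_space set \<Rightarrow> 'a set \<Rightarrow> 'a set" where
  "positive_roots \<Phi> \<Delta> = \<Phi> \<inter> nonneg_combinations \<Delta>"

definition coxeter_element :: "'a::euclidean_space list \<Rightarrow> 'a \<Rightarrow> 'a" where
  "coxeter_element \<alpha>s = foldr (\<lambda>\<alpha> w. reflection \<alpha> \<circ> w) \<alpha>s id"

text \<open>The order of the product of the simple reflections.  All Coxeter elements are
  conjugate in the Weyl group, so neither the choice of simple roots nor the order in
  which they are listed matters.\<close>

definition coxeter_number :: "'a::euclidean_space list \<Rightarrow> nat" where
  "coxeter_number \<alpha>s = (LEAST m. 0 < m \<and> coxeter_element \<alpha>s ^^ m = id)"

section \<open>Characteristic quasi-polynomials\<close>

definition coweight_lattice :: "'a::euclidean_space set \<Rightarrow> 'a set" where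
  "coweight_lattice \<Delta> = {x. \<forall>\<alpha>\<in>\<Delta>. \<alpha> \<bullet> x \<in> \<int>}"

definition lattice_mod :: "'a::euclidean_space set \<Rightarrow> int \<Rightarrow> 'a set set" where
  "lattice_mod Z q = Z // {(x, y). x \<in> Z \<and> y \<in> Z \<and> (\<exists>z\<in>Z. x - y = of_int q *\<^sub>R z)}"

text \<open>The classes modulo \<open>q\<close> that avoid the hyperplanes \<open>{x. \<alpha> \<bullet> x = k}\<close> with \<open>\<alpha>\<close> a positive
  root and \<open>a \<le> k \<le> b\<close>.  The inner products \<open>\<alpha> \<bullet> x\<close> are integers, so the congruence of
  reals used here is congruence of integers; it does not depend on the representative.\<close>

definition complement_mod ::
  "'a::euclidean_space set \<Rightarrow> 'a set \<Rightarrow> int \<Rightarrow> int \<Rightarrow> int \<Rightarrow> 'a set set" where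
  "complement_mod \<Phi> \<Delta> a b q =
     {C \<in> lattice_mod (coweight_lattice \<Delta>) q.
        \<forall>x\<in>C. \<forall>\<alpha>\<in>positive_roots \<Phi> \<Delta>. \<forall>k\<in>{a..b}.
          \<not> [\<alpha> \<bullet> x = of_int k] (rmod of_int q)}"

definition quasi_polynomial :: "(int \<Rightarrow> int) \<Rightarrow> bool" where
  "quasi_polynomial f \<longleftrightarrow>
     (\<exists>N>0. \<exists>P :: int \<Rightarrow> rat poly. \<forall>q. of_int (f q) = poly (P (q mod N)) (of_int q))"

text \<open>A quasi-polynomial is determined by its values at all large positive integers.\<close>

definition characteristic_quasi_polynomial ::
  "'a::euclidean_space set \<Rightarrow> 'a set \<Rightarrow> int \<Rightarrow> int \<Rightarrow> int \<Rightarrow> int" where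
  "characteristic_quasi_polynomial \<Phi> \<Delta> a b =
     (THE f. quasi_polynomial f \<and>
        (\<forall>\<^sub>F q in at_top. f q = int (card (complement_mod \<Phi> \<Delta> a b q))))"

end

theory Submission imports Defs begin

text \<open>Let \<open>\<theta>\<close> be the highest root, \<open>\<rho>\<close> the sum of the fundamental coweights and
  \<open>h = 1 + \<theta> \<bullet> \<rho>\<close>.  A class modulo \<open>q\<close> has a unique representative \<open>x\<close> with \<open>0 < a \<bullet> x \<le> q\<close> at the
  simple roots \<open>a\<close>, and \<open>x\<close> lies in exactly one half-open alcove of the affine arrangement
  dilated by \<open>q\<close>.  An alcove is recorded by its centre \<open>w \<rho> + h z\<close>, taken in the dilation by \<open>h\<close>.
  Transported to the fundamental alcove by \<open>x = w y + q z\<close>, the condition of avoiding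
  \<open>1 - k, ..., n + k\<close> becomes a lower bound \<open>k\<close> or \<open>n + k + 1\<close> on the distance of \<open>y\<close> to each wall.
  The wall distances satisfy one linear relation, whose coefficients are \<open>1\<close> and the coefficients
  of \<open>\<theta>\<close> and add up to \<open>h\<close>; hence subtracting \<open>k\<close> from all of them replaces \<open>q\<close> by \<open>q - k h\<close>, and
  what remains is a restricted partition function, which is a quasi-polynomial.

  That \<open>h\<close> is the order of a Coxeter element follows from two counts of the roots: \<open>h\<close> times the
  rank by the trace of an invariant form, and the order times the rank by Steinberg's argument in
  the Coxeter plane.\<close>

section \<open>Quasi-polynomials\<close>

text \<open>Alcoves are moved by all orthogonal symmetries of \<Phi> together with translations by
  the whole coweight lattice, a group that is in general larger than the affine Weyl group; so an
  alcove does not determine the pair \<open>(w, z)\<close>. Its centre does not depend on the pair: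
  \<rho> is the only lattice point strictly inside the fundamental alcove dilated by
  \<open>h\<close>, because its wall distances are positive integers, and both their weighted sum
  and the sum of the weights are \<open>h\<close>.

  Alcoves have to be half-open because for \<open>k = 0\<close> the value \<open>0\<close> is not
  excluded: points on the walls count, and each must count once.

  The number \<open>h\<close> has two guises, an order in the definition and a total weight in the
  count; both are compared with the number of roots. Steinberg's argument works with a word that
  lists two orthogonal colour classes one after the other, whereas the definition admits any order.
  This is why the Dynkin diagram is shown to be a forest: leaves give both the colouring and the
  conjugacy of all orders.\<close>

lemma quasi_polynomial_multiple_period:
  assumes "N > 0" "M > 0" and f: "\<And>q. of_int (f q) = poly (P (q mod N)) (of_int q :: rat)"
  shows "of_int (f q) = poly (P ((q mod (N * M)) mod N)) (of_int q)"
  using f[of q] assms(1,2) by (simp add: mod_mod_cancel)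

lemma quasi_polynomial_zero: "quasi_polynomial (\<lambda>q. 0)"
  unfolding quasi_polynomial_def by (intro exI[of _ 1] conjI exI[of _ "\<lambda>_. 0"]) auto

lemma quasi_polynomial_add:
  assumes "quasi_polynomial f" "quasi_polynomial g" shows "quasi_polynomial (\<lambda>q. f q + g q)"
proof -
  obtain N P where N: "N > 0" and f: "\<And>q. of_int (f q) = poly (P (q mod N) :: rat poly) (of_int q)"
    using assms(1) unfolding quasi_polynomial_def by blast
  obtain M Q where M: "M > 0" and g: "\<And>q. of_int (g q) = poly (Q (q mod M) :: rat poly) (of_int q)"
    using assms(2) unfolding quasi_polynomial_def by blast
  have "of_int (f q + g q) = poly (P ((q mod (N * M)) mod N) + Q ((q mod (N * M)) mod M)) (of_int q)" for q
    using quasi_polynomial_multiple_period[where f = f and P = P, OF N M f, of q]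
      quasi_polynomial_multiple_period[where f = g and P = Q, OF M N g, of q]
    by (simp add: mult.commute)
  then show ?thesis unfolding quasi_polynomial_def
    by (intro exI[of _ "N * M"] conjI exI[of _ "\<lambda>r. P (r mod N) + Q (r mod M)"])
      (use N M in auto)
qed

lemma quasi_polynomial_sum:
  "(\<And>i. i \<in> A \<Longrightarrow> quasi_polynomial (f i)) \<Longrightarrow> quasi_polynomial (\<lambda>q. \<Sum>i\<in>A. f i q)"
  by (induction A rule: infinite_finite_induct)
    (auto intro: quasi_polynomial_zero quasi_polynomial_add)

lemma quasi_polynomial_shift:
  assumes "quasi_polynomial f" shows "quasi_polynomial (\<lambda>q. f (q - s))"
proof -
  obtain N P where N: "N > 0" and f: "\<And>q. of_int (f q) = poly (P (q mod N) :: rat poly) (of_int q)"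
    using assms(1) unfolding quasi_polynomial_def by blast
  have "of_int (f (q - s)) = poly (pcompose (P ((q mod N - s) mod N)) [:- of_int s, 1:]) (of_int q)" for q
    using f[of "q - s"] by (simp add: poly_pcompose mod_diff_left_eq)
  then show ?thesis unfolding quasi_polynomial_def
    by (intro exI[of _ N] conjI exI[of _ "\<lambda>r. pcompose (P ((r - s) mod N)) [:- of_int s, 1:]"])
      (use N in auto)
qed

text \<open>On a class modulo \<open>N * M\<close> both functions are polynomials that agree at
  infinitely many points. Agreement for large \<open>q\<close> thus spreads to all integers, which
  gives the \<open>THE\<close> in the definition its value.\<close>

lemma quasi_polynomial_unique:
  assumes "quasi_polynomial f" "quasi_polynomial g" "\<forall>\<^sub>F q in at_top. f q = g q"
  shows "f = g"
proof
  fix q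
  obtain N P where N: "N > 0" and f: "\<And>q. of_int (f q) = poly (P (q mod N) :: rat poly) (of_int q)"
    using assms(1) unfolding quasi_polynomial_def by blast
  obtain M Q where M: "M > 0" and g: "\<And>q. of_int (g q) = poly (Q (q mod M) :: rat poly) (of_int q)"
    using assms(2) unfolding quasi_polynomial_def by blast
  obtain b where b: "\<And>q. q \<ge> b \<Longrightarrow> f q = g q" using assms(3) by (auto simp: eventually_at_top_linorder)
  let ?D = "P (q mod N) - Q (q mod M)"
  have "?D = 0"
  proof (rule ccontr)
    assume nz: "?D \<noteq> 0"
    \<comment> \<open>Points of the class of \<open>q\<close> modulo \<open>N * M\<close>; since
      \<open>N * M \<ge> 1\<close>, adding \<open>\<bar>b\<bar> + \<bar>q\<bar>\<close> periods
      leads beyond \<open>b\<close>.\<close>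
    define z where "z i = (of_int (q + N * M * (\<bar>b\<bar> + \<bar>q\<bar> + int i)) :: rat)" for i :: nat
    have "z i \<in> {x. poly ?D x = 0}" for i
    proof -
      define t where "t = \<bar>b\<bar> + \<bar>q\<bar> + int i"
      have "1 * t \<le> N * M * t" using N M by (intro mult_right_mono) (auto simp: t_def int_one_le_iff_zero_less)
      moreover have "t \<ge> b - q" unfolding t_def by linarith
      ultimately have "q + N * M * t \<ge> b" by linarith
      then have "f (q + N * M * t) = g (q + N * M * t)" by (rule b)
      moreover have "(q + N * M * t) mod N = q mod N" "(q + N * M * t) mod M = q mod M"
        using mod_mult_self2[of q N "M * t"] mod_mult_self2[of q M "N * t"] by (simp_all add: mult_ac)
      ultimately show ?thesis using f[of "q + N * M * t"] g[of "q + N * M * t"]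
        unfolding z_def t_def[symmetric] by simp
    qed
    then have "range z \<subseteq> {x. poly ?D x = 0}" by auto
    moreover have "inj z" using N M by (auto simp: inj_def z_def)
    ultimately have "infinite {x. poly ?D x = 0}"
      using finite_subset range_inj_infinite by blast
    then show False using poly_roots_finite[OF nz] by simp
  qed
  then have "(of_int (f q) :: rat) = of_int (g q)" using f[of q] g[of q] by simp
  then show "f q = g q" by simp
qed

text \<open>The difference of \<open>c / (n + 1)\<close> times \<open>x ^ (n + 1)\<close> has the
  leading term \<open>c\<close> times \<open>x ^ n\<close>; subtracting it from \<open>D\<close>
  leaves a rest \<open>R\<close> of lower degree.\<close>

lemma poly_antidifference:
  fixes D :: "rat poly"
  shows "\<exists>E. \<forall>x. poly E (x + 1) - poly E x = poly D x"
proof (induction "degree D" arbitrary: D rule: less_induct)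
  case less
  define n c where "n = degree D" and "c = lead_coeff D"
  define M :: "rat poly" where "M = monom (c / of_nat (Suc n)) (Suc n)"
  define T where "T = smult (c / of_nat (Suc n)) ([:1, 1:] ^ Suc n) - M"
  define R where "R = D - T"
  have T: "poly T x = poly M (x + 1) - poly M x" for x
    by (simp add: T_def M_def poly_monom algebra_simps del: power_Suc)
  have coeff_R: "coeff R i = 0" if i: "i \<ge> n" for i
  proof -
    consider "i = n" | "i = Suc n" | "i > Suc n" using i by linarith
    then show ?thesis
    proof cases
      case 1
      then have "coeff T i = c"
        unfolding T_def M_def by (simp add: coeff_linear_poly_power del: power_Suc of_nat_Suc)
      then show ?thesis using 1 unfolding R_def c_def n_def by simp
    next
      case 2
      then have "coeff T i = 0"
        unfolding T_def M_def by (simp add: coeff_linear_poly_power del: power_Suc of_nat_Suc)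
      then show ?thesis using 2 coeff_eq_0[of D i] unfolding R_def n_def by simp
    next
      case 3
      then have "coeff T i = 0"
        unfolding T_def M_def by (simp add: coeff_eq_0 degree_linear_power del: power_Suc of_nat_Suc)
      then show ?thesis using 3 coeff_eq_0[of D i] unfolding R_def n_def by simp
    qed
  qed
  have "\<exists>E. \<forall>x. poly E (x + 1) - poly E x = poly R x"
  proof (cases "R = 0")
    case False
    then have "degree R < degree D" using coeff_R[of "degree R"] unfolding n_def
      by (metis leading_coeff_0_iff not_le)
    then show ?thesis by (rule less)
  qed (auto intro: exI[of _ 0])
  then obtain E where "\<And>x. poly E (x + 1) - poly E x = poly R x" by auto
  then show ?case using T by (intro exI[of _ "E + M"]) (simp add: R_def algebra_simps)
qed

text \<open>The recurrence is required on all integers, so \<open>G\<close> is integer-valued by hypothesis and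
  no integrality of the interpolating polynomials has to be shown.\<close>

lemma quasi_polynomial_antidifference:
  assumes g: "quasi_polynomial g" and c: "c > 0" and G: "\<And>q. G q - G (q - c) = g q"
  shows "quasi_polynomial G"
proof -
  obtain N P where N: "N > 0" and gP: "\<And>q. of_int (g q) = poly (P (q mod N) :: rat poly) (of_int q)"
    using g unfolding quasi_polynomial_def by blast
  \<comment> \<open>\<open>N\<close> steps of length \<open>c\<close> return to the same class
    modulo \<open>N\<close>. Along a class modulo \<open>L\<close> every telescoping summand is
    therefore a fixed polynomial, and so is the increment \<open>D\<close> of \<open>G\<close> over
    \<open>L\<close>.\<close>
  define L where "L = N * c"
  have L: "L > 0" using N c unfolding L_def by simp
  have tele: "G q - G (q - int n * c) = (\<Sum>i<n. g (q - int i * c))" for q n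
  proof (induction n)
    case (Suc n)
    have "q - int (Suc n) * c = (q - int n * c) - c" by (simp add: algebra_simps)
    show ?case unfolding \<open>q - int (Suc n) * c = _\<close> using Suc G[of "q - int n * c"] by simp
  qed simp
  have "\<exists>Q. \<forall>q. q mod L = r \<longrightarrow> of_int (G q) = poly Q (of_int q :: rat)" for r
  proof -
    define D where "D = (\<Sum>i<nat N. pcompose (P ((r - int i * c) mod N)) [:- of_int (int i * c), 1:])"
    have step: "of_int (G q - G (q - L)) = poly D (of_int q)" if q: "q mod L = r mod L" for q
    proof -
      have "(q - int i * c) mod N = (r - int i * c) mod N" for i
      proof -
        have "q mod N = r mod N" using q mod_mod_cancel[of N L] unfolding L_def by (metis dvd_triv_left)
        then show ?thesis by (metis mod_diff_left_eq)
      qed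
      then have "of_int (g (q - int i * c)) = poly (pcompose (P ((r - int i * c) mod N)) [:- of_int (int i * c), 1:]) (of_int q)" for i
        using gP[of "q - int i * c"] by (simp add: poly_pcompose)
      then show ?thesis using tele[of q "nat N"] N unfolding D_def L_def by (simp add: poly_sum)
    qed
    \<comment> \<open>On the points \<open>r + L * a\<close> the increment from \<open>a\<close> to
      \<open>a + 1\<close> is \<open>D\<close> at the right end point, hence the substitution of
      \<open>r + L + L * x\<close>.\<close>
    obtain E where E: "\<And>x. poly E (x + 1) - poly E x = poly (pcompose D [:of_int (r + L), of_int L:]) x"
      using poly_antidifference[of "pcompose D [:of_int (r + L), of_int L:]"] by auto
    have E': "poly E (x + 1) - poly E x = poly D (of_int r + of_int L * (x + 1))" for x
      unfolding E by (simp add: poly_pcompose algebra_simps)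
    have Ga: "of_int (G (r + L * a)) = (of_int (G r) + poly E (of_int a) - poly E 0 :: rat)" for a
    proof (induction a rule: int_induct[where k = 0])
      case base show ?case by simp
    next
      case (step1 a)
      have e: "r + L * (a + 1) - L = r + L * a" by (simp add: algebra_simps)
      have "of_int (G (r + L * (a + 1)) - G (r + L * a)) = poly D (of_int (r + L * (a + 1)))"
        using step[of "r + L * (a + 1)"] unfolding e by simp
      also have "\<dots> = poly E (of_int (a + 1)) - poly E (of_int a)" using E'[of "of_int a"] by simp
      finally show ?case using step1 by simp
    next
      case (step2 a)
      have e: "r + L * a - L = r + L * (a - 1)" by (simp add: algebra_simps)
      have "of_int (G (r + L * a) - G (r + L * (a - 1))) = poly D (of_int (r + L * a))"
        using step[of "r + L * a"] unfolding e by simp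
      also have "\<dots> = poly E (of_int a) - poly E (of_int (a - 1))" using E'[of "of_int (a - 1)"] by simp
      finally show ?case using step2 by simp
    qed
    have "of_int (G q) = poly ([:of_int (G r) - poly E 0:] + pcompose E [:- of_int r / of_int L, 1 / of_int L:]) (of_int q)"
      if q: "q mod L = r" for q
    proof -
      define a where "a = q div L"
      have qa: "q = r + L * a" using q unfolding a_def by (metis mod_mult_div_eq)
      have "(of_int q - of_int r) / of_int L = (of_int a :: rat)" using L unfolding qa by simp
      then show ?thesis using Ga[of a] L unfolding qa[symmetric]
        by (simp add: poly_pcompose diff_divide_distrib algebra_simps)
    qed
    then show ?thesis by blast
  qed
  then obtain Q where "\<And>r q. q mod L = r \<Longrightarrow> of_int (G q) = poly (Q r) (of_int q :: rat)" by metis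
  then show ?thesis unfolding quasi_polynomial_def using L by blast
qed

text \<open>The slack in the inequality is the distance to the wall of \<theta>, which has
  coefficient \<open>1\<close> in the linear relation; so the cardinality is the restricted
  partition function with parts \<open>1\<close> and all \<open>c s\<close>.\<close>

definition solutions :: "'b set \<Rightarrow> ('b \<Rightarrow> nat) \<Rightarrow> int \<Rightarrow> ('b \<Rightarrow> nat) set" where
  "solutions S c N = {t \<in> PiE S (\<lambda>_. UNIV). int (\<Sum>s\<in>S. c s * t s) \<le> N}"

lemma finite_solutions:
  assumes "finite S" "\<And>s. s \<in> S \<Longrightarrow> c s > 0"
  shows "finite (solutions S c N)"
proof (rule finite_subset)
  show "solutions S c N \<subseteq> PiE S (\<lambda>_. {..nat N})"
  proof
    fix t assume t: "t \<in> solutions S c N"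
    have "t s \<le> nat N" if s: "s \<in> S" for s
    proof -
      have "t s \<le> c s * t s" using assms(2)[OF s] by simp
      also have "c s * t s \<le> (\<Sum>s\<in>S. c s * t s)"
        by (rule member_le_sum[of s S "\<lambda>s. c s * t s"]) (use s assms in auto)
      also have "\<dots> \<le> nat N"
      proof -
        have "int (\<Sum>s\<in>S. c s * t s) \<le> N" using t unfolding solutions_def by blast
        then show ?thesis by linarith
      qed
      finally show ?thesis .
    qed
    then show "t \<in> PiE S (\<lambda>_. {..nat N})" using t unfolding solutions_def by auto
  qed
  show "finite (PiE S (\<lambda>_. {..nat N}))" by (rule finite_PiE) (use assms in auto)
qed

lemma card_solutions_insert:
  assumes fin: "finite S" and s: "s \<notin> S" and c: "\<And>a. a \<in> insert s S \<Longrightarrow> c a > 0" and N: "N \<ge> 0"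
  shows "card (solutions (insert s S) c N) =
    (\<Sum>j\<le>nat (N div int (c s)). card (solutions S c (N - int (c s) * int j)))"
proof -
  let ?J = "{..nat (N div int (c s))}"
  let ?A = "Sigma ?J (\<lambda>j. solutions S c (N - int (c s) * int j))"
  let ?f = "\<lambda>(y, g). g(s := y)"
  have cs: "c s > 0" using c by auto
  have sum_upd: "(\<Sum>a\<in>insert s S. c a * (g(s := y)) a) = c s * y + (\<Sum>a\<in>S. c a * g a)" for g y
  proof -
    have "(\<Sum>a\<in>S. c a * (g(s := y)) a) = (\<Sum>a\<in>S. c a * g a)" by (rule sum.cong) (use s in auto)
    then show ?thesis using fin s by simp
  qed
  have "solutions (insert s S) c N = ?f ` ?A"
  proof (intro equalityI subsetI)
    fix t assume t: "t \<in> solutions (insert s S) c N"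
    then obtain y g where yg: "g \<in> PiE S (\<lambda>_. UNIV)" "t = g(s := y)"
      unfolding solutions_def PiE_insert_eq by auto
    have "int (\<Sum>a\<in>insert s S. c a * (g(s := y)) a) \<le> N"
      using t unfolding solutions_def yg(2) by blast
    then have le: "int (c s) * int y + int (\<Sum>a\<in>S. c a * g a) \<le> N"
      unfolding sum_upd by simp
    moreover have "int (\<Sum>a\<in>S. c a * g a) \<ge> 0" by (rule of_nat_0_le_iff)
    ultimately have "int (c s) * int y \<le> N" by linarith
    then have "int y \<le> N div int (c s)"
      using zdiv_mono1[of "int (c s) * int y" N "int (c s)"] cs by simp
    then have "y \<in> ?J" by simp
    then show "t \<in> ?f ` ?A" using yg le unfolding solutions_def
      by (intro image_eqI[of _ _ "(y, g)"]) auto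
  next
    fix t assume "t \<in> ?f ` ?A"
    then obtain y g where yg: "y \<in> ?J" "g \<in> solutions S c (N - int (c s) * int y)" "t = g(s := y)" by auto
    then have "int (\<Sum>a\<in>S. c a * g a) \<le> N - int (c s) * int y"
      unfolding solutions_def by blast
    then have "int (\<Sum>a\<in>insert s S. c a * (g(s := y)) a) \<le> N" unfolding sum_upd by simp
    moreover have "g(s := y) \<in> PiE (insert s S) (\<lambda>_. UNIV)"
      using yg unfolding solutions_def PiE_insert_eq by auto
    ultimately show "t \<in> solutions (insert s S) c N"
      unfolding solutions_def yg(3) by blast
  qed
  moreover have "inj_on ?f ?A"
    by (rule inj_on_subset[OF inj_combinator[OF s, of "\<lambda>_. UNIV"]]) (auto simp: solutions_def)
  ultimately have "card (solutions (insert s S) c N) = card ?A" by (simp add: card_image)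
  also have "\<dots> = (\<Sum>j\<in>?J. card (solutions S c (N - int (c s) * int j)))"
    by (rule card_SigmaI) (use fin c in \<open>auto intro: finite_solutions\<close>)
  finally show ?thesis .
qed

text \<open>Sorting by the value at a new index \<open>s\<close> sums the previous counts at
  \<open>N\<close>, \<open>N - c s\<close>, and so on; the new count is an antidifference with step
  \<open>c s\<close>.\<close>

lemma quasi_polynomial_solutions:
  assumes "finite S" "\<And>s. s \<in> S \<Longrightarrow> c s > 0"
  shows "\<exists>g. quasi_polynomial g \<and> (\<forall>N\<ge>0. g N = int (card (solutions S c N)))"
  using assms
proof (induction S rule: finite_induct)
  case empty
  have "solutions {} c N = {\<lambda>_. undefined}" if "N \<ge> 0" for N
    using that unfolding solutions_def by auto
  moreover have "quasi_polynomial (\<lambda>_. 1)"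
    unfolding quasi_polynomial_def by (intro exI[of _ 1] conjI exI[of _ "\<lambda>_. 1"]) auto
  ultimately show ?case by (intro exI[of _ "\<lambda>_. 1"]) auto
next
  case (insert s S)
  then obtain g where g: "quasi_polynomial g" "\<And>N. N \<ge> 0 \<Longrightarrow> g N = int (card (solutions S c N))" by auto
  define d where "d = int (c s)"
  have d: "d > 0" using insert.prems unfolding d_def by auto
  \<comment> \<open>For negative \<open>N\<close> the sum is continued backwards, with the usual
    sign convention, rather than cut off at zero: the recurrence must hold on all integers.\<close>
  define G where "G N = (if N div d \<ge> 0 then \<Sum>i\<in>{0..N div d}. g (N mod d + d * i)
    else - (\<Sum>i\<in>{N div d<..<0}. g (N mod d + d * i)))" for N
  have "quasi_polynomial G"
  proof (rule quasi_polynomial_antidifference[OF g(1) d])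
    fix N
    define a r where "a = N div d" and "r = N mod d"
    have N: "N = r + d * a" unfolding a_def r_def by simp
    have m: "(N - d) div d = a - 1" "(N - d) mod d = r"
      using d div_mult_self1[of d N "-1"] unfolding a_def r_def by simp_all
    consider "a > 0" | "a = 0" | "a < 0" by linarith
    then show "G N - G (N - d) = g N"
    proof cases
      case 1
      have "{0..a} = insert a {0..a - 1}" using 1 by auto
      then show ?thesis using 1 N unfolding G_def m a_def[symmetric] r_def[symmetric] by simp
    next
      case 2
      moreover have "{- 1<..<0::int} = {}" by auto
      ultimately show ?thesis using N unfolding G_def m a_def[symmetric] r_def[symmetric] by simp
    next
      case 3
      have "{a - 1<..<0} = insert a {a<..<0}" using 3 by auto
      then show ?thesis using 3 N unfolding G_def m a_def[symmetric] r_def[symmetric] by simp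
    qed
  qed
  moreover have "G N = int (card (solutions (insert s S) c N))" if N: "N \<ge> 0" for N
  proof -
    have a: "N div d \<ge> 0" using N d by (simp add: pos_imp_zdiv_nonneg_iff)
    have "int (card (solutions (insert s S) c N)) = (\<Sum>j\<le>nat (N div d). int (card (solutions S c (N - d * int j))))"
      unfolding d_def by (subst card_solutions_insert[OF insert.hyps insert.prems N]) auto
    also have "\<dots> = (\<Sum>i\<in>{0..N div d}. g (N mod d + d * i))"
    proof (rule sum.reindex_bij_witness[where i = "\<lambda>i. nat (N div d - i)" and j = "\<lambda>j. N div d - int j"])
      fix j assume j: "j \<in> {..nat (N div d)}"
      show "nat (N div d - (N div d - int j)) = j" by simp
      show "N div d - int j \<in> {0..N div d}" using j a by auto
      have e: "N mod d + d * (N div d - int j) = N - d * int j"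
        using mod_mult_div_eq[of N d] by (simp add: algebra_simps)
      have "d * (N div d - int j) \<ge> 0" using j a d by (intro mult_nonneg_nonneg) auto
      then have "N - d * int j \<ge> 0" unfolding e[symmetric] using d by (intro add_nonneg_nonneg) auto
      then show "g (N mod d + d * (N div d - int j)) = int (card (solutions S c (N - d * int j)))"
        unfolding e by (rule g(2))
    qed (use a in auto)
    finally show ?thesis using a unfolding G_def by simp
  qed
  ultimately show ?case by blast
qed

section \<open>Reflections and Coxeter words\<close>

lemma reflection_linear: "linear (reflection a)"
  by (rule linearI) (simp_all add: reflection_def inner_right_distrib algebra_simps add_divide_distrib)

lemma reflection_inner_swap: "reflection a x \<bullet> y = x \<bullet> reflection a y"
  by (simp add: reflection_def inner_diff_left inner_diff_right inner_commute)

lemma reflection_reflection [simp]: "reflection a (reflection a x) = x"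
  by (cases "a = 0") (simp_all add: reflection_def inner_diff_right divide_simps)

lemma reflection_self [simp]: "reflection a a = - a"
  by (cases "a = 0") (simp_all add: reflection_def scaleR_2)

lemma reflection_fixes: "a \<bullet> x = 0 \<Longrightarrow> reflection a x = x"
  by (simp add: reflection_def)

lemma orthogonal_transformation_reflection: "orthogonal_transformation (reflection a)"
  unfolding orthogonal_transformation_def
  by (simp add: reflection_linear reflection_inner_swap)

lemma reflection_commute:
  assumes "a \<bullet> b = 0" shows "reflection a (reflection b x) = reflection b (reflection a x)"
  using assms by (simp add: reflection_def inner_diff_right inner_commute algebra_simps)

lemma reflection_transform:
  assumes "orthogonal_transformation w"
  shows "reflection (w a) (w x) = w (reflection a x)"
  using assms unfolding orthogonal_transformation_def reflection_def
  by (simp add: linear_diff linear_scale)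

lemma sum_in_Nats:
  fixes f :: "'b \<Rightarrow> 'c::semiring_1"
  shows "(\<And>a. a \<in> A \<Longrightarrow> f a \<in> \<nat>) \<Longrightarrow> sum f A \<in> \<nat>"
  by (induction A rule: infinite_finite_induct) auto

lemma coxeter_element_simps [simp]:
  fixes a :: "'a::euclidean_space" and as bs :: "'a list"
  shows "coxeter_element [] = (id :: 'a \<Rightarrow> 'a)"
  and "coxeter_element (a # as) = reflection a \<circ> coxeter_element as"
  and "coxeter_element (as @ bs) = coxeter_element as \<circ> coxeter_element bs"
proof -
  show 1: "coxeter_element [] = (id :: 'a \<Rightarrow> 'a)" by (simp add: coxeter_element_def)
  have 2: "coxeter_element (c # cs) = reflection c \<circ> coxeter_element cs" for c :: 'a and cs
    by (simp add: coxeter_element_def)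
  then show "coxeter_element (a # as) = reflection a \<circ> coxeter_element as" by blast
  show "coxeter_element (as @ bs) = coxeter_element as \<circ> coxeter_element bs"
    by (induction as) (simp_all only: append.simps 1 2 comp_assoc id_comp)
qed

lemma orthogonal_coxeter_element: "orthogonal_transformation (coxeter_element as)"
proof (induction as)
  case (Cons a as)
  then show ?case
    using orthogonal_transformation_compose[OF orthogonal_transformation_reflection Cons]
    by (simp add: comp_def)
qed (simp add: id_def)

section \<open>Words in reflections up to rotation and commutation\<close>

lemma funpow_conjugate:
  assumes "s \<circ> s = id" shows "(s \<circ> w) ^^ m = s \<circ> (w \<circ> s) ^^ m \<circ> s"
proof (induction m)
  case (Suc m)
  have "(s \<circ> w) ^^ Suc m = s \<circ> w \<circ> (s \<circ> (w \<circ> s) ^^ m \<circ> s)"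
    by (simp only: Suc funpow.simps)
  then show ?case by (simp only: comp_assoc funpow.simps)
qed (simp add: assms)

text \<open>Rotation conjugates the product by its first reflection and a swap does not change it,
  so the order of the product is invariant. Words, unlike group elements, permit an induction that
  deletes a letter.\<close>

inductive cox_eq :: "'a::euclidean_space list \<Rightarrow> 'a list \<Rightarrow> bool" where
  idle: "cox_eq xs xs"
| comp_eq: "cox_eq xs ys \<Longrightarrow> cox_eq ys zs \<Longrightarrow> cox_eq xs zs"
| rot: "cox_eq (x # xs) (xs @ [x])"
| swp: "x \<bullet> y = 0 \<Longrightarrow> cox_eq (us @ x # y # vs) (us @ y # x # vs)"

lemma cox_eq_append: "cox_eq (xs @ ys) (ys @ xs)"
proof (induction xs arbitrary: ys)
  case (Cons x xs)
  have "cox_eq ((x # xs) @ ys) (xs @ (ys @ [x]))" using cox_eq.rot[of x "xs @ ys"] by simp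
  from cox_eq.comp_eq[OF this Cons[of "ys @ [x]"]] show ?case by simp
qed (simp add: cox_eq.idle)

lemma cox_eq_sym: "cox_eq xs ys \<Longrightarrow> cox_eq ys xs"
proof (induction rule: cox_eq.induct)
  case (rot x xs)
  show ?case using cox_eq_append[of xs "[x]"] by simp
next
  case (swp x y us vs)
  then show ?case by (intro cox_eq.swp) (simp add: inner_commute)
next
  case (comp_eq xs ys zs)
  show ?case by (rule cox_eq.comp_eq[OF comp_eq.IH(2,1)])
qed (rule cox_eq.idle)

lemma cox_eq_set: "cox_eq xs ys \<Longrightarrow> set ys = set xs \<and> distinct ys = distinct xs"
  by (induction rule: cox_eq.induct) auto

lemma cox_eq_power:
  "cox_eq xs ys \<Longrightarrow> coxeter_element xs ^^ m = id \<longleftrightarrow> coxeter_element ys ^^ m = id"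
proof (induction rule: cox_eq.induct)
  case (rot x xs)
  have ss: "reflection x \<circ> reflection x = id" by (rule ext) simp
  have "f = id \<longleftrightarrow> reflection x \<circ> f \<circ> reflection x = id" for f
  proof
    assume "reflection x \<circ> f \<circ> reflection x = id"
    then have "reflection x \<circ> (reflection x \<circ> f \<circ> reflection x) \<circ> reflection x = id" using ss by simp
    then show "f = id" by (simp add: fun_eq_iff)
  qed (use ss in simp)
  then show ?case
    by (simp only: coxeter_element_simps comp_id
        funpow_conjugate[OF ss, where w = "coxeter_element xs" and m = m])
next
  case (swp x y us vs)
  have "coxeter_element (us @ x # y # vs) = coxeter_element (us @ y # x # vs)"
    by (rule ext) (simp add: reflection_commute[OF swp])
  then show ?case by simp
qed auto

lemma cox_eq_move:
  "(\<And>y. y \<in> set ys \<Longrightarrow> s \<bullet> y = 0) \<Longrightarrow> cox_eq (us @ s # ys) (us @ ys @ [s])"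
proof (induction ys arbitrary: us)
  case (Cons y ys)
  have "cox_eq (us @ s # y # ys) ((us @ [y]) @ s # ys)"
    using cox_eq.swp[of s y us ys] Cons.prems by simp
  moreover have "cox_eq ((us @ [y]) @ s # ys) ((us @ [y]) @ ys @ [s])"
    by (rule Cons.IH) (use Cons.prems in auto)
  ultimately have "cox_eq (us @ s # y # ys) ((us @ [y]) @ ys @ [s])" by (rule cox_eq.comp_eq)
  then show ?case by simp
qed (simp add: cox_eq.idle)

text \<open>Here \<open>s\<close> is a leaf of the Dynkin diagram with only neighbour
  \<open>t\<close>. It commutes with all other letters, so every move on \<open>xs\<close> can be
  imitated with \<open>s\<close> in front.\<close>

lemma cox_eq_leaf:
  assumes "cox_eq xs ys" "distinct xs" "\<And>x. x \<in> set xs \<Longrightarrow> x \<noteq> t \<Longrightarrow> s \<bullet> x = 0"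
  shows "cox_eq (s # xs) (s # ys)"
  using assms
proof (induction rule: cox_eq.induct)
  case (comp_eq xs ys zs)
  then show ?case using cox_eq_set[OF comp_eq.hyps(1)] by (auto intro: cox_eq.comp_eq)
next
  case (rot x xs)
  show ?case
  proof (cases "s \<bullet> x = 0")
    case True
    then have "cox_eq (s # x # xs) (x # s # xs)" using cox_eq.swp[of s x "[]" xs] by simp
    moreover have "cox_eq (x # s # xs) (s # xs @ [x])"
      using cox_eq.rot[of x "s # xs"] by simp
    ultimately show ?thesis by (rule cox_eq.comp_eq)
  next
    case False
    \<comment> \<open>Rotate \<open>s\<close> to the end, pull it back through \<open>xs\<close>,
      which does not contain its neighbour because the word is distinct, and then rotate
      \<open>x\<close>.\<close>
    then have "x = t" using rot by auto
    then have "cox_eq ([x] @ s # xs) ([x] @ xs @ [s])"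
      by (intro cox_eq_move) (use rot in auto)
    then have m: "cox_eq (x # xs @ [s]) (x # s # xs)" using cox_eq_sym by simp
    have "cox_eq (s # x # xs) (x # xs @ [s])" using cox_eq.rot[of s "x # xs"] by simp
    note cox_eq.comp_eq[OF this m]
    moreover have "cox_eq (x # s # xs) (s # xs @ [x])"
      using cox_eq.rot[of x "s # xs"] by simp
    ultimately show ?thesis by (rule cox_eq.comp_eq)
  qed
next
  case (swp x y us vs)
  then show ?case using cox_eq.swp[of x y "s # us" vs] by simp
qed (rule cox_eq.idle)

text \<open>First-order condition at a minimum, for the extremal vector in \<open>perron\<close>.
  Near \<open>0\<close> the linear term wins, and \<open>t = - b / d\<close> with
  \<open>d > c\<close> is near enough.\<close>

lemma linear_coeff_zero_if_nonneg:
  fixes b c :: real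
  assumes "\<And>t. 0 \<le> 2 * t * b + t\<^sup>2 * c" shows "b = 0"
proof (rule ccontr)
  assume b: "b \<noteq> 0"
  define d where "d = \<bar>c\<bar> + 1"
  have d: "d > 0" "c < d" unfolding d_def by auto
  have "0 \<le> 2 * (- b / d) * b + (- b / d)\<^sup>2 * c" by (rule assms)
  also have "(- b / d)\<^sup>2 * c \<le> (- b / d)\<^sup>2 * d" using d by (intro mult_left_mono) auto
  also have "2 * (- b / d) * b + (- b / d)\<^sup>2 * d = - (b\<^sup>2 / d)"
    using d by (simp add: field_simps power2_eq_square)
  finally have "b\<^sup>2 / d \<le> 0" by simp
  moreover have "b\<^sup>2 / d > 0" using b d by simp
  ultimately show False by linarith
qed

text \<open>Each reflection fixes what the others subtract, so the corrections add up. This computes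
  the product over one colour class.\<close>

lemma orthogonal_word:
  assumes "distinct as" "\<And>a b. a \<in> set as \<Longrightarrow> b \<in> set as \<Longrightarrow> a \<noteq> b \<Longrightarrow> a \<bullet> b = 0"
  shows "coxeter_element as x = x - (\<Sum>a\<in>set as. (2 * (a \<bullet> x) / (a \<bullet> a)) *\<^sub>R a)"
  using assms
proof (induction as)
  case (Cons d as)
  have "reflection d ((2 * (a \<bullet> x) / (a \<bullet> a)) *\<^sub>R a) = (2 * (a \<bullet> x) / (a \<bullet> a)) *\<^sub>R a"
    if "a \<in> set as" for a
    using Cons.prems that by (intro reflection_fixes) auto
  then have "(\<Sum>a\<in>set as. reflection d ((2 * (a \<bullet> x) / (a \<bullet> a)) *\<^sub>R a)) =
      (\<Sum>a\<in>set as. (2 * (a \<bullet> x) / (a \<bullet> a)) *\<^sub>R a)" by (intro sum.cong) auto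
  then have "reflection d (x - (\<Sum>a\<in>set as. (2 * (a \<bullet> x) / (a \<bullet> a)) *\<^sub>R a)) =
      reflection d x - (\<Sum>a\<in>set as. (2 * (a \<bullet> x) / (a \<bullet> a)) *\<^sub>R a)"
    by (simp only: linear_diff[OF reflection_linear] linear_sum[OF reflection_linear])
  moreover have "coxeter_element as x = x - (\<Sum>a\<in>set as. (2 * (a \<bullet> x) / (a \<bullet> a)) *\<^sub>R a)"
    using Cons by auto
  ultimately have "coxeter_element (d # as) x =
      reflection d x - (\<Sum>a\<in>set as. (2 * (a \<bullet> x) / (a \<bullet> a)) *\<^sub>R a)" by simp
  then show ?case using Cons.prems(1) by (simp add: reflection_def)
qed simp

lemma coxeter_element_power:
  "coxeter_element as ^^ m = coxeter_element (concat (replicate m as))"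
  by (induction m) (simp_all only: replicate.simps concat.simps coxeter_element_simps funpow.simps)

lemma finite_has_max:
  fixes f :: "'b \<Rightarrow> real"
  assumes "finite S" "S \<noteq> {}"
  obtains x where "x \<in> S" "\<And>y. y \<in> S \<Longrightarrow> f y \<le> f x"
proof -
  have "Max (f ` S) \<in> f ` S" using assms by simp
  then obtain x where "x \<in> S" "f x = Max (f ` S)" by auto
  then show ?thesis using assms that by (metis Max_ge finite_imageI imageI)
qed

section \<open>Root systems with a base\<close>

locale based_roots =
  fixes \<Phi> \<Delta> :: "'a::euclidean_space set"
  assumes root_sys: "root_system \<Phi>" and base: "simple_roots \<Phi> \<Delta>"
begin

text \<open>Fundamental coweights, the basis dual to the simple roots:
  \<open>x \<bullet> \<omega> a\<close> reads off root coordinates, and signs and supports of roots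
  are phrased through these pairings.\<close>

definition \<omega> :: "'a \<Rightarrow> 'a" where
  "\<omega> a = (SOME v. \<forall>b\<in>\<Delta>. b \<bullet> v = (if b = a then 1 else 0))"

definition \<rho> :: 'a where "\<rho> = (\<Sum>a\<in>\<Delta>. \<omega> a)"

abbreviation Pos :: "'a set" where "Pos \<equiv> positive_roots \<Phi> \<Delta>"

lemma finite_roots: "finite \<Phi>"
  and roots_nonzero: "0 \<notin> \<Phi>"
  and span_roots: "span \<Phi> = UNIV"
  and roots_reduced: "a \<in> \<Phi> \<Longrightarrow> \<Phi> \<inter> span {a} = {a, - a}"
  and reflection_image: "a \<in> \<Phi> \<Longrightarrow> reflection a ` \<Phi> = \<Phi>"
  and roots_integral: "a \<in> \<Phi> \<Longrightarrow> b \<in> \<Phi> \<Longrightarrow> 2 * (a \<bullet> b) / (a \<bullet> a) \<in> \<int>"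
  using root_sys unfolding root_system_def by blast+

lemma simple_subset: "\<Delta> \<subseteq> \<Phi>"
  and simple_indep: "independent \<Delta>"
  and span_simple: "span \<Delta> = UNIV"
  and pos_or_neg: "b \<in> \<Phi> \<Longrightarrow> b \<in> nonneg_combinations \<Delta> \<or> - b \<in> nonneg_combinations \<Delta>"
  using base unfolding simple_roots_def by blast+

lemma finite_simple: "finite \<Delta>"
  using simple_subset finite_roots finite_subset by blast

lemma card_simple: "card \<Delta> = DIM('a)"
  using simple_indep span_simple by (metis dim_UNIV dim_eq_card_independent dim_span)

lemma reflection_root: "a \<in> \<Phi> \<Longrightarrow> b \<in> \<Phi> \<Longrightarrow> reflection a b \<in> \<Phi>"
  using reflection_image by blast

lemma uminus_root: "a \<in> \<Phi> \<Longrightarrow> - a \<in> \<Phi>"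
  using reflection_root[of a a] by simp

lemma inner_root_pos: "a \<in> \<Phi> \<Longrightarrow> a \<bullet> a > 0"
  using roots_nonzero by auto

lemma root_eq_scale: "a \<in> \<Phi> \<Longrightarrow> c *\<^sub>R a \<in> \<Phi> \<Longrightarrow> c = 1 \<or> c = -1"
proof -
  assume a: "a \<in> \<Phi>" and "c *\<^sub>R a \<in> \<Phi>"
  then have "c *\<^sub>R a \<in> {a, - a}" using roots_reduced[OF a] by (auto simp: span_singleton)
  moreover have "a \<noteq> 0" using a roots_nonzero by auto
  ultimately show ?thesis
    using scaleR_cancel_right[of c a 1] scaleR_cancel_right[of c a "-1"] by auto
qed

lemma ex_dual_vector: "\<exists>v. \<forall>b\<in>\<Delta>. b \<bullet> v = (g b :: real)"
proof -
  obtain f :: "'a \<Rightarrow> real" where f: "linear f" "\<forall>b\<in>\<Delta>. f b = g b"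
    using linear_independent_extend[OF simple_indep, of g] by blast
  have "x \<bullet> adjoint f 1 = f x" for x
    using adjoint_works[OF f(1), of x 1] by simp
  with f(2) show ?thesis by (intro exI[of _ "adjoint f 1"]) auto
qed

lemma simple_omega: "a \<in> \<Delta> \<Longrightarrow> b \<in> \<Delta> \<Longrightarrow> b \<bullet> \<omega> a = (if b = a then 1 else 0)"
  unfolding \<omega>_def using someI_ex[OF ex_dual_vector[of "\<lambda>b. if b = a then 1 else 0"]] by blast

lemma simple_rho: "b \<in> \<Delta> \<Longrightarrow> b \<bullet> \<rho> = 1"
  unfolding \<rho>_def using finite_simple by (simp add: inner_sum_right simple_omega)

lemma expansion: "(\<Sum>a\<in>\<Delta>. (x \<bullet> \<omega> a) *\<^sub>R a) = x"
proof -
  have l: "linear (\<lambda>x. \<Sum>a\<in>\<Delta>. (x \<bullet> \<omega> a) *\<^sub>R a)"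
    by (rule linearI) (simp_all add: inner_add_left scaleR_left_distrib sum.distrib scaleR_sum_right)
  have "x \<in> span \<Delta>" using span_simple by auto
  moreover have "(\<Sum>a\<in>\<Delta>. (b \<bullet> \<omega> a) *\<^sub>R a) = b" if "b \<in> \<Delta>" for b
  proof -
    have "(\<Sum>a\<in>\<Delta>. (b \<bullet> \<omega> a) *\<^sub>R a) = (\<Sum>a\<in>\<Delta>. if a = b then a else 0)"
      by (rule sum.cong) (use that simple_omega in auto)
    then show ?thesis using that finite_simple by simp
  qed
  ultimately show ?thesis using linear_eq_on[OF l linear_ident] by blast
qed

lemma inner_expansion: "x \<bullet> y = (\<Sum>a\<in>\<Delta>. (x \<bullet> \<omega> a) * (a \<bullet> y))"
  using arg_cong[OF expansion[of x], of "\<lambda>u. u \<bullet> y"] by (simp add: inner_sum_left)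

lemma simple_eqI: "(\<And>a. a \<in> \<Delta> \<Longrightarrow> a \<bullet> x = a \<bullet> y) \<Longrightarrow> x = y"
proof -
  assume *: "\<And>a. a \<in> \<Delta> \<Longrightarrow> a \<bullet> x = a \<bullet> y"
  have "z \<bullet> x = z \<bullet> y" for z
    unfolding inner_expansion[of z x] inner_expansion[of z y] using * by simp
  then show "x = y" using vector_eq_ldot[of x y] by blast
qed

lemma coweight_eqI: "(\<And>a. a \<in> \<Delta> \<Longrightarrow> x \<bullet> \<omega> a = y \<bullet> \<omega> a) \<Longrightarrow> x = y"
proof -
  assume *: "\<And>a. a \<in> \<Delta> \<Longrightarrow> x \<bullet> \<omega> a = y \<bullet> \<omega> a"
  have "(\<Sum>a\<in>\<Delta>. (x \<bullet> \<omega> a) *\<^sub>R a) = (\<Sum>a\<in>\<Delta>. (y \<bullet> \<omega> a) *\<^sub>R a)"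
    by (rule sum.cong) (use * in auto)
  then show "x = y" by (simp only: expansion)
qed

lemma simple_coweight_sum: "a \<in> \<Delta> \<Longrightarrow> a \<bullet> (\<Sum>b\<in>\<Delta>. c b *\<^sub>R \<omega> b) = c a"
proof -
  assume a: "a \<in> \<Delta>"
  have "a \<bullet> (\<Sum>b\<in>\<Delta>. c b *\<^sub>R \<omega> b) = (\<Sum>b\<in>\<Delta>. if b = a then c b else 0)"
    unfolding inner_sum_right by (rule sum.cong) (use a simple_omega in auto)
  then show ?thesis using a finite_simple by simp
qed

lemma finite_simple_coordinates:
  assumes "finite F" shows "finite {x. \<forall>a\<in>\<Delta>. a \<bullet> x \<in> F}"
proof -
  define r where "r x = restrict (\<lambda>a. a \<bullet> x) \<Delta>" for x
  have "r ` {x. \<forall>a\<in>\<Delta>. a \<bullet> x \<in> F} \<subseteq> PiE \<Delta> (\<lambda>_. F)" unfolding r_def by auto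
  moreover have "finite (PiE \<Delta> (\<lambda>_. F))" using finite_simple assms by (intro finite_PiE) auto
  ultimately have "finite (r ` {x. \<forall>a\<in>\<Delta>. a \<bullet> x \<in> F})" by (rule finite_subset)
  moreover have "inj r"
  proof (rule injI)
    fix x y assume "r x = r y"
    then have "r x a = r y a" for a by simp
    then have "a \<bullet> x = a \<bullet> y" if "a \<in> \<Delta>" for a
      using that unfolding r_def by (metis restrict_apply')
    then show "x = y" by (rule simple_eqI)
  qed
  ultimately show ?thesis using finite_imageD inj_on_subset by blast
qed

section \<open>Positive roots and simple reflections\<close>

lemma nonneg_combinations_iff: "x \<in> nonneg_combinations \<Delta> \<longleftrightarrow> (\<forall>a\<in>\<Delta>. x \<bullet> \<omega> a \<in> \<nat>)"
proof
  assume "x \<in> nonneg_combinations \<Delta>"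
  then obtain c :: "'a \<Rightarrow> nat" where x: "x = (\<Sum>a\<in>\<Delta>. real (c a) *\<^sub>R a)"
    unfolding nonneg_combinations_def by auto
  have "x \<bullet> \<omega> a = c a" if "a \<in> \<Delta>" for a
  proof -
    have "x \<bullet> \<omega> a = (\<Sum>b\<in>\<Delta>. if b = a then real (c b) else 0)"
      unfolding x inner_sum_left by (rule sum.cong) (use that simple_omega in auto)
    then show ?thesis using that finite_simple by simp
  qed
  then show "\<forall>a\<in>\<Delta>. x \<bullet> \<omega> a \<in> \<nat>" by simp
next
  assume h: "\<forall>a\<in>\<Delta>. x \<bullet> \<omega> a \<in> \<nat>"
  then have "\<forall>a\<in>\<Delta>. \<exists>c. x \<bullet> \<omega> a = real c" by (auto elim!: Nats_cases)
  from bchoice[OF this] obtain c where c: "\<And>a. a \<in> \<Delta> \<Longrightarrow> x \<bullet> \<omega> a = real (c a)"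
    by auto
  have "(\<Sum>a\<in>\<Delta>. (x \<bullet> \<omega> a) *\<^sub>R a) = (\<Sum>a\<in>\<Delta>. real (c a) *\<^sub>R a)"
    by (rule sum.cong) (auto simp: c)
  then have "x = (\<Sum>a\<in>\<Delta>. real (c a) *\<^sub>R a)" by (simp only: expansion)
  then show "x \<in> nonneg_combinations \<Delta>" unfolding nonneg_combinations_def by auto
qed

lemma pos_root: "b \<in> Pos \<Longrightarrow> b \<in> \<Phi>"
  unfolding positive_roots_def by simp

lemma finite_pos: "finite Pos"
  using finite_roots unfolding positive_roots_def by simp

lemma pos_coeff: "b \<in> Pos \<Longrightarrow> a \<in> \<Delta> \<Longrightarrow> b \<bullet> \<omega> a \<in> \<nat>"
  unfolding positive_roots_def using nonneg_combinations_iff by auto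

lemma pos_coeff_nonneg: "b \<in> Pos \<Longrightarrow> a \<in> \<Delta> \<Longrightarrow> b \<bullet> \<omega> a \<ge> 0"
  using pos_coeff[of b a] by (auto elim!: Nats_cases)

lemma rho_inner: "b \<bullet> \<rho> = (\<Sum>a\<in>\<Delta>. b \<bullet> \<omega> a)"
  unfolding \<rho>_def by (simp add: inner_sum_right)

lemma pos_height: "b \<in> Pos \<Longrightarrow> b \<bullet> \<rho> \<ge> 1"
proof -
  assume b: "b \<in> Pos"
  have "b \<noteq> 0" using b pos_root roots_nonzero by auto
  then obtain a where a: "a \<in> \<Delta>" "b \<bullet> \<omega> a \<noteq> 0" using coweight_eqI[of b 0] by auto
  then have "b \<bullet> \<omega> a \<ge> 1" using pos_coeff[OF b a(1)] by (auto elim!: Nats_cases)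
  also have "b \<bullet> \<omega> a \<le> b \<bullet> \<rho>" unfolding rho_inner
    by (rule member_le_sum) (use a b pos_coeff_nonneg finite_simple in auto)
  finally show ?thesis .
qed

lemma pos_height_nat: "b \<in> Pos \<Longrightarrow> b \<bullet> \<rho> \<in> \<nat>"
  unfolding rho_inner by (rule sum_in_Nats) (rule pos_coeff)

lemma not_pos_iff: "b \<in> \<Phi> \<Longrightarrow> b \<notin> Pos \<longleftrightarrow> - b \<in> Pos"
  using pos_or_neg[of b] pos_height[of b] pos_height[of "- b"] uminus_root[of b]
  by (auto simp: positive_roots_def)

lemma pos_if_coeff: "b \<in> \<Phi> \<Longrightarrow> a \<in> \<Delta> \<Longrightarrow> b \<bullet> \<omega> a > 0 \<Longrightarrow> b \<in> Pos"
  using not_pos_iff[of b] pos_coeff_nonneg[of "- b" a] by force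

lemma simple_pos: "a \<in> \<Delta> \<Longrightarrow> a \<in> Pos"
  using pos_if_coeff[of a a] simple_subset simple_omega by auto

lemma root_coeff_int: "b \<in> \<Phi> \<Longrightarrow> a \<in> \<Delta> \<Longrightarrow> b \<bullet> \<omega> a \<in> \<int>"
  using not_pos_iff[of b] pos_coeff[of b a] pos_coeff[of "-b" a] Nats_subset_Ints
  by (metis Ints_minus inner_minus_left minus_minus subsetD)

lemma reflection_coeff:
  assumes "a \<in> \<Delta>" "d \<in> \<Delta>"
  shows "reflection a b \<bullet> \<omega> d = b \<bullet> \<omega> d - (if d = a then 2 * (a \<bullet> b) / (a \<bullet> a) else 0)"
  using assms by (auto simp: reflection_def inner_diff_left simple_omega)

lemma reflection_height:
  assumes "a \<in> \<Delta>" shows "reflection a b \<bullet> \<rho> = b \<bullet> \<rho> - 2 * (a \<bullet> b) / (a \<bullet> a)"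
  using assms by (simp add: reflection_def inner_diff_left simple_rho)

text \<open>The reflection changes only the coefficient of \<open>a\<close>. Since \<open>a\<close>
  and \<open>- a\<close> are the only roots on the line of \<open>a\<close>, some other coefficient
  of \<open>b\<close> is positive, and one positive coefficient decides the sign of a root.\<close>

lemma simple_reflection_pos:
  assumes a: "a \<in> \<Delta>" and b: "b \<in> Pos" and ne: "b \<noteq> a"
  shows "reflection a b \<in> Pos"
proof -
  have "\<exists>d\<in>\<Delta>. d \<noteq> a \<and> b \<bullet> \<omega> d > 0"
  proof (rule ccontr)
    assume "\<not> ?thesis"
    then have z: "b \<bullet> \<omega> d = 0" if "d \<in> \<Delta>" "d \<noteq> a" for d
      using that pos_coeff_nonneg[OF b that(1)] by force
    have b': "b = (b \<bullet> \<omega> a) *\<^sub>R a"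
      by (rule coweight_eqI) (use z a simple_omega in auto)
    then have "(b \<bullet> \<omega> a) *\<^sub>R a \<in> \<Phi>" using b pos_root by auto
    then have "b \<bullet> \<omega> a = 1 \<or> b \<bullet> \<omega> a = -1" using root_eq_scale[of a] a simple_subset by auto
    with pos_coeff_nonneg[OF b a] b' ne show False by auto
  qed
  then obtain d where d: "d \<in> \<Delta>" "d \<noteq> a" "b \<bullet> \<omega> d > 0" by auto
  show ?thesis
    by (rule pos_if_coeff[OF _ d(1)])
      (use d a b simple_subset pos_root reflection_root reflection_coeff[of a d b] in auto)
qed

text \<open>The positive root \<open>reflection a d\<close> has coefficient
  \<open>- 2 * (a \<bullet> d) / (a \<bullet> a)\<close> at \<open>a\<close>.\<close>

lemma simple_inner_nonpos:
  assumes "a \<in> \<Delta>" "d \<in> \<Delta>" "a \<noteq> d" shows "a \<bullet> d \<le> 0"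
proof -
  have "reflection a d \<in> Pos" using simple_reflection_pos simple_pos assms by auto
  from pos_coeff_nonneg[OF this assms(1)]
  have "2 * (a \<bullet> d) / (a \<bullet> a) \<le> 0" using assms reflection_coeff simple_omega by simp
  moreover have "a \<bullet> a > 0" using inner_root_pos assms simple_subset by blast
  ultimately show ?thesis by (simp only: divide_le_0_iff) linarith
qed

lemma pos_inner_simple: "b \<in> Pos \<Longrightarrow> \<exists>a\<in>\<Delta>. b \<bullet> \<omega> a > 0 \<and> a \<bullet> b > 0"
proof (rule ccontr)
  assume b: "b \<in> Pos" and n: "\<not> ?thesis"
  have "b \<bullet> b = (\<Sum>a\<in>\<Delta>. (b \<bullet> \<omega> a) * (a \<bullet> b))" by (rule inner_expansion)
  also have "\<dots> \<le> 0"
  proof (rule sum_nonpos)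
    fix a assume a: "a \<in> \<Delta>"
    show "(b \<bullet> \<omega> a) * (a \<bullet> b) \<le> 0"
      using n a pos_coeff_nonneg[OF b a] by (cases "b \<bullet> \<omega> a = 0") (auto simp: mult_le_0_iff)
  qed
  finally show False using inner_root_pos[OF pos_root[OF b]] by linarith
qed

text \<open>Reflecting in a simple root that has positive product with \<open>b\<close> lowers the
  height, a natural number.\<close>

lemma pos_root_induct [consumes 1, case_names simple reflect]:
  assumes "b \<in> Pos" and s: "\<And>a. a \<in> \<Delta> \<Longrightarrow> P a"
    and r: "\<And>a b. a \<in> \<Delta> \<Longrightarrow> b \<in> Pos \<Longrightarrow> P b \<Longrightarrow> P (reflection a b)"
  shows "P b"
  using assms(1)
proof (induction "nat \<lfloor>b \<bullet> \<rho>\<rfloor>" arbitrary: b rule: less_induct)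
  case less
  obtain a where a: "a \<in> \<Delta>" "a \<bullet> b > 0" using pos_inner_simple less.prems by auto
  show ?case
  proof (cases "b = a")
    case True then show ?thesis using s a by auto
  next
    case False
    have p: "reflection a b \<in> Pos" using simple_reflection_pos[OF a(1) less.prems False] .
    obtain i j :: nat where ij: "b \<bullet> \<rho> = i" "reflection a b \<bullet> \<rho> = j"
      using pos_height_nat[OF p] pos_height_nat[OF less.prems] by (auto elim!: Nats_cases)
    have "a \<bullet> a > 0" using inner_root_pos a simple_subset by auto
    then have "2 * (a \<bullet> b) / (a \<bullet> a) > 0" using a(2) by simp
    then have "j < i" using ij reflection_height[OF a(1), of b] by linarith
    then have "P (reflection a b)" using less.hyps[OF _ p] ij by auto
    from r[OF a(1) p this] show ?thesis by simp
  qed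
qed

text \<open>Both Cartan integers are positive, and strictness in Cauchy-Schwarz keeps their product
  below \<open>4\<close>; so one of them is \<open>1\<close>, and the corresponding reflection
  produces the difference up to sign.\<close>

lemma root_difference:
  assumes a: "a \<in> \<Phi>" and b: "b \<in> \<Phi>" and p: "a \<bullet> b > 0" and ne: "a \<noteq> b"
  shows "a - b \<in> \<Phi>"
proof -
  define m n where "m = 2 * (a \<bullet> b) / (a \<bullet> a)" and "n = 2 * (b \<bullet> a) / (b \<bullet> b)"
  have pa: "a \<bullet> a > 0" "b \<bullet> b > 0" using inner_root_pos a b by auto
  have pos: "m > 0" "n > 0" using p pa by (auto simp: m_def n_def inner_commute)
  have "(a \<bullet> b)\<^sup>2 \<noteq> (a \<bullet> a) * (b \<bullet> b)"
  proof
    assume eq: "(a \<bullet> b)\<^sup>2 = (a \<bullet> a) * (b \<bullet> b)"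
    define v where "v = b - ((a \<bullet> b) / (a \<bullet> a)) *\<^sub>R a"
    have "v \<bullet> v = b \<bullet> b - (a \<bullet> b)\<^sup>2 / (a \<bullet> a)"
      unfolding v_def using pa by (simp add: inner_diff_left inner_diff_right inner_commute power2_eq_square)
    then have "v \<bullet> v = 0" using eq pa by simp
    then have e: "b = ((a \<bullet> b) / (a \<bullet> a)) *\<^sub>R a" unfolding v_def by simp
    then have "(a \<bullet> b) / (a \<bullet> a) = 1 \<or> (a \<bullet> b) / (a \<bullet> a) = -1" using root_eq_scale[OF a] b by metis
    moreover have "(a \<bullet> b) / (a \<bullet> a) > 0" using p pa by simp
    ultimately have "(a \<bullet> b) / (a \<bullet> a) = 1" by linarith
    with e ne show False by simp
  qed
  then have "(a \<bullet> b)\<^sup>2 < (a \<bullet> a) * (b \<bullet> b)" using Cauchy_Schwarz_ineq[of a b] by auto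
  then have "m * n < 4" unfolding m_def n_def using pa
    by (simp add: field_simps inner_commute power2_eq_square)
  moreover obtain i j :: int where ij: "m = i" "n = j"
    using roots_integral[OF a b] roots_integral[OF b a] unfolding m_def n_def by (auto elim!: Ints_cases)
  ultimately have "i * j < 4" "i > 0" "j > 0" using pos by (auto simp flip: of_int_mult)
  have "i = 1 \<or> j = 1"
  proof (rule ccontr)
    assume "\<not> ?thesis"
    then have "i \<ge> 2" "j \<ge> 2" using \<open>i > 0\<close> \<open>j > 0\<close> by auto
    then have "2 * 2 \<le> i * j" by (intro mult_mono) auto
    then show False using \<open>i * j < 4\<close> by simp
  qed
  then show ?thesis
  proof
    assume "i = 1"
    then have "m = 1" using ij by simp
    then have "reflection a b = b - a" unfolding reflection_def m_def[symmetric] by simp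
    then have "b - a \<in> \<Phi>" using reflection_root[OF a b] by simp
    from uminus_root[OF this] show ?thesis by simp
  next
    assume "j = 1"
    then have "n = 1" using ij by simp
    then have "reflection b a = a - b" unfolding reflection_def n_def[symmetric] by simp
    then show ?thesis using reflection_root[OF b a] by simp
  qed
qed

section \<open>Symmetries of the root system and words in simple reflections\<close>

definition Sym :: "('a \<Rightarrow> 'a) set" where
  "Sym = {w. orthogonal_transformation w \<and> w ` \<Phi> = \<Phi>}"

lemma Sym_reflection: "a \<in> \<Phi> \<Longrightarrow> reflection a \<in> Sym"
  unfolding Sym_def using orthogonal_transformation_reflection reflection_image by auto

lemma Sym_id: "(\<lambda>x. x) \<in> Sym" "id \<in> Sym"
  unfolding Sym_def by (auto simp: id_def)

lemma Sym_compose: "v \<in> Sym \<Longrightarrow> w \<in> Sym \<Longrightarrow> v \<circ> w \<in> Sym"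
  unfolding Sym_def using orthogonal_transformation_compose by (auto simp flip: image_image)

lemma Sym_linear: "w \<in> Sym \<Longrightarrow> linear w"
  and Sym_inner: "w \<in> Sym \<Longrightarrow> w x \<bullet> w y = x \<bullet> y"
  and Sym_root: "w \<in> Sym \<Longrightarrow> b \<in> \<Phi> \<Longrightarrow> w b \<in> \<Phi>"
  and Sym_bij: "w \<in> Sym \<Longrightarrow> bij w"
  unfolding Sym_def using orthogonal_transformation_bij by (auto simp: orthogonal_transformation_def)

lemma Sym_inv: "w \<in> Sym \<Longrightarrow> inv w \<in> Sym"
  unfolding Sym_def using orthogonal_transformation_inv orthogonal_transformation_bij
  by (metis (mono_tags, lifting) bij_is_inj image_inv_f_f mem_Collect_eq)

lemma Sym_inv_cancel: "w \<in> Sym \<Longrightarrow> inv w (w x) = x" "w \<in> Sym \<Longrightarrow> w (inv w x) = x"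
  using Sym_bij by (simp_all add: bij_is_inj bij_is_surj surj_f_inv_f)

lemma Sym_adjoint: "w \<in> Sym \<Longrightarrow> x \<bullet> w y = inv w x \<bullet> y"
  by (metis Sym_inner Sym_inv_cancel(2))

lemma coxeter_element_Sym: "set as \<subseteq> \<Phi> \<Longrightarrow> coxeter_element as \<in> Sym"
  by (induction as) (auto intro: Sym_id Sym_compose Sym_reflection)

text \<open>Apply the letters to \<open>b\<close> from the right. Just before the first letter
  \<open>d\<close> that makes the image negative, the image is \<open>d\<close> itself; so
  \<open>reflection d\<close> passes through the letters to its right as \<open>reflection b\<close>
  and cancels the appended letter.\<close>

lemma exchange_condition:
  assumes "set as \<subseteq> \<Delta>" "b \<in> \<Delta>" "coxeter_element as b \<notin> Pos"
  shows "\<exists>cs. set cs \<subseteq> \<Delta> \<and> Suc (length cs) = length as \<and>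
    coxeter_element (as @ [b]) = coxeter_element cs"
  using assms
proof (induction as)
  case Nil
  then show ?case using simple_pos by simp
next
  case (Cons d as)
  let ?v = "coxeter_element as"
  show ?case
  proof (cases "?v b \<in> Pos")
    case False
    then obtain cs where "set cs \<subseteq> \<Delta>" "Suc (length cs) = length as"
      "coxeter_element (as @ [b]) = coxeter_element cs"
      using Cons.IH Cons.prems(1,2) by (metis insert_subset list.simps(15))
    moreover from this have "coxeter_element ((d # as) @ [b]) = coxeter_element (d # cs)"
      by (simp only: append_Cons coxeter_element_simps(2))
    ultimately show ?thesis using Cons.prems(1) by (intro exI[of _ "d # cs"]) auto
  next
    case True
    have "?v b = d"
      using simple_reflection_pos[of d "?v b"] True Cons.prems by auto
    then have c: "reflection d (?v x) = ?v (reflection b x)" for x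
      using reflection_transform[OF orthogonal_coxeter_element[of as], of b x] by simp
    have "coxeter_element ((d # as) @ [b]) = coxeter_element as"
      by (rule ext) (simp add: c)
    then show ?thesis using Cons.prems by (intro exI[of _ as]) auto
  qed
qed

text \<open>The last reflection negates its root \<open>a\<close>, so the rest of the word sends
  \<open>a\<close> to a negative root. The exchange condition then gives a word for the same map
  that is two letters shorter.\<close>

lemma positive_word_trivial:
  assumes "set as \<subseteq> \<Delta>" "\<And>b. b \<in> \<Delta> \<Longrightarrow> coxeter_element as b \<in> Pos"
  shows "coxeter_element as = id"
  using assms
proof (induction "length as" arbitrary: as rule: less_induct)
  case less
  show ?case
  proof (cases as rule: rev_cases)
    case (snoc bs a)
    have a: "a \<in> \<Delta>" and bs: "set bs \<subseteq> \<Delta>" using snoc less.prems by auto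
    have v: "coxeter_element bs a \<in> \<Phi>"
      using Sym_root[OF coxeter_element_Sym] a bs simple_subset by blast
    have "coxeter_element as a = - coxeter_element bs a"
      using linear_neg[OF orthogonal_transformation_linear[OF orthogonal_coxeter_element]]
      by (simp add: snoc)
    then have "coxeter_element bs a \<notin> Pos" using less.prems(2)[OF a] not_pos_iff[OF v] by simp
    from exchange_condition[OF bs a this] obtain cs where cs: "set cs \<subseteq> \<Delta>"
      "Suc (length cs) = length bs" "coxeter_element as = coxeter_element cs" using snoc by auto
    then show ?thesis using less.hyps[of cs] less.prems snoc by simp
  qed simp
qed

text \<open>A point of the open chamber detects the sign of a root, and
  \<open>w b \<bullet> p = w b \<bullet> w p = b \<bullet> p\<close>. This turns a computation at
  one point of the Coxeter plane into an identity of maps.\<close>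

lemma regular_fixed_trivial:
  assumes "set as \<subseteq> \<Delta>" and reg: "\<And>b. b \<in> Pos \<Longrightarrow> b \<bullet> p > 0"
    and fix_p: "coxeter_element as p = p"
  shows "coxeter_element as = id"
proof (rule positive_word_trivial[OF assms(1)])
  fix b assume b: "b \<in> \<Delta>"
  have S: "coxeter_element as \<in> Sym" using coxeter_element_Sym assms(1) simple_subset by blast
  have r: "coxeter_element as b \<in> \<Phi>" using Sym_root[OF S] b simple_subset by blast
  have "coxeter_element as b \<bullet> coxeter_element as p = b \<bullet> p" by (rule Sym_inner[OF S])
  then have "coxeter_element as b \<bullet> p > 0" using fix_p reg[OF simple_pos[OF b]] by simp
  then show "coxeter_element as b \<in> Pos"
    using not_pos_iff[OF r] reg[of "- coxeter_element as b"] by force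
qed

text \<open>The Dynkin diagram is a forest: if every vertex of \<open>S\<close> had two neighbours in \<open>S\<close>, the
  sum of the normalised simple roots in \<open>S\<close> would have length \<open>0\<close>.\<close>

lemma ex_leaf:
  assumes S: "S \<subseteq> \<Delta>" "S \<noteq> {}"
  shows "\<exists>s\<in>S. \<exists>t. \<forall>x\<in>S - {s}. x \<noteq> t \<longrightarrow> s \<bullet> x = 0"
proof (rule ccontr)
  assume n: "\<not> ?thesis"
  define e where "e x = x /\<^sub>R norm x" for x :: 'a
  have fS: "finite S" using S finite_simple finite_subset by auto
  have nz: "norm x > 0" if "x \<in> S" for x using that S simple_subset roots_nonzero by auto
  have ee: "e x \<bullet> e x = 1" if "x \<in> S" for x
    using nz[OF that] unfolding e_def by (simp add: dot_square_norm power2_eq_square)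
  have np: "e x \<bullet> e y \<le> 0" if "x \<in> S" "y \<in> S" "x \<noteq> y" for x y
    using simple_inner_nonpos[of x y] that S unfolding e_def by (auto simp: mult_le_0_iff)
  \<comment> \<open>The product of the two Cartan integers is
    \<open>4 * (e x \<bullet> e y)\<^sup>2\<close>, a positive integer.\<close>
  have half: "e x \<bullet> e y \<le> - 1/2" if xy: "x \<in> S" "y \<in> S" "x \<noteq> y" "x \<bullet> y \<noteq> 0" for x y
  proof -
    have "x \<bullet> y < 0" using simple_inner_nonpos[of x y] xy S by force
    then have neg: "e x \<bullet> e y < 0"
      using nz[OF xy(1)] nz[OF xy(2)] unfolding e_def
      by (auto simp: mult_less_0_iff zero_less_mult_iff)
    obtain i j :: int where i: "2 * (x \<bullet> y) / (x \<bullet> x) = i" and j: "2 * (y \<bullet> x) / (y \<bullet> y) = j"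
      using roots_integral[of x y] roots_integral[of y x] xy S simple_subset
      by (auto elim!: Ints_cases)
    have "of_int (i * j) = 4 * (e x \<bullet> e y)\<^sup>2"
      unfolding of_int_mult i[symmetric] j[symmetric] e_def
      by (simp add: dot_square_norm power2_eq_square inner_commute divide_simps)
    moreover have "4 * (e x \<bullet> e y)\<^sup>2 > 0" using neg by simp
    ultimately have "i * j > 0" by (simp flip: of_int_0_less_iff[where 'a = real])
    then have "real_of_int (i * j) \<ge> 1" by linarith
    then have "(2 * (e x \<bullet> e y))\<^sup>2 \<ge> 1" using \<open>of_int (i * j) = 4 * (e x \<bullet> e y)\<^sup>2\<close> by (simp add: power_mult_distrib)
    then have "\<bar>2 * (e x \<bullet> e y)\<bar> \<ge> 1" using abs_square_less_1[of "2 * (e x \<bullet> e y)"] by linarith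
    then show ?thesis using neg by linarith
  qed
  \<comment> \<open>The diagonal entry \<open>1\<close> is balanced by two neighbours with entries
    at most \<open>- 1/2\<close>; the second neighbour comes from the assumption with
    \<open>t\<close> chosen as the first.\<close>
  have row: "(\<Sum>x\<in>S. e s \<bullet> e x) \<le> 0" if s: "s \<in> S" for s
  proof -
    obtain x where x: "x \<in> S - {s}" "s \<bullet> x \<noteq> 0" using n s by blast
    obtain y where y: "y \<in> S - {s}" "y \<noteq> x" "s \<bullet> y \<noteq> 0" using n s by blast
    have "(\<Sum>x\<in>S. e s \<bullet> e x) = e s \<bullet> e s + (\<Sum>x\<in>S - {s}. e s \<bullet> e x)"
      by (rule sum.remove[OF fS s])
    also have "(\<Sum>x\<in>S - {s}. e s \<bullet> e x) = e s \<bullet> e x + (\<Sum>z\<in>S - {s} - {x}. e s \<bullet> e z)"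
      by (rule sum.remove) (use fS x in auto)
    also have "(\<Sum>z\<in>S - {s} - {x}. e s \<bullet> e z) = e s \<bullet> e y + (\<Sum>z\<in>S - {s} - {x} - {y}. e s \<bullet> e z)"
      by (rule sum.remove) (use fS x y in auto)
    finally have "(\<Sum>x\<in>S. e s \<bullet> e x) = e s \<bullet> e s + (e s \<bullet> e x + (e s \<bullet> e y + (\<Sum>z\<in>S - {s} - {x} - {y}. e s \<bullet> e z)))" .
    moreover have "(\<Sum>z\<in>S - {s} - {x} - {y}. e s \<bullet> e z) \<le> 0"
      by (rule sum_nonpos) (use np s in auto)
    moreover have "e s \<bullet> e x \<le> - 1/2" using half[of s x] x s by auto
    moreover have "e s \<bullet> e y \<le> - 1/2" using half[of s y] y s by auto
    ultimately show ?thesis using ee[OF s] by linarith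
  qed
  obtain s where s: "s \<in> S" using S by auto
  let ?v = "\<Sum>x\<in>S. e x"
  have "?v \<bullet> ?v = (\<Sum>s\<in>S. \<Sum>x\<in>S. e s \<bullet> e x)"
    by (simp add: inner_sum_left inner_sum_right inner_commute)
  also have "\<dots> \<le> 0" by (rule sum_nonpos) (rule row)
  finally have "?v = 0" by (metis inner_eq_zero_iff inner_ge_zero order_antisym)
  have "?v \<bullet> \<omega> s = (\<Sum>x\<in>S. if x = s then 1 / norm s else 0)"
    unfolding inner_sum_left e_def by (rule sum.cong) (use S s in \<open>auto simp: simple_omega subset_iff divide_inverse\<close>)
  also have "\<dots> = 1 / norm s" using fS s by simp
  finally show False using nz[OF s] \<open>?v = 0\<close> by simp
qed

text \<open>Delete a leaf \<open>s\<close>: both words rotate to start with \<open>s\<close>, the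
  rests are equivalent by induction, and \<open>cox_eq_leaf\<close> restores \<open>s\<close>. Any
  listing of the simple roots can thus be exchanged for a bipartite one.\<close>

lemma coxeter_words_conjugate:
  assumes "distinct xs" "distinct ys" "set xs \<subseteq> \<Delta>" "set ys = set xs"
  shows "cox_eq xs ys"
  using assms
proof (induction "length xs" arbitrary: xs ys rule: less_induct)
  case less
  show ?case
  proof (cases "xs = []")
    case False
    then obtain s t where s: "s \<in> set xs" and leaf: "\<forall>x\<in>set xs - {s}. x \<noteq> t \<longrightarrow> s \<bullet> x = 0"
      using ex_leaf[of "set xs"] less.prems by auto
    obtain us vs where xs: "xs = us @ s # vs" using s split_list by metis
    obtain us' vs' where ys: "ys = us' @ s # vs'" using s less.prems(4) split_list by metis
    have "cox_eq (vs @ us) (vs' @ us')"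
    proof (rule less.hyps)
      show "distinct (vs @ us)" "distinct (vs' @ us')" "set (vs @ us) \<subseteq> \<Delta>" "length (vs @ us) < length xs"
        using less.prems xs ys by auto
      have "set xs - {s} = set (vs @ us)" "set ys - {s} = set (vs' @ us')"
        using less.prems(1,2) xs ys by auto
      then show "set (vs' @ us') = set (vs @ us)" using less.prems(4) by simp
    qed
    then have "cox_eq (s # vs @ us) (s # vs' @ us')"
      by (rule cox_eq_leaf[where t = t]) (use less.prems xs leaf in auto)
    moreover have "cox_eq xs (s # vs @ us)" using cox_eq_append[of us "s # vs"] xs by simp
    moreover have "cox_eq (s # vs' @ us') ys" using cox_eq_append[of "s # vs'" us'] ys by simp
    ultimately show ?thesis by (blast intro: cox_eq.comp_eq)
  qed (use less.prems in \<open>auto intro: cox_eq.idle\<close>)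
qed

text \<open>A leaf is coloured last, opposite to its only possible neighbour
  \<open>t\<close>.\<close>

lemma ex_bipartition:
  assumes "S \<subseteq> \<Delta>"
  shows "\<exists>B\<subseteq>S. (\<forall>x\<in>B. \<forall>y\<in>B. x \<noteq> y \<longrightarrow> x \<bullet> y = 0) \<and>
    (\<forall>x\<in>S - B. \<forall>y\<in>S - B. x \<noteq> y \<longrightarrow> x \<bullet> y = 0)"
  using assms
proof (induction "card S" arbitrary: S rule: less_induct)
  case less
  show ?case
  proof (cases "S = {}")
    case False
    then obtain s t where s: "s \<in> S" and leaf: "\<forall>x\<in>S - {s}. x \<noteq> t \<longrightarrow> s \<bullet> x = 0"
      using ex_leaf[of S] less.prems by auto
    then have leaf': "\<forall>x\<in>S - {s}. x \<noteq> t \<longrightarrow> x \<bullet> s = 0" by (simp add: inner_commute)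
    have "finite S" using less.prems finite_simple finite_subset by auto
    then have "card (S - {s}) < card S" using s by (rule card_Diff1_less)
    from less.hyps[OF this] less.prems obtain B where B: "B \<subseteq> S - {s}"
      "\<forall>x\<in>B. \<forall>y\<in>B. x \<noteq> y \<longrightarrow> x \<bullet> y = 0"
      "\<forall>x\<in>S - {s} - B. \<forall>y\<in>S - {s} - B. x \<noteq> y \<longrightarrow> x \<bullet> y = 0" by blast
    show ?thesis
    proof (cases "t \<in> B")
      case True
      have "S - B = insert s (S - {s} - B)" using s B(1) by auto
      moreover have "s \<bullet> x = 0 \<and> x \<bullet> s = 0" if "x \<in> S - {s} - B" for x
        using leaf leaf' that True by auto
      ultimately show ?thesis using B by (intro exI[of _ B]) auto
    next
      case False
      have "S - insert s B = S - {s} - B" by auto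
      moreover have "s \<bullet> x = 0 \<and> x \<bullet> s = 0" if "x \<in> B" for x
        using leaf leaf' that False B(1) by auto
      ultimately show ?thesis using B s by (intro exI[of _ "insert s B"]) auto
    qed
  qed auto
qed

end

section \<open>The highest root and the number of roots\<close>

locale irreducible_based_roots = based_roots +
  assumes irreducible: "irreducible_root_system \<Phi>"
begin

lemma roots_connected:
  assumes "A \<subseteq> \<Phi>" "A \<noteq> {}" "\<And>a b. a \<in> A \<Longrightarrow> b \<in> \<Phi> - A \<Longrightarrow> a \<bullet> b = 0"
  shows "A = \<Phi>"
proof (rule ccontr)
  assume "A \<noteq> \<Phi>"
  then have "A \<noteq> {} \<and> \<Phi> - A \<noteq> {} \<and> A \<inter> (\<Phi> - A) = {} \<and> A \<union> (\<Phi> - A) = \<Phi> \<and>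
    (\<forall>a\<in>A. \<forall>b\<in>\<Phi> - A. a \<bullet> b = 0)" using assms by blast
  then show False using irreducible unfolding irreducible_root_system_def by blast
qed

text \<open>Positive roots arise from simple ones by simple reflections. A reflection belonging to
  one orthogonal part changes only coefficients of that part and fixes the roots supported in the
  other.\<close>

lemma pos_support:
  assumes "A \<subseteq> \<Delta>" and orth: "\<And>a b. a \<in> A \<Longrightarrow> b \<in> \<Delta> - A \<Longrightarrow> a \<bullet> b = 0"
    and "b \<in> Pos"
  shows "(\<forall>d\<in>\<Delta> - A. b \<bullet> \<omega> d = 0) \<or> (\<forall>d\<in>A. b \<bullet> \<omega> d = 0)"
  using \<open>b \<in> Pos\<close>
proof (induction rule: pos_root_induct)
  case (simple a)
  then show ?case using assms(1) simple_omega[of _ a] by (cases "a \<in> A") (auto simp: subset_iff)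
next
  case (reflect a b)
  have other: "reflection a b = b"
    if S: "S \<subseteq> \<Delta>" "\<forall>d\<in>\<Delta> - S. b \<bullet> \<omega> d = 0" "\<forall>d\<in>S. d \<bullet> a = 0" for S
  proof -
    have "b \<bullet> a = (\<Sum>d\<in>\<Delta>. (b \<bullet> \<omega> d) * (d \<bullet> a))" by (rule inner_expansion)
    also have "\<dots> = 0" by (rule sum.neutral) (use S in auto)
    finally show ?thesis by (intro reflection_fixes) (simp add: inner_commute)
  qed
  show ?case
  proof (cases "a \<in> A")
    case True
    have "reflection a b = b" if "\<forall>d\<in>A. b \<bullet> \<omega> d = 0"
    proof (rule other[of "\<Delta> - A"])
      show "\<forall>d\<in>\<Delta> - A. d \<bullet> a = 0" using orth[OF True] by (metis inner_commute)
    qed (use that in auto)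
    moreover have "reflection a b \<bullet> \<omega> d = b \<bullet> \<omega> d" if "d \<in> \<Delta> - A" for d
      using reflection_coeff[of a d b] that True reflect by auto
    ultimately show ?thesis using reflect.IH by auto
  next
    case False
    have "reflection a b = b" if "\<forall>d\<in>\<Delta> - A. b \<bullet> \<omega> d = 0"
      by (rule other[of A]) (use that False reflect orth assms(1) in auto)
    moreover have "reflection a b \<bullet> \<omega> d = b \<bullet> \<omega> d" if "d \<in> A" for d
      using reflection_coeff[of a d b] that False reflect assms(1) by auto
    ultimately show ?thesis using reflect.IH by auto
  qed
qed

text \<open>Transfers irreducibility to the Dynkin diagram: by \<open>pos_support\<close> every root
  is supported in \<open>A\<close> or in its complement, and roots of the two kinds are
  orthogonal.\<close>

lemma simple_connected:
  assumes "A \<subseteq> \<Delta>" "A \<noteq> {}" and orth: "\<And>a b. a \<in> A \<Longrightarrow> b \<in> \<Delta> - A \<Longrightarrow> a \<bullet> b = 0"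
  shows "A = \<Delta>"
proof -
  define R where "R = {b \<in> \<Phi>. \<forall>d\<in>\<Delta> - A. b \<bullet> \<omega> d = 0}"
  have "A \<subseteq> R" using assms(1) simple_subset simple_omega unfolding R_def by auto
  have off: "\<forall>d\<in>A. b \<bullet> \<omega> d = 0" if "b \<in> \<Phi> - R" for b
  proof (cases "b \<in> Pos")
    case True
    then show ?thesis using pos_support[OF assms(1) orth True] that unfolding R_def by auto
  next
    case False
    then have "- b \<in> Pos" using that not_pos_iff by auto
    then show ?thesis using pos_support[OF assms(1) orth, of "- b"] that unfolding R_def by auto
  qed
  have "R = \<Phi>"
  proof (rule roots_connected)
    fix a b assume a: "a \<in> R" and b: "b \<in> \<Phi> - R"
    have "a \<bullet> b = (\<Sum>d\<in>\<Delta>. (a \<bullet> \<omega> d) * (d \<bullet> b))" by (rule inner_expansion)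
    also have "\<dots> = 0"
    proof (rule sum.neutral, rule ballI)
      fix d assume d: "d \<in> \<Delta>"
      show "(a \<bullet> \<omega> d) * (d \<bullet> b) = 0"
      proof (cases "d \<in> A")
        case True
        have "b \<bullet> d = (\<Sum>e\<in>\<Delta>. (b \<bullet> \<omega> e) * (e \<bullet> d))" by (rule inner_expansion)
        also have "\<dots> = 0"
          by (rule sum.neutral) (use off[OF b] orth[OF True] inner_commute[of d] in auto)
        finally show ?thesis by (simp add: inner_commute)
      next
        case False
        then show ?thesis using a d unfolding R_def by auto
      qed
    qed
    finally show "a \<bullet> b = 0" .
  qed (use \<open>A \<subseteq> R\<close> assms(2) R_def in auto)
  have "d \<in> A" if "d \<in> \<Delta>" for d
  proof -
    have "d \<in> R" using that simple_subset \<open>R = \<Phi>\<close> by auto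
    then have "d \<bullet> \<omega> e = 0" if "e \<in> \<Delta> - A" for e using that unfolding R_def by blast
    then show ?thesis using that simple_omega[of d d] by force
  qed
  then show ?thesis using assms(1) by auto
qed

section \<open>The highest root\<close>

definition maximal :: "'a \<Rightarrow> bool" where
  "maximal b \<longleftrightarrow> b \<in> Pos \<and> (\<forall>c\<in>Pos. (\<forall>a\<in>\<Delta>. b \<bullet> \<omega> a \<le> c \<bullet> \<omega> a) \<longrightarrow> c = b)"

text \<open>A negative product would let the reflection in \<open>a\<close> raise the coefficient of
  \<open>a\<close>.\<close>

lemma maximal_dominant:
  assumes m: "maximal b" and a: "a \<in> \<Delta>" shows "a \<bullet> b \<ge> 0"
proof (rule ccontr)
  assume n: "\<not> ?thesis"
  have aa: "a \<bullet> a > 0" using a simple_subset inner_root_pos by auto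
  have neg: "2 * (a \<bullet> b) / (a \<bullet> a) < 0" using n aa by (simp add: divide_neg_pos)
  have b: "b \<in> Pos" using m unfolding maximal_def by auto
  have "b \<noteq> a" using n aa by auto
  then have p: "reflection a b \<in> Pos" using simple_reflection_pos a b by auto
  moreover have "\<forall>d\<in>\<Delta>. b \<bullet> \<omega> d \<le> reflection a b \<bullet> \<omega> d"
    using a neg by (auto simp: reflection_coeff)
  ultimately have "reflection a b = b" using m unfolding maximal_def by auto
  then have "b \<bullet> \<omega> a = b \<bullet> \<omega> a - 2 * (a \<bullet> b) / (a \<bullet> a)"
    using reflection_coeff[OF a a, of b] by (simp only: if_True simp_thms)
  then show False using neg by linarith
qed

text \<open>For \<open>e\<close> outside the support, \<open>b \<bullet> e\<close> is nonnegative by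
  dominance and yet a sum of nonpositive terms. All terms vanish, so the support is orthogonal to
  its complement.\<close>

lemma maximal_coeff_pos:
  assumes m: "maximal b" and a: "a \<in> \<Delta>" shows "b \<bullet> \<omega> a > 0"
proof -
  have b: "b \<in> Pos" using m unfolding maximal_def by auto
  define A where "A = {a\<in>\<Delta>. b \<bullet> \<omega> a > 0}"
  have "A = \<Delta>"
  proof (rule simple_connected)
    show "A \<subseteq> \<Delta>" unfolding A_def by auto
    show "A \<noteq> {}" using pos_inner_simple[OF b] unfolding A_def by auto
    fix d e assume d: "d \<in> A" and e: "e \<in> \<Delta> - A"
    have t: "(b \<bullet> \<omega> c) * (c \<bullet> e) \<le> 0" if "c \<in> \<Delta>" for c
    proof (cases "c = e")
      case True
      then have "b \<bullet> \<omega> c = 0" using e pos_coeff_nonneg[OF b that] unfolding A_def by auto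
      then show ?thesis by simp
    next
      case False
      then show ?thesis using simple_inner_nonpos[of c e] that e pos_coeff_nonneg[OF b that]
        by (auto simp: mult_le_0_iff)
    qed
    have "0 \<le> b \<bullet> e" using maximal_dominant[OF m, of e] e by (auto simp: inner_commute)
    also have "b \<bullet> e = (\<Sum>c\<in>\<Delta>. (b \<bullet> \<omega> c) * (c \<bullet> e))" by (rule inner_expansion)
    finally have "(\<Sum>c\<in>\<Delta>. (b \<bullet> \<omega> c) * (c \<bullet> e)) \<ge> 0" .
    moreover have "(\<Sum>c\<in>\<Delta>. (b \<bullet> \<omega> c) * (c \<bullet> e)) \<le> 0" using t by (rule sum_nonpos)
    ultimately have "(\<Sum>c\<in>\<Delta>. - ((b \<bullet> \<omega> c) * (c \<bullet> e))) = 0" by (simp add: sum_negf)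
    then have "- ((b \<bullet> \<omega> d) * (d \<bullet> e)) = 0"
      using sum_nonneg_eq_0_iff[of \<Delta> "\<lambda>c. - ((b \<bullet> \<omega> c) * (c \<bullet> e))"] t finite_simple d
      unfolding A_def by auto
    then show "d \<bullet> e = 0" using d unfolding A_def by auto
  qed
  then show ?thesis using a unfolding A_def by auto
qed

text \<open>Dominance and full support give \<open>b \<bullet> c > 0\<close>, so
  \<open>b - c\<close> would be a root; whatever its sign, one of the two would lie above the
  other.\<close>

lemma maximal_unique:
  assumes "maximal b" "maximal c" shows "b = c"
proof (rule ccontr)
  assume ne: "b \<noteq> c"
  have p: "b \<in> Pos" "c \<in> Pos" using assms unfolding maximal_def by auto
  obtain a where a: "a \<in> \<Delta>" "a \<bullet> c > 0" using pos_inner_simple[OF p(2)] by auto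
  have "0 < (\<Sum>a\<in>\<Delta>. (b \<bullet> \<omega> a) * (a \<bullet> c))"
  proof (rule sum_pos2[OF finite_simple a(1)])
    show "0 < (b \<bullet> \<omega> a) * (a \<bullet> c)" using a maximal_coeff_pos[OF assms(1)] by simp
    show "0 \<le> (b \<bullet> \<omega> d) * (d \<bullet> c)" if "d \<in> \<Delta>" for d
      using that maximal_dominant[OF assms(2)] pos_coeff_nonneg[OF p(1)] by simp
  qed
  then have "b \<bullet> c > 0" by (simp only: inner_expansion[of b c])
  then have r: "b - c \<in> \<Phi>" using root_difference p pos_root ne by auto
  show False
  proof (cases "b - c \<in> Pos")
    case True
    from pos_coeff_nonneg[OF this] have "\<forall>a\<in>\<Delta>. c \<bullet> \<omega> a \<le> b \<bullet> \<omega> a" by (auto simp: inner_diff_left)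
    then show False using assms(2) p ne unfolding maximal_def by auto
  next
    case False
    then have "c - b \<in> Pos" using not_pos_iff r by auto
    from pos_coeff_nonneg[OF this] have "\<forall>a\<in>\<Delta>. b \<bullet> \<omega> a \<le> c \<bullet> \<omega> a" by (auto simp: inner_diff_left)
    then show False using assms(1) p ne unfolding maximal_def by auto
  qed
qed

lemma ex_maximal_above:
  assumes "g \<in> Pos" shows "\<exists>b. maximal b \<and> (\<forall>a\<in>\<Delta>. g \<bullet> \<omega> a \<le> b \<bullet> \<omega> a)"
proof -
  let ?S = "{b \<in> Pos. \<forall>a\<in>\<Delta>. g \<bullet> \<omega> a \<le> b \<bullet> \<omega> a}"
  have "finite ?S" "?S \<noteq> {}" using assms finite_pos by auto
  from finite_has_max[OF this, of "\<lambda>c. c \<bullet> \<rho>"]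
  obtain b where b: "b \<in> ?S" and mx: "\<And>c. c \<in> ?S \<Longrightarrow> c \<bullet> \<rho> \<le> b \<bullet> \<rho>"
    by blast
  have "maximal b" unfolding maximal_def
  proof (intro conjI ballI impI)
    fix c assume c: "c \<in> Pos" and le: "\<forall>a\<in>\<Delta>. b \<bullet> \<omega> a \<le> c \<bullet> \<omega> a"
    then have "c \<in> ?S" using b by force
    then have "c \<bullet> \<rho> \<le> b \<bullet> \<rho>" by (rule mx)
    then have "(\<Sum>a\<in>\<Delta>. c \<bullet> \<omega> a - b \<bullet> \<omega> a) \<le> 0" by (simp add: rho_inner sum_subtractf)
    moreover have "(\<Sum>a\<in>\<Delta>. c \<bullet> \<omega> a - b \<bullet> \<omega> a) \<ge> 0" by (rule sum_nonneg) (use le in auto)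
    ultimately have z: "(\<Sum>a\<in>\<Delta>. c \<bullet> \<omega> a - b \<bullet> \<omega> a) = 0" by linarith
    have "\<forall>a\<in>\<Delta>. c \<bullet> \<omega> a - b \<bullet> \<omega> a = 0"
      by (rule sum_nonneg_eq_0_iff[THEN iffD1, OF finite_simple _ z]) (use le in auto)
    then show "c = b" by (intro coweight_eqI) auto
  qed (use b in auto)
  then show ?thesis using b by auto
qed

definition \<theta> :: 'a where "\<theta> = (THE b. maximal b)"

lemma simple_nonempty: "\<Delta> \<noteq> {}"
  using card_simple DIM_positive by fastforce

lemma maximal_theta: "maximal \<theta>"
proof -
  obtain a where "a \<in> \<Delta>" using simple_nonempty by auto
  then obtain b where "maximal b" using ex_maximal_above simple_pos by blast
  then show ?thesis unfolding \<theta>_def by (rule theI) (rule maximal_unique[OF _ \<open>maximal b\<close>])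
qed

lemma theta_pos: "\<theta> \<in> Pos"
  using maximal_theta unfolding maximal_def by auto

lemma theta_ge: "b \<in> Pos \<Longrightarrow> a \<in> \<Delta> \<Longrightarrow> b \<bullet> \<omega> a \<le> \<theta> \<bullet> \<omega> a"
  using ex_maximal_above maximal_unique[OF maximal_theta] by blast

lemma theta_coeff: "a \<in> \<Delta> \<Longrightarrow> \<theta> \<bullet> \<omega> a \<ge> 1"
  using maximal_coeff_pos[OF maximal_theta, of a] pos_coeff[OF theta_pos, of a]
  by (auto elim!: Nats_cases)

lemma theta_dominant: "b \<in> Pos \<Longrightarrow> b \<bullet> \<theta> \<ge> 0"
  unfolding inner_expansion[of b \<theta>] using maximal_dominant[OF maximal_theta] pos_coeff_nonneg
  by (intro sum_nonneg) auto

lemma theta_height: "b \<in> Pos \<Longrightarrow> b \<bullet> \<rho> \<le> \<theta> \<bullet> \<rho>"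
  unfolding rho_inner by (intro sum_mono theta_ge)

text \<open>From \<open>2\<close> on, the root \<open>- reflection \<theta> b\<close> would have
  coefficients at least those of \<theta>, hence equal \<theta>, and \<open>b\<close> would be a
  multiple of \<theta>.\<close>

lemma theta_coroot:
  assumes b: "b \<in> Pos" and ne: "b \<noteq> \<theta>"
  shows "2 * (\<theta> \<bullet> b) / (\<theta> \<bullet> \<theta>) = 0 \<or> 2 * (\<theta> \<bullet> b) / (\<theta> \<bullet> \<theta>) = 1"
proof -
  have tr: "\<theta> \<in> \<Phi>" using theta_pos pos_root by auto
  have tt: "\<theta> \<bullet> \<theta> > 0" using inner_root_pos tr by auto
  obtain i where i: "2 * (\<theta> \<bullet> b) / (\<theta> \<bullet> \<theta>) = of_int i"
    using roots_integral[OF tr pos_root[OF b]] by (auto elim!: Ints_cases)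
  have "0 \<le> 2 * (\<theta> \<bullet> b) / (\<theta> \<bullet> \<theta>)" using theta_dominant[OF b] tt by (simp add: inner_commute)
  then have "i \<ge> 0" using i by simp
  moreover have "i < 2"
  proof (rule ccontr)
    assume "\<not> i < 2"
    then have i2: "real_of_int i \<ge> 2" by simp
    define c where "c = - reflection \<theta> b"
    have ce: "c = of_int i *\<^sub>R \<theta> - b" unfolding c_def reflection_def i by simp
    have cr: "c \<in> \<Phi>" unfolding c_def using reflection_root[OF tr pos_root[OF b]] uminus_root by auto
    have ch: "c \<bullet> \<omega> a \<ge> \<theta> \<bullet> \<omega> a" if "a \<in> \<Delta>" for a
    proof -
      have "2 * (\<theta> \<bullet> \<omega> a) \<le> of_int i * (\<theta> \<bullet> \<omega> a)"
        by (rule mult_right_mono) (use i2 theta_coeff[OF that] in auto)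
      then show ?thesis using theta_ge[OF b that] by (simp add: ce inner_diff_left)
    qed
    obtain a where a: "a \<in> \<Delta>" using simple_nonempty by auto
    have "c \<in> Pos" by (rule pos_if_coeff[OF cr a]) (use ch[OF a] theta_coeff[OF a] in auto)
    then have "c = \<theta>" using maximal_theta ch unfolding maximal_def by auto
    then have b': "b = of_int (i - 1) *\<^sub>R \<theta>" using ce by (simp add: algebra_simps)
    then have "real_of_int (i - 1) = 1 \<or> real_of_int (i - 1) = -1"
      using root_eq_scale[OF tr] pos_root[OF b] by metis
    then have "real_of_int (i - 1) = 1" using i2 by auto
    then show False using b' ne by simp
  qed
  ultimately have "i = 0 \<or> i = 1" by linarith
  then show ?thesis using i by auto
qed

text \<open>The Coxeter number: see \<open>coxeter_number_eq\<close> below.\<close>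

definition cox :: nat where "cox = nat \<lfloor>\<theta> \<bullet> \<rho>\<rfloor> + 1"

lemma real_cox: "real cox = \<theta> \<bullet> \<rho> + 1"
  using pos_height_nat[OF theta_pos] unfolding cox_def by (auto elim!: Nats_cases)

text \<open>The reflection in \<open>a\<close> permutes the other positive roots and negates their
  pairings with \<open>a\<close>, so only the term of \<open>a\<close> survives. By linearity the
  positive coroots add up to twice \<rho>, which is \<open>sum_coroots\<close>.\<close>

lemma sum_coroots_simple:
  assumes a: "a \<in> \<Delta>" shows "(\<Sum>b\<in>Pos. 2 * (b \<bullet> a) / (b \<bullet> b)) = 2"
proof -
  have aa: "a \<bullet> a > 0" using a simple_subset inner_root_pos by auto
  let ?f = "\<lambda>b. 2 * (b \<bullet> a) / (b \<bullet> b)"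
  have bij: "bij_betw (reflection a) (Pos - {a}) (Pos - {a})"
  proof (rule bij_betwI[where g = "reflection a"])
    have "reflection a b \<noteq> a" if "b \<in> Pos" for b
    proof
      assume e: "reflection a b = a"
      have "b = reflection a (reflection a b)" by simp
      then have "b = - a" using e by simp
      then show False using that not_pos_iff[of a] a simple_pos simple_subset by auto
    qed
    then show "reflection a \<in> Pos - {a} \<rightarrow> Pos - {a}" "reflection a \<in> Pos - {a} \<rightarrow> Pos - {a}"
      using simple_reflection_pos[OF a] by auto
  qed auto
  have "sum ?f (Pos - {a}) = (\<Sum>b\<in>Pos - {a}. ?f (reflection a b))"
    by (rule sum.reindex_bij_betw[OF bij, symmetric])
  also have "\<dots> = - sum ?f (Pos - {a})"
  proof -
    have "reflection a b \<bullet> reflection a b = b \<bullet> b" for b by (simp add: reflection_inner_swap)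
    moreover have "reflection a b \<bullet> a = - (b \<bullet> a)" for b by (simp add: reflection_inner_swap)
    ultimately show ?thesis by (simp add: sum_negf[symmetric])
  qed
  finally have "sum ?f (Pos - {a}) = 0" by simp
  moreover have "sum ?f Pos = ?f a + sum ?f (Pos - {a})"
    by (rule sum.remove) (use a simple_pos finite_pos in auto)
  ultimately show ?thesis using aa by simp
qed

lemma sum_coroots: "(\<Sum>b\<in>Pos. 2 * (b \<bullet> x) / (b \<bullet> b)) = 2 * (x \<bullet> \<rho>)"
proof -
  have "(\<Sum>b\<in>Pos. 2 * (b \<bullet> x) / (b \<bullet> b)) = (\<Sum>b\<in>Pos. \<Sum>a\<in>\<Delta>. (x \<bullet> \<omega> a) * (2 * (b \<bullet> a) / (b \<bullet> b)))"
  proof (rule sum.cong)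
    fix b
    have "2 * (b \<bullet> x) / (b \<bullet> b) = 2 / (b \<bullet> b) * (x \<bullet> b)" by (simp add: inner_commute)
    also have "\<dots> = (\<Sum>a\<in>\<Delta>. 2 / (b \<bullet> b) * ((x \<bullet> \<omega> a) * (a \<bullet> b)))"
      by (subst inner_expansion) (simp add: sum_distrib_left)
    also have "\<dots> = (\<Sum>a\<in>\<Delta>. (x \<bullet> \<omega> a) * (2 * (b \<bullet> a) / (b \<bullet> b)))"
      by (rule sum.cong) (auto simp: inner_commute)
    finally show "2 * (b \<bullet> x) / (b \<bullet> b) = (\<Sum>a\<in>\<Delta>. (x \<bullet> \<omega> a) * (2 * (b \<bullet> a) / (b \<bullet> b)))" .
  qed simp
  also have "\<dots> = (\<Sum>a\<in>\<Delta>. (x \<bullet> \<omega> a) * (\<Sum>b\<in>Pos. 2 * (b \<bullet> a) / (b \<bullet> b)))"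
    by (subst sum.swap) (simp add: sum_distrib_left)
  also have "\<dots> = (\<Sum>a\<in>\<Delta>. (x \<bullet> \<omega> a) * 2)" by (rule sum.cong) (auto simp: sum_coroots_simple)
  finally show ?thesis by (simp add: rho_inner sum_distrib_left mult.commute)
qed

lemma sum_roots_split:
  assumes "\<And>b. f (- b) = (f b :: real)"
  shows "sum f \<Phi> = 2 * sum f Pos"
proof -
  have e: "\<Phi> = Pos \<union> uminus ` Pos"
    using not_pos_iff pos_root uminus_root by (auto simp: image_iff) (metis minus_minus)
  have "Pos \<inter> uminus ` Pos = {}" using not_pos_iff pos_root by auto
  then have "sum f \<Phi> = sum f Pos + sum f (uminus ` Pos)"
    by (subst e) (use finite_pos in \<open>auto intro: sum.union_disjoint\<close>)
  moreover have "sum f (uminus ` Pos) = sum f Pos"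
    by (subst sum.reindex) (auto simp: assms)
  ultimately show ?thesis by simp
qed

text \<open>By irreducibility the invariant form \<open>\<Sum> 2 (a \<bullet> x) (a \<bullet> y) / (a \<bullet> a)\<close> is a multiple
  of the inner product; the multiple is found by evaluating at the highest root, and taking
  the trace then counts the roots.\<close>

lemma card_roots: "card \<Phi> = cox * DIM('a)"
proof -
  define T where "T x = (\<Sum>a\<in>\<Phi>. (2 * (a \<bullet> x) / (a \<bullet> a)) *\<^sub>R a)" for x
  have linT: "linear T"
    unfolding T_def by (rule linearI)
      (simp_all add: inner_right_distrib distrib_left add_divide_distrib scaleR_left_distrib
        sum.distrib scaleR_sum_right mult.left_commute)
  have symT: "T x \<bullet> y = x \<bullet> T y" for x y
    unfolding T_def by (simp add: inner_sum_left inner_sum_right inner_commute mult.commute mult.left_commute)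
  have Tw: "T (reflection b x) = reflection b (T x)" if b: "b \<in> \<Phi>" for b x
  proof -
    have bij: "bij_betw (reflection b) \<Phi> \<Phi>"
      by (rule bij_betwI[where g = "reflection b"]) (use b reflection_root in auto)
    have "T (reflection b x) = (\<Sum>a\<in>\<Phi>. (2 * (reflection b a \<bullet> reflection b x) / (reflection b a \<bullet> reflection b a)) *\<^sub>R reflection b a)"
      unfolding T_def by (rule sum.reindex_bij_betw[OF bij, symmetric])
    also have "\<dots> = (\<Sum>a\<in>\<Phi>. (2 * (a \<bullet> x) / (a \<bullet> a)) *\<^sub>R reflection b a)"
      by (simp add: reflection_inner_swap)
    also have "\<dots> = reflection b (T x)"
      unfolding T_def by (simp add: linear_sum[OF reflection_linear] linear_scale[OF reflection_linear])
    finally show ?thesis .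
  qed
  \<comment> \<open>\<open>T\<close> commutes with \<open>reflection b\<close>, so
    \<open>T b\<close> lies in the eigenspace of \<open>-1\<close>, the line of \<open>b\<close>:
    every root is an eigenvector.\<close>
  define \<kappa> where "\<kappa> b = (b \<bullet> T b) / (b \<bullet> b)" for b
  have eig: "T b = \<kappa> b *\<^sub>R b" if b: "b \<in> \<Phi>" for b
  proof -
    have "reflection b (T b) = - T b"
      using Tw[OF b, of b] linear_neg[OF linT] by simp
    then have "2 *\<^sub>R T b = (2 * (b \<bullet> T b) / (b \<bullet> b)) *\<^sub>R b"
      unfolding reflection_def by (simp add: algebra_simps scaleR_2)
    also have "\<dots> = 2 *\<^sub>R (\<kappa> b *\<^sub>R b)" unfolding \<kappa>_def by simp
    finally show ?thesis using scaleR_cancel_left[of 2 "T b" "\<kappa> b *\<^sub>R b"] by linarith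
  qed
  have tr: "\<theta> \<in> \<Phi>" using theta_pos pos_root by auto
  have tt: "\<theta> \<bullet> \<theta> > 0" using tr inner_root_pos by auto
  \<comment> \<open>Roots with different eigenvalues of the symmetric map \<open>T\<close> are
    orthogonal.\<close>
  let ?A = "{b\<in>\<Phi>. \<kappa> b = \<kappa> \<theta>}"
  have "?A = \<Phi>"
  proof (rule roots_connected)
    fix a b assume a: "a \<in> ?A" and b: "b \<in> \<Phi> - ?A"
    have "T a \<bullet> b = a \<bullet> T b" by (rule symT)
    then have "\<kappa> a * (a \<bullet> b) = \<kappa> b * (a \<bullet> b)" using a b eig by auto
    then show "a \<bullet> b = 0" using a b by auto
  qed (use tr in auto)
  then have eig': "T b = \<kappa> \<theta> *\<^sub>R b" if "b \<in> \<Phi>" for b using eig that by auto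
  have all: "T x = \<kappa> \<theta> *\<^sub>R x" for x
    using linear_eq_on[OF linT, of "\<lambda>x. \<kappa> \<theta> *\<^sub>R x" x \<Phi>] eig' span_roots
    by (simp add: linear_scale_self)
  have "\<theta> \<bullet> T \<theta> = (\<Sum>a\<in>\<Phi>. 2 * (a \<bullet> \<theta>)\<^sup>2 / (a \<bullet> a))"
    unfolding T_def by (simp add: inner_sum_right inner_commute power2_eq_square mult.assoc)
  also have "\<dots> = 2 * (\<Sum>a\<in>Pos. 2 * (a \<bullet> \<theta>)\<^sup>2 / (a \<bullet> a))"
    by (rule sum_roots_split) simp
  also have "(\<Sum>a\<in>Pos. 2 * (a \<bullet> \<theta>)\<^sup>2 / (a \<bullet> a)) = 2 * (\<theta> \<bullet> \<theta>) + (\<Sum>a\<in>Pos - {\<theta>}. 2 * (a \<bullet> \<theta>)\<^sup>2 / (a \<bullet> a))"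
    using sum.remove[OF finite_pos theta_pos, of "\<lambda>a. 2 * (a \<bullet> \<theta>)\<^sup>2 / (a \<bullet> a)"] tt
    by (simp add: power2_eq_square)
  \<comment> \<open>By \<open>theta_coroot\<close>, \<open>2 * (\<theta> \<bullet> a)\<close> is
    \<open>0\<close> or \<open>\<theta> \<bullet> \<theta>\<close>. This replaces the square by a
    first power, to which \<open>sum_coroots\<close> applies.\<close>
  also have "(\<Sum>a\<in>Pos - {\<theta>}. 2 * (a \<bullet> \<theta>)\<^sup>2 / (a \<bullet> a)) =
      (\<Sum>a\<in>Pos - {\<theta>}. (\<theta> \<bullet> \<theta>) / 2 * (2 * (a \<bullet> \<theta>) / (a \<bullet> a)))"
  proof (rule sum.cong)
    fix a assume a: "a \<in> Pos - {\<theta>}"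
    then have "2 * (\<theta> \<bullet> a) = 0 \<or> 2 * (\<theta> \<bullet> a) = \<theta> \<bullet> \<theta>"
      using theta_coroot[of a] tt by (auto simp: field_simps)
    then show "2 * (a \<bullet> \<theta>)\<^sup>2 / (a \<bullet> a) = (\<theta> \<bullet> \<theta>) / 2 * (2 * (a \<bullet> \<theta>) / (a \<bullet> a))"
      by (auto simp: power2_eq_square inner_commute)
  qed simp
  also have "\<dots> = (\<theta> \<bullet> \<theta>) / 2 * ((\<Sum>a\<in>Pos. 2 * (a \<bullet> \<theta>) / (a \<bullet> a)) - 2)"
    using sum.remove[OF finite_pos theta_pos, of "\<lambda>a. 2 * (a \<bullet> \<theta>) / (a \<bullet> a)"] tt
    by (simp add: sum_distrib_left)
  also have "(\<Sum>a\<in>Pos. 2 * (a \<bullet> \<theta>) / (a \<bullet> a)) = 2 * (\<theta> \<bullet> \<rho>)" by (rule sum_coroots)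
  finally have "\<theta> \<bullet> T \<theta> = 2 * real cox * (\<theta> \<bullet> \<theta>)" by (simp add: real_cox algebra_simps)
  then have k: "\<kappa> \<theta> = 2 * real cox" unfolding \<kappa>_def using tt by simp
  have "\<kappa> \<theta> * real DIM('a) = (\<Sum>b\<in>Basis. b \<bullet> T b)"
    unfolding all by (simp add: mult.commute)
  also have "\<dots> = (\<Sum>b\<in>Basis. \<Sum>a\<in>\<Phi>. 2 / (a \<bullet> a) * ((a \<bullet> b) * (a \<bullet> b)))"
    unfolding T_def by (simp add: inner_sum_right inner_commute mult.assoc)
  also have "\<dots> = (\<Sum>a\<in>\<Phi>. 2 / (a \<bullet> a) * (\<Sum>b\<in>Basis. (a \<bullet> b) * (a \<bullet> b)))"
    by (subst sum.swap) (simp add: sum_distrib_left)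
  also have "\<dots> = (\<Sum>a\<in>\<Phi>. 2)"
    by (rule sum.cong) (use inner_root_pos in \<open>auto simp flip: euclidean_inner\<close>)
  finally have "real (card \<Phi>) = real (cox * DIM('a))" using k by simp
  then show ?thesis by linarith
qed

section \<open>The order of a Coxeter element\<close>

definition nrm :: "'a \<Rightarrow> 'a" where "nrm a = a /\<^sub>R norm a"

lemma simple_norm_pos: "a \<in> \<Delta> \<Longrightarrow> norm a > 0"
  using simple_subset roots_nonzero by auto

lemma nrm_self: "a \<in> \<Delta> \<Longrightarrow> nrm a \<bullet> nrm a = 1"
  using simple_norm_pos[of a] unfolding nrm_def by (simp add: dot_square_norm power2_eq_square)

lemma nrm_nonpos: "a \<in> \<Delta> \<Longrightarrow> b \<in> \<Delta> \<Longrightarrow> a \<noteq> b \<Longrightarrow> nrm a \<bullet> nrm b \<le> 0"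
  using simple_inner_nonpos[of a b] unfolding nrm_def by (auto simp: mult_le_0_iff)

text \<open>The Perron-Frobenius eigenvector of the Gram matrix of the normalised simple roots,
  found by maximising the sum of the squared coordinates on the unit sphere.\<close>

lemma perron:
  obtains x :: "'a \<Rightarrow> real" and l :: real
  where "\<And>a. a \<in> \<Delta> \<Longrightarrow> x a > 0" "0 < l" "l \<le> 1"
    "\<And>a. a \<in> \<Delta> \<Longrightarrow> nrm a \<bullet> (\<Sum>b\<in>\<Delta>. x b *\<^sub>R nrm b) = l * x a"
proof -
  \<comment> \<open>Coordinates with respect to the normalised simple roots. The maximum
    \<open>K\<close> of \<open>N\<close> on the sphere is the reciprocal of the least eigenvalue of
    the Gram matrix.\<close>
  define X where "X a y = (y \<bullet> \<omega> a) * norm a" for a y :: 'a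
  define N where "N y = (\<Sum>a\<in>\<Delta>. (X a y)\<^sup>2)" for y
  have X_sum: "X a (\<Sum>b\<in>\<Delta>. z b *\<^sub>R nrm b) = z a" if "a \<in> \<Delta>" for a and z :: "'a \<Rightarrow> real"
  proof -
    have "(\<Sum>b\<in>\<Delta>. z b *\<^sub>R nrm b) \<bullet> \<omega> a = (\<Sum>b\<in>\<Delta>. if b = a then z b / norm b else 0)"
      unfolding inner_sum_left nrm_def
      by (rule sum.cong) (use that simple_omega in \<open>auto simp: divide_inverse\<close>)
    then show ?thesis using that finite_simple simple_norm_pos[OF that] unfolding X_def by simp
  qed
  have exp_X: "(\<Sum>a\<in>\<Delta>. X a y *\<^sub>R nrm a) = y" for y
  proof -
    have "(\<Sum>a\<in>\<Delta>. X a y *\<^sub>R nrm a) = (\<Sum>a\<in>\<Delta>. (y \<bullet> \<omega> a) *\<^sub>R a)"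
      unfolding X_def nrm_def by (rule sum.cong) (use simple_norm_pos in auto)
    then show ?thesis by (simp only: expansion)
  qed
  have X_nrm: "X a (nrm b) = (if a = b then 1 else 0)" if "a \<in> \<Delta>" "b \<in> \<Delta>" for a b
    using simple_omega[OF that] simple_norm_pos[OF that(1)] unfolding X_def nrm_def by auto
  have X_lin: "X a (y + t *\<^sub>R z) = X a y + t * X a z" for a y z t
    unfolding X_def by (simp add: inner_add_left algebra_simps)
  have "continuous_on (sphere 0 1) N"
    unfolding N_def X_def by (intro continuous_intros)
  moreover have "sphere (0::'a) 1 \<noteq> {}" by auto
  ultimately obtain p where p: "p \<in> sphere 0 1" and mx: "\<And>y. y \<in> sphere 0 1 \<Longrightarrow> N y \<le> N p"
    using continuous_attains_sup[OF compact_sphere] by metis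
  define K where "K = N p"
  have bound: "N y \<le> K * (y \<bullet> y)" for y
  proof (cases "y = 0")
    case True then show ?thesis by (simp add: N_def X_def)
  next
    case False
    have "N (y /\<^sub>R norm y) \<le> K" unfolding K_def by (rule mx) (use False in simp)
    moreover have "N (y /\<^sub>R norm y) = N y / (norm y)\<^sup>2"
      unfolding N_def X_def sum_divide_distrib
      by (rule sum.cong) (auto simp: divide_inverse power_mult_distrib power_inverse)
    ultimately show ?thesis using False
      by (simp add: divide_le_eq dot_square_norm)
  qed
  obtain a0 where a0: "a0 \<in> \<Delta>" using simple_nonempty by auto
  have "N (nrm a0) = (\<Sum>a\<in>\<Delta>. if a = a0 then 1 else 0)"
    unfolding N_def by (rule sum.cong) (use a0 X_nrm in auto)
  then have "N (nrm a0) = 1" using a0 finite_simple by simp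
  then have K1: "K \<ge> 1" using bound[of "nrm a0"] nrm_self[OF a0] by simp
  \<comment> \<open>Absolute values keep \<open>N\<close> and do not increase the length, because
    the off-diagonal products are nonpositive; so \<open>p'\<close> is again extremal.\<close>
  define x where "x a = \<bar>X a p\<bar>" for a
  define p' where "p' = (\<Sum>b\<in>\<Delta>. x b *\<^sub>R nrm b)"
  have Xp': "X a p' = x a" if "a \<in> \<Delta>" for a unfolding p'_def by (rule X_sum[OF that])
  have Np': "N p' = K" unfolding K_def N_def
    by (rule sum.cong) (auto simp: Xp', auto simp: x_def)
  have "p' \<bullet> p' = (\<Sum>a\<in>\<Delta>. \<Sum>b\<in>\<Delta>. x a * x b * (nrm a \<bullet> nrm b))"
    unfolding p'_def by (simp add: inner_sum_left inner_sum_right sum_distrib_left inner_commute mult.assoc mult.left_commute)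
  also have "\<dots> \<le> (\<Sum>a\<in>\<Delta>. \<Sum>b\<in>\<Delta>. X a p * X b p * (nrm a \<bullet> nrm b))"
  proof (intro sum_mono)
    fix a b assume ab: "a \<in> \<Delta>" "b \<in> \<Delta>"
    show "x a * x b * (nrm a \<bullet> nrm b) \<le> X a p * X b p * (nrm a \<bullet> nrm b)"
    proof (cases "a = b")
      case False
      have "X a p * X b p \<le> x a * x b" unfolding x_def abs_mult[symmetric] by (rule abs_ge_self)
      then show ?thesis using nrm_nonpos[OF ab False] by (rule mult_right_mono_neg)
    qed (simp add: x_def)
  qed
  also have "\<dots> = (\<Sum>a\<in>\<Delta>. X a p *\<^sub>R nrm a) \<bullet> (\<Sum>b\<in>\<Delta>. X b p *\<^sub>R nrm b)"
    by (simp add: inner_sum_left inner_sum_right sum_distrib_left inner_commute mult.assoc mult.left_commute)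
  also have "\<dots> = 1" unfolding exp_X using p by (simp add: dot_square_norm)
  finally have "K * (p' \<bullet> p') \<le> K" using K1 by simp
  then have opt: "N p' = K * (p' \<bullet> p')" using bound[of p'] Np' by simp
  have eigen: "K * (p' \<bullet> nrm b) = x b" if b: "b \<in> \<Delta>" for b
  proof -
    \<comment> \<open>First-order condition, in the direction \<open>nrm b\<close>, for
      \<open>K * (y \<bullet> y) - N y\<close>, which is nonnegative and vanishes at
      \<open>p'\<close>.\<close>
    have "K * (p' \<bullet> nrm b) - x b = 0"
    proof (rule linear_coeff_zero_if_nonneg)
      fix t :: real
      have "N (p' + t *\<^sub>R nrm b) = N p' + 2 * t * (\<Sum>a\<in>\<Delta>. X a p' * X a (nrm b)) + t\<^sup>2 * N (nrm b)"
        unfolding N_def X_lin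
        by (simp add: power2_eq_square algebra_simps sum.distrib sum_distrib_left)
      also have "(\<Sum>a\<in>\<Delta>. X a p' * X a (nrm b)) = (\<Sum>a\<in>\<Delta>. if a = b then x b else 0)"
        by (rule sum.cong) (use b X_nrm Xp' in auto)
      also have "\<dots> = x b" using b finite_simple by simp
      finally have "N p' + 2 * t * x b + t\<^sup>2 * N (nrm b) \<le> K * ((p' + t *\<^sub>R nrm b) \<bullet> (p' + t *\<^sub>R nrm b))"
        using bound[of "p' + t *\<^sub>R nrm b"] by simp
      also have "\<dots> = K * (p' \<bullet> p') + 2 * t * (K * (p' \<bullet> nrm b)) + t\<^sup>2 * (K * (nrm b \<bullet> nrm b))"
        by (simp add: inner_add_left inner_add_right inner_commute algebra_simps power2_eq_square)
      finally show "0 \<le> 2 * t * (K * (p' \<bullet> nrm b) - x b) + t\<^sup>2 * (K * (nrm b \<bullet> nrm b) - N (nrm b))"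
        using opt by (simp add: algebra_simps)
    qed
    then show ?thesis by simp
  qed
  then have eigen': "nrm b \<bullet> p' = 1 / K * x b" if "b \<in> \<Delta>" for b
    using K1 that by (simp add: field_simps inner_commute)
  have x_nonneg: "x a \<ge> 0" for a unfolding x_def by simp
  \<comment> \<open>At a zero coordinate the eigenvector equation is a vanishing sum of nonpositive
    terms, so no edge joins zero and nonzero coordinates.\<close>
  let ?A = "{a \<in> \<Delta>. x a \<noteq> 0}"
  have "?A = \<Delta>"
  proof (rule simple_connected)
    show "?A \<noteq> {}"
    proof
      assume e: "?A = {}"
      have "N p' = 0" unfolding N_def by (rule sum.neutral) (use e Xp' in auto)
      then show False using Np' K1 by simp
    qed
    fix a b assume a: "a \<in> ?A" and b: "b \<in> \<Delta> - ?A"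
    have t: "x c * (nrm b \<bullet> nrm c) \<le> 0" if "c \<in> \<Delta>" for c
      using nrm_nonpos[of b c] that b x_nonneg[of c] by (cases "c = b") (auto simp: mult_le_0_iff)
    have "(\<Sum>c\<in>\<Delta>. x c * (nrm b \<bullet> nrm c)) = nrm b \<bullet> p'"
      unfolding p'_def by (simp add: inner_sum_right)
    also have "\<dots> = 0" using eigen'[of b] b by auto
    finally have z: "(\<Sum>c\<in>\<Delta>. - (x c * (nrm b \<bullet> nrm c))) = 0" by (simp add: sum_negf)
    have "\<forall>c\<in>\<Delta>. - (x c * (nrm b \<bullet> nrm c)) = 0"
      by (rule sum_nonneg_eq_0_iff[THEN iffD1, OF finite_simple _ z]) (use t in auto)
    then have "nrm b \<bullet> nrm a = 0" using a by auto
    then show "a \<bullet> b = 0" using simple_norm_pos[of a] simple_norm_pos[of b] a b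
      unfolding nrm_def by (auto simp: inner_commute)
  qed auto
  then have "x a > 0" if "a \<in> \<Delta>" for a
  proof -
    have "x a \<noteq> 0" using that \<open>?A = \<Delta>\<close> by blast
    then show ?thesis using x_nonneg[of a] by linarith
  qed
  then show ?thesis using that[of x "1 / K"] K1 eigen' unfolding p'_def by auto
qed

text \<open>The plane is spanned by the parts \<open>p\<close> and \<open>q\<close> of the Perron
  vector on the two colour classes. The eigenvector equation makes each class pair with the other
  part through the same coordinates \<open>x\<close>, so each class acts on the plane as one
  reflection; the mirrors meet at the angle with cosine \<open>1 - l\<close>.\<close>

lemma coxeter_plane:
  assumes bs: "set bs = B" "distinct bs" "pairwise orthogonal B"
    and ws: "set ws = \<Delta> - B" "distinct ws" "pairwise orthogonal (\<Delta> - B)"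
    and sub: "B \<subseteq> \<Delta>"
  obtains v1 v2 :: 'a and \<phi> :: real and k :: "'a \<Rightarrow> real" where "0 < \<phi>" "\<phi> \<le> pi / 2"
    "\<And>a. a \<in> \<Delta> \<Longrightarrow> k a > 0"
    "\<And>a t. a \<in> B \<Longrightarrow> a \<bullet> (cos t *\<^sub>R v1 + sin t *\<^sub>R v2) = k a * sin t"
    "\<And>a t. a \<in> \<Delta> - B \<Longrightarrow> a \<bullet> (cos t *\<^sub>R v1 + sin t *\<^sub>R v2) = k a * sin (\<phi> - t)"
    "\<And>t. coxeter_element bs (cos t *\<^sub>R v1 + sin t *\<^sub>R v2) = cos (- t) *\<^sub>R v1 + sin (- t) *\<^sub>R v2"
    "\<And>t. coxeter_element ws (cos t *\<^sub>R v1 + sin t *\<^sub>R v2) =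
       cos (2 * \<phi> - t) *\<^sub>R v1 + sin (2 * \<phi> - t) *\<^sub>R v2"
proof -
  have B: "set bs = B" "distinct bs" "\<And>x y. x \<in> B \<Longrightarrow> y \<in> B \<Longrightarrow> x \<noteq> y \<Longrightarrow> x \<bullet> y = 0"
    and C: "set ws = \<Delta> - B" "distinct ws"
      "\<And>x y. x \<in> \<Delta> - B \<Longrightarrow> y \<in> \<Delta> - B \<Longrightarrow> x \<noteq> y \<Longrightarrow> x \<bullet> y = 0"
    using bs ws by (auto simp: pairwise_def orthogonal_def)
  obtain x l where x: "\<And>a. a \<in> \<Delta> \<Longrightarrow> x a > 0" and l: "0 < l" "l \<le> 1"
    and eig: "\<And>a. a \<in> \<Delta> \<Longrightarrow> nrm a \<bullet> (\<Sum>b\<in>\<Delta>. x b *\<^sub>R nrm b) = l * x a"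
    using perron by metis
  define \<mu> where "\<mu> = 1 - l"
  have mu: "0 \<le> \<mu>" "\<mu> < 1" using l unfolding \<mu>_def by auto
  define \<phi> where "\<phi> = arccos \<mu>"
  have cphi: "cos \<phi> = \<mu>" unfolding \<phi>_def using mu by (intro cos_arccos) auto
  have phi: "0 < \<phi>" "\<phi> \<le> pi / 2" unfolding \<phi>_def using mu arccos_lt_bounded[of \<mu>] arccos_le_pi2[of \<mu>] by auto
  have sphi: "sin \<phi> > 0" using phi pi_gt_zero by (intro sin_gt_zero) auto
  define p q where "p = (\<Sum>b\<in>B. x b *\<^sub>R nrm b)" and "q = (\<Sum>b\<in>\<Delta> - B. x b *\<^sub>R nrm b)"
  have pq: "(\<Sum>b\<in>\<Delta>. x b *\<^sub>R nrm b) = p + q"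
    unfolding p_def q_def using sum.subset_diff[OF sub finite_simple, of "\<lambda>b. x b *\<^sub>R nrm b"] by simp
  have own: "nrm a \<bullet> (\<Sum>b\<in>S. x b *\<^sub>R nrm b) = x a"
    if S: "a \<in> S" "S \<subseteq> \<Delta>" "\<And>x y. x \<in> S \<Longrightarrow> y \<in> S \<Longrightarrow> x \<noteq> y \<Longrightarrow> x \<bullet> y = 0" for a S
  proof -
    have "nrm a \<bullet> (\<Sum>b\<in>S. x b *\<^sub>R nrm b) = (\<Sum>b\<in>S. if b = a then x b else 0)"
      unfolding inner_sum_right
    proof (rule sum.cong)
      fix b assume b: "b \<in> S"
      show "nrm a \<bullet> x b *\<^sub>R nrm b = (if b = a then x b else 0)"
      proof (cases "b = a")
        case True then show ?thesis using nrm_self[of a] S by auto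
      next
        case False
        then have "a \<bullet> b = 0" using S(3)[of a b] S(1) b by auto
        then show ?thesis using False by (simp add: nrm_def)
      qed
    qed simp
    then show ?thesis using S finite_subset[OF S(2) finite_simple] by simp
  qed
  have Bp: "nrm a \<bullet> p = x a" if "a \<in> B" for a unfolding p_def by (rule own) (use that sub B in auto)
  have Cq: "nrm a \<bullet> q = x a" if "a \<in> \<Delta> - B" for a unfolding q_def by (rule own) (use that C in auto)
  \<comment> \<open>The part on the own class contributes \<open>x a\<close> to
    \<open>l * x a\<close>, which leaves \<open>(l - 1) * x a\<close>.\<close>
  have Bq: "nrm a \<bullet> q = - \<mu> * x a" if "a \<in> B" for a
    using eig[of a] Bp[OF that] that sub unfolding pq \<mu>_def by (auto simp: inner_add_right algebra_simps)
  have Cp: "nrm a \<bullet> p = - \<mu> * x a" if "a \<in> \<Delta> - B" for a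
    using eig[of a] Cq[OF that] that unfolding pq \<mu>_def by (auto simp: inner_add_right algebra_simps)
  \<comment> \<open>Adding a multiple of \<open>p\<close> makes \<open>q\<close> orthogonal to
    \<open>B\<close>; dividing by \<open>sin \<phi>\<close> turns the pairings with the other class
    into \<open>sin (\<phi> - t)\<close>.\<close>
  define v where "v = (q + \<mu> *\<^sub>R p) /\<^sub>R sin \<phi>"
  have s2: "1 - \<mu> * \<mu> = sin \<phi> * sin \<phi>"
    using sin_cos_squared_add[of \<phi>] unfolding cphi by (simp add: power2_eq_square)
  have Bv: "nrm a \<bullet> v = 0" if "a \<in> B" for a
    using Bp[OF that] Bq[OF that] unfolding v_def by (simp add: inner_add_right)
  have Cv: "nrm a \<bullet> v = sin \<phi> * x a" if "a \<in> \<Delta> - B" for a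
  proof -
    have "nrm a \<bullet> v = (1 - \<mu> * \<mu>) * x a / sin \<phi>"
      using Cp[OF that] Cq[OF that] unfolding v_def by (simp add: inner_add_right algebra_simps divide_inverse)
    then show ?thesis using sphi unfolding s2 by simp
  qed
  define g where "g t = cos t *\<^sub>R v + sin t *\<^sub>R p" for t
  have Bg: "nrm a \<bullet> g t = x a * sin t" if "a \<in> B" for a t
    using Bp[OF that] Bv[OF that] unfolding g_def by (simp add: inner_add_right)
  have Cg: "nrm a \<bullet> g t = x a * sin (\<phi> - t)" if "a \<in> \<Delta> - B" for a t
    using Cp[OF that] Cv[OF that] unfolding g_def sin_diff cphi by (simp add: inner_add_right algebra_simps)
  have nrm_inner: "a \<bullet> y = norm a * (nrm a \<bullet> y)" if "a \<in> \<Delta>" for a y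
    using simple_norm_pos[OF that] unfolding nrm_def by simp
  have refl_nrm: "(2 * (a \<bullet> y) / (a \<bullet> a)) *\<^sub>R a = (2 * (nrm a \<bullet> y)) *\<^sub>R nrm a" for a y
    unfolding nrm_def by (simp add: dot_square_norm power2_eq_square divide_inverse mult_ac)
  have q_eq: "q = sin \<phi> *\<^sub>R v - \<mu> *\<^sub>R p" using sphi unfolding v_def by simp
  have "coxeter_element bs (g t) = g (- t)" for t
  proof -
    have "coxeter_element bs (g t) = g t - (\<Sum>a\<in>B. (2 * (nrm a \<bullet> g t)) *\<^sub>R nrm a)"
      using orthogonal_word[OF B(2), of "g t"] B(1,3) refl_nrm by simp
    also have "(\<Sum>a\<in>B. (2 * (nrm a \<bullet> g t)) *\<^sub>R nrm a) = (2 * sin t) *\<^sub>R p"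
      unfolding p_def scaleR_sum_right by (rule sum.cong) (auto simp: Bg)
    finally have "coxeter_element bs (g t) = g t - (2 * sin t) *\<^sub>R p" .
    moreover have "(2 * sin t) *\<^sub>R p = sin t *\<^sub>R p + sin t *\<^sub>R p" by (simp flip: scaleR_add_left)
    ultimately show ?thesis unfolding g_def by simp
  qed
  moreover have "coxeter_element ws (g t) = g (2 * \<phi> - t)" for t
  proof -
    have e12: "cos t - 2 * sin (\<phi> - t) * sin \<phi> = cos (2 * \<phi> - t)"
      "sin t + 2 * sin (\<phi> - t) * \<mu> = sin (2 * \<phi> - t)"
    proof -
      define s where "s = \<phi> - t"
      have e: "2 * \<phi> - t = \<phi> + s" "\<phi> - t = s" and "t = \<phi> - s" unfolding s_def by simp_all
      then have "cos t = cos (\<phi> - s)" "sin t = sin (\<phi> - s)" by simp_all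
      note ct = this[unfolded cos_diff sin_diff]
      show "cos t - 2 * sin (\<phi> - t) * sin \<phi> = cos (2 * \<phi> - t)"
        "sin t + 2 * sin (\<phi> - t) * \<mu> = sin (2 * \<phi> - t)"
        unfolding e ct cos_add sin_add cphi by simp_all
    qed
    have "coxeter_element ws (g t) = g t - (\<Sum>a\<in>\<Delta> - B. (2 * (nrm a \<bullet> g t)) *\<^sub>R nrm a)"
      using orthogonal_word[OF C(2), of "g t"] C(1,3) refl_nrm by simp
    also have "(\<Sum>a\<in>\<Delta> - B. (2 * (nrm a \<bullet> g t)) *\<^sub>R nrm a) = (2 * sin (\<phi> - t)) *\<^sub>R q"
      unfolding q_def scaleR_sum_right by (rule sum.cong) (auto simp: Cg)
    also have "g t - \<dots> = (cos t - 2 * sin (\<phi> - t) * sin \<phi>) *\<^sub>R v + (sin t + 2 * sin (\<phi> - t) * \<mu>) *\<^sub>R p"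
      unfolding g_def q_eq by (simp add: algebra_simps)
    finally show ?thesis unfolding e12 g_def .
  qed
  moreover have "norm a * x a > 0" if "a \<in> \<Delta>" for a using x[OF that] simple_norm_pos[OF that] by simp
  moreover have "a \<bullet> g t = (norm a * x a) * sin t" if "a \<in> B" for a t
    using nrm_inner[of a "g t"] that sub Bg by (auto simp: mult.assoc)
  moreover have "a \<bullet> g t = (norm a * x a) * sin (\<phi> - t)" if "a \<in> \<Delta> - B" for a t
    using nrm_inner[of a "g t"] that Cg by (auto simp: mult.assoc)
  ultimately show ?thesis
    using that[of \<phi> "\<lambda>a. norm a * x a" v p] phi unfolding g_def by blast
qed

text \<open>A point of the closed chamber annihilates only roots supported on \<open>B\<close>, and
  over an orthogonal \<open>B\<close> these are the elements of \<open>B\<close> and their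
  negatives.\<close>

lemma roots_through_wall:
  assumes sub: "B \<subseteq> \<Delta>" and orth: "\<And>x y. x \<in> B \<Longrightarrow> y \<in> B \<Longrightarrow> x \<noteq> y \<Longrightarrow> x \<bullet> y = 0"
    and z: "\<And>a. a \<in> B \<Longrightarrow> a \<bullet> x = 0" and nz: "\<And>a. a \<in> \<Delta> - B \<Longrightarrow> a \<bullet> x > 0"
  shows "card {b \<in> \<Phi>. b \<bullet> x = 0} = 2 * card B"
proof -
  have pos_B: "b \<in> B" if b: "b \<in> Pos" and bx: "b \<bullet> x = 0" for b
  proof -
    have nn: "(b \<bullet> \<omega> a) * (a \<bullet> x) \<ge> 0" if "a \<in> \<Delta>" for a
      using pos_coeff_nonneg[OF b that] z[of a] nz[of a] that by (cases "a \<in> B") auto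
    have "(\<Sum>a\<in>\<Delta>. (b \<bullet> \<omega> a) * (a \<bullet> x)) = 0" using bx inner_expansion[of b x] by simp
    then have "\<forall>a\<in>\<Delta>. (b \<bullet> \<omega> a) * (a \<bullet> x) = 0"
      using sum_nonneg_eq_0_iff[of \<Delta> "\<lambda>a. (b \<bullet> \<omega> a) * (a \<bullet> x)", OF finite_simple nn] by blast
    then have supp: "b \<bullet> \<omega> a = 0" if "a \<in> \<Delta> - B" for a using nz[OF that] that by auto
    obtain a where a: "a \<in> \<Delta>" "b \<bullet> \<omega> a > 0" "a \<bullet> b > 0" using pos_inner_simple[OF b] by auto
    then have aB: "a \<in> B" using supp by force
    \<comment> \<open>On an orthogonal support the reflection in \<open>a\<close> negates the
      coefficient of \<open>a\<close>, impossible for a positive root other than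
      \<open>a\<close>.\<close>
    have "b = a"
    proof (rule ccontr)
      assume "b \<noteq> a"
      then have "reflection a b \<in> Pos" using simple_reflection_pos[OF a(1) b] by simp
      from pos_coeff_nonneg[OF this a(1)]
      have "b \<bullet> \<omega> a - 2 * (a \<bullet> b) / (a \<bullet> a) \<ge> 0" using reflection_coeff[OF a(1) a(1), of b] by simp
      moreover have "a \<bullet> b = (b \<bullet> \<omega> a) * (a \<bullet> a)"
      proof -
        have "b \<bullet> a = (\<Sum>d\<in>\<Delta>. (b \<bullet> \<omega> d) * (d \<bullet> a))" by (rule inner_expansion)
        also have "\<dots> = (\<Sum>d\<in>\<Delta>. if d = a then (b \<bullet> \<omega> d) * (d \<bullet> a) else 0)"
          by (rule sum.cong) (use supp orth aB in auto)
        also have "\<dots> = (b \<bullet> \<omega> a) * (a \<bullet> a)" using a finite_simple by simp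
        finally show ?thesis by (simp add: inner_commute)
      qed
      moreover have "a \<bullet> a > 0" using inner_root_pos a simple_subset by blast
      ultimately show False using a(2) by simp
    qed
    then show ?thesis using aB by simp
  qed
  have fB: "finite B" using sub finite_simple finite_subset by auto
  have "{b \<in> \<Phi>. b \<bullet> x = 0} = B \<union> uminus ` B"
  proof (intro equalityI subsetI)
    fix b assume b: "b \<in> {b \<in> \<Phi>. b \<bullet> x = 0}"
    show "b \<in> B \<union> uminus ` B"
    proof (cases "b \<in> Pos")
      case False
      then have "- b \<in> B" using b not_pos_iff[of b] pos_B[of "- b"] by auto
      then show ?thesis by (metis UnI2 imageI minus_minus)
    qed (use pos_B b in auto)
  qed (use sub simple_subset uminus_root z in auto)
  moreover have "- b \<notin> B" if "b \<in> B" for b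
    using that sub simple_pos[of b] simple_pos[of "- b"] not_pos_iff[of b] simple_subset by auto
  then have "B \<inter> uminus ` B = {}" by auto
  moreover have "card (uminus ` B) = card B" by (intro card_image) auto
  ultimately show ?thesis using fB by (simp add: card_Un_disjoint)
qed

lemma Sym_nonvanishing:
  assumes w: "w \<in> Sym" and "\<And>b. b \<in> \<Phi> \<Longrightarrow> b \<bullet> x \<noteq> 0" "b \<in> \<Phi>"
  shows "b \<bullet> w x \<noteq> 0"
  using Sym_adjoint[OF w, of b x] assms(2)[OF Sym_root[OF Sym_inv[OF w] assms(3)]] by simp

lemma Sym_card_vanishing:
  assumes w: "w \<in> Sym"
  shows "card {b \<in> \<Phi>. b \<bullet> w x = 0} = card {b \<in> \<Phi>. b \<bullet> x = 0}"
proof (rule bij_betw_same_card[of "inv w"], rule bij_betwI[where g = w])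
  show "inv w \<in> {b \<in> \<Phi>. b \<bullet> w x = 0} \<rightarrow> {b \<in> \<Phi>. b \<bullet> x = 0}"
    using Sym_adjoint[OF w] Sym_root[OF Sym_inv[OF w]] by auto
  show "w \<in> {b \<in> \<Phi>. b \<bullet> x = 0} \<rightarrow> {b \<in> \<Phi>. b \<bullet> w x = 0}"
    using Sym_inner[OF w] Sym_root[OF w] by auto
qed (use Sym_inv_cancel[OF w] in auto)

text \<open>Steinberg's argument: the two colour classes generate a dihedral action on the Coxeter
  plane, with fundamental sector of angle \<open>\<phi> = \<pi> / m\<close>.  Every root vanishes on exactly two of
  the \<open>2 m\<close> rays bounding the sectors, which gives \<open>m\<close> times the rank as the number of roots.\<close>

lemma bipartite_coxeter_order:
  assumes bs: "set bs = B" "distinct bs" "pairwise orthogonal B"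
    and ws: "set ws = \<Delta> - B" "distinct ws" "pairwise orthogonal (\<Delta> - B)"
    and sub: "B \<subseteq> \<Delta>" and ne: "B \<noteq> {}" "\<Delta> - B \<noteq> {}"
  shows "coxeter_element (bs @ ws) ^^ j = id \<longleftrightarrow> cox dvd j"
proof -
  have B: "set bs = B" "distinct bs" "\<And>x y. x \<in> B \<Longrightarrow> y \<in> B \<Longrightarrow> x \<noteq> y \<Longrightarrow> x \<bullet> y = 0"
    and C: "set ws = \<Delta> - B" "distinct ws"
      "\<And>x y. x \<in> \<Delta> - B \<Longrightarrow> y \<in> \<Delta> - B \<Longrightarrow> x \<noteq> y \<Longrightarrow> x \<bullet> y = 0"
    using bs ws by (auto simp: pairwise_def orthogonal_def)
  obtain v1 v2 \<phi> k where phi: "0 < \<phi>" "\<phi> \<le> pi / 2" and k: "\<And>a. a \<in> \<Delta> \<Longrightarrow> k a > 0"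
    and Bg': "\<And>a t. a \<in> B \<Longrightarrow> a \<bullet> (cos t *\<^sub>R v1 + sin t *\<^sub>R v2) = k a * sin t"
    and Cg': "\<And>a t. a \<in> \<Delta> - B \<Longrightarrow> a \<bullet> (cos t *\<^sub>R v1 + sin t *\<^sub>R v2) = k a * sin (\<phi> - t)"
    and bw': "\<And>t. coxeter_element bs (cos t *\<^sub>R v1 + sin t *\<^sub>R v2) = cos (- t) *\<^sub>R v1 + sin (- t) *\<^sub>R v2"
    "\<And>t. coxeter_element ws (cos t *\<^sub>R v1 + sin t *\<^sub>R v2) =
       cos (2 * \<phi> - t) *\<^sub>R v1 + sin (2 * \<phi> - t) *\<^sub>R v2"
    by (rule coxeter_plane[OF bs ws sub]) (rule that)
  define g where "g t = cos t *\<^sub>R v1 + sin t *\<^sub>R v2" for t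
  note Bg = Bg'[folded g_def] and Cg = Cg'[folded g_def] and bw = bw'[folded g_def]
  have S: "coxeter_element bs \<in> Sym" "coxeter_element ws \<in> Sym"
    using coxeter_element_Sym B(1) C(1) sub simple_subset by blast+
  have g_pi: "g (t + pi) = - g t" for t unfolding g_def by simp
  have dom: "b \<bullet> g t > 0" if t: "0 < t" "t < \<phi>" and b: "b \<in> Pos" for b t
  proof -
    have "sin t > 0" "sin (\<phi> - t) > 0" using t phi pi_gt_zero by (auto intro!: sin_gt_zero)
    then have at: "a \<bullet> g t > 0" if a: "a \<in> \<Delta>" for a
      using Bg[of a t] Cg[of a t] k[OF a] a by (cases "a \<in> B") auto
    obtain a where a: "a \<in> \<Delta>" "b \<bullet> \<omega> a > 0" using pos_inner_simple[OF b] by auto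
    have "0 < (\<Sum>a\<in>\<Delta>. (b \<bullet> \<omega> a) * (a \<bullet> g t))"
      by (rule sum_pos2[OF finite_simple a(1)])
        (use a at pos_coeff_nonneg[OF b] in \<open>auto intro: mult_nonneg_nonneg less_imp_le\<close>)
    then show ?thesis using inner_expansion[of b "g t"] by simp
  qed
  define G where "G t \<longleftrightarrow> (\<forall>b\<in>\<Phi>. b \<bullet> g t \<noteq> 0)" for t
  have G0: "G t" if "0 < t" "t < \<phi>" for t
    unfolding G_def
  proof
    fix b assume "b \<in> \<Phi>"
    then show "b \<bullet> g t \<noteq> 0" using dom[OF that, of b] dom[OF that, of "- b"] not_pos_iff[of b] by auto
  qed
  have G_neg: "G (- t)" if "G t" for t
    using that Sym_nonvanishing[OF S(1), of "g t"] bw(1) unfolding G_def by auto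
  have G_refl: "G (2 * \<phi> - t)" if "G t" for t
    using that Sym_nonvanishing[OF S(2), of "g t"] bw(2) unfolding G_def by auto
  \<comment> \<open>The two words compose to a rotation by \<open>2 * \<phi>\<close>, and each
    preserves regularity.\<close>
  have G_shift: "G (t + 2 * \<phi> * of_int i)" if G: "G t" for t i
  proof (induction i rule: int_induct[where k = 0])
    case base show ?case using G by simp
  next
    case (step1 i)
    have e: "2 * \<phi> - - (t + 2 * \<phi> * of_int i) = t + 2 * \<phi> * of_int (i + 1)"
      by (simp add: algebra_simps)
    show ?case using G_refl[OF G_neg[OF step1(2)]] unfolding e .
  next
    case (step2 i)
    have e: "- (2 * \<phi> - (t + 2 * \<phi> * of_int i)) = t + 2 * \<phi> * of_int (i - 1)"
      by (simp add: algebra_simps)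
    show ?case using G_neg[OF G_refl[OF step2(2)]] unfolding e .
  qed
  \<comment> \<open>Up to rotation \<open>t\<close> lies between \<open>0\<close> and
    \<open>2 * \<phi>\<close>. The first open sector is regular, the second is its mirror image, and
    only the bounding rays remain.\<close>
  have zero: "\<exists>i::int. t = of_int i * \<phi>" if nG: "\<not> G t" for t
  proof -
    define i where "i = \<lfloor>t / (2 * \<phi>)\<rfloor>"
    define s where "s = t - 2 * \<phi> * of_int i"
    have s: "0 \<le> s" "s < 2 * \<phi>"
    proof -
      have "of_int i \<le> t / (2 * \<phi>)" "t / (2 * \<phi>) < of_int i + 1" unfolding i_def by linarith+
      then show "0 \<le> s" "s < 2 * \<phi>" unfolding s_def using phi(1) by (auto simp: field_simps)
    qed
    have "\<not> G s"
    proof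
      assume "G s"
      from G_shift[OF this, of i] nG show False unfolding s_def by simp
    qed
    then have "\<not> (0 < s \<and> s < \<phi>)" using G0 by auto
    moreover have "\<not> (\<phi> < s)"
    proof
      assume "\<phi> < s"
      then have "G (2 * \<phi> - s)" using G0[of "2 * \<phi> - s"] s by auto
      from G_refl[OF this] \<open>\<not> G s\<close> show False by simp
    qed
    ultimately have "s = 0 \<or> s = \<phi>" using s by linarith
    then show ?thesis
    proof
      assume "s = 0" then show ?thesis unfolding s_def by (intro exI[of _ "2 * i"]) simp
    next
      assume "s = \<phi>" then show ?thesis unfolding s_def
        by (intro exI[of _ "2 * i + 1"]) (simp add: algebra_simps)
    qed
  qed
  obtain a0 where a0: "a0 \<in> B" using ne by auto
  obtain c0 where c0: "c0 \<in> \<Delta> - B" using ne by auto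
  \<comment> \<open>A root of \<open>B\<close> vanishes at the angle \<open>pi\<close>, which is
    therefore a multiple of \<open>\<phi>\<close>; this produces \<open>m\<close>.\<close>
  have "\<not> G pi" unfolding G_def using a0 sub simple_subset Bg[OF a0, of pi] by auto
  then obtain m' :: int where m': "pi = of_int m' * \<phi>" using zero by blast
  have "m' > 0"
  proof -
    have "of_int m' * \<phi> > 0" using m' pi_gt_zero by linarith
    then show ?thesis using phi(1) by (simp add: zero_less_mult_iff)
  qed
  define m where "m = nat m'"
  have m: "pi = real m * \<phi>" "m > 0" using m' \<open>m' > 0\<close> unfolding m_def by auto
  define f where "f i = card {b \<in> \<Phi>. b \<bullet> g (real i * \<phi>) = 0}" for i
  have f0: "f 0 = 2 * card B"
    unfolding f_def
  proof (rule roots_through_wall)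
    show "a \<bullet> g (real 0 * \<phi>) > 0" if "a \<in> \<Delta> - B" for a
      using Cg[OF that, of 0] k[of a] that phi pi_gt_zero by (auto intro!: mult_pos_pos sin_gt_zero)
  qed (use sub B(3) Bg in auto)
  have f1: "f (Suc 0) = 2 * card (\<Delta> - B)"
    unfolding f_def
  proof (rule roots_through_wall)
    show "a \<bullet> g (real (Suc 0) * \<phi>) > 0" if "a \<in> \<Delta> - (\<Delta> - B)" for a
    proof -
      have "a \<in> B" using that by auto
      then show ?thesis using Bg[of a \<phi>] k[of a] sub phi pi_gt_zero
        by (auto intro!: mult_pos_pos sin_gt_zero)
    qed
  qed (use C(3) Cg in auto)
  have f2: "f (Suc (Suc i)) = f i" for i
  proof -
    have "g (real (Suc (Suc i)) * \<phi>) = coxeter_element ws (coxeter_element bs (g (real i * \<phi>)))"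
      unfolding bw by (simp add: algebra_simps)
    then show ?thesis unfolding f_def using Sym_card_vanishing[OF S(1)] Sym_card_vanishing[OF S(2)] by simp
  qed
  have f_even: "f (2 * i) = f 0" and f_odd: "f (Suc (2 * i)) = f (Suc 0)" for i
    by (induction i) (simp_all add: f2)
  have sum_f: "(\<Sum>i<2 * n. f i) = n * (f 0 + f (Suc 0))" for n
    by (induction n) (simp_all add: f_even f_odd)
  have card_BC: "card B + card (\<Delta> - B) = card \<Delta>"
    using sub finite_simple by (metis card_Diff_subset card_mono finite_subset le_add_diff_inverse)
  \<comment> \<open>Along the curve a root is a nonzero multiple of a sine, with zeros
    \<open>pi\<close> apart, that is \<open>m\<close> rays apart. A first zero exists because the
    sign flips over a half turn.\<close>
  have two: "card {i \<in> {..<2 * m}. b \<bullet> g (real i * \<phi>) = 0} = 2" if b: "b \<in> \<Phi>" for b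
  proof -
    define u where "u t = b \<bullet> g t" for t
    have u_pi: "u (t + pi) = - u t" for t unfolding u_def g_pi by simp
    have cont: "continuous_on {0..pi} u"
      unfolding u_def g_def by (intro continuous_intros)
    have "\<exists>t. 0 \<le> t \<and> t < pi \<and> u t = 0"
    proof (cases "u 0 = 0")
      case False
      have "\<exists>t. 0 \<le> t \<and> t \<le> pi \<and> u t = 0"
      proof (cases "u 0 < 0")
        case True
        then show ?thesis using IVT'[of u 0 0 pi] u_pi[of 0] cont pi_gt_zero by auto
      next
        case F: False
        then show ?thesis using IVT2'[of u pi 0 0] u_pi[of 0] cont pi_gt_zero by auto
      qed
      then obtain t where t: "0 \<le> t" "t \<le> pi" "u t = 0" by auto
      then have "t \<noteq> pi" using u_pi[of 0] False by auto
      then show ?thesis using t by (intro exI[of _ t]) auto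
    qed (use pi_gt_zero in auto)
    then obtain t where t: "0 \<le> t" "t < pi" "u t = 0" by auto
    then have "\<not> G t" using b unfolding G_def u_def by auto
    then obtain i0 where i0: "t = of_int i0 * \<phi>" using zero by blast
    have "0 \<le> i0" "i0 < int m"
    proof -
      have "0 \<le> of_int i0 * \<phi>" "of_int i0 * \<phi> < real m * \<phi>" using t i0 m by auto
      then show "0 \<le> i0" "i0 < int m" using phi(1) by (auto simp: zero_le_mult_iff)
    qed
    then obtain j0 where j0: "i0 = int j0" "j0 < m" by (metis nonneg_int_cases of_nat_less_iff)
    have tj: "t = real j0 * \<phi>" using i0 j0 by simp
    have u_eq: "u s = u (t + pi / 2) * sin (s - t)" for s
    proof -
      have "u s = u t * cos (s - t) + u (t + pi / 2) * sin (s - t)"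
      proof -
        have s: "cos s = cos (t + (s - t))" "sin s = sin (t + (s - t))" by simp_all
        show ?thesis unfolding u_def g_def s cos_add[of t] sin_add[of t]
          by (simp add: inner_add_right algebra_simps)
      qed
      then show ?thesis using t by simp
    qed
    \<comment> \<open>With amplitude zero the root would also vanish inside the open sector.\<close>
    have R: "u (t + pi / 2) \<noteq> 0"
    proof
      assume "u (t + pi / 2) = 0"
      then have "u (\<phi> / 2) = 0" using u_eq[of "\<phi> / 2"] by simp
      then show False using G0[of "\<phi> / 2"] phi b unfolding G_def u_def by auto
    qed
    have "{i \<in> {..<2 * m}. b \<bullet> g (real i * \<phi>) = 0} = {j0, j0 + m}"
    proof (intro equalityI subsetI)
      fix i assume i: "i \<in> {i \<in> {..<2 * m}. b \<bullet> g (real i * \<phi>) = 0}"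
      then have "sin (real i * \<phi> - t) = 0" using u_eq[of "real i * \<phi>"] R unfolding u_def by auto
      then obtain n :: int where "real i * \<phi> - t = of_int n * pi" using sin_zero_iff_int2 by blast
      then have "(real i - real j0) * \<phi> = (of_int n * real m) * \<phi>" using tj m by (simp add: algebra_simps)
      then have "real i - real j0 = of_int n * real m" using phi(1) by simp
      then have "real_of_int (int i - int j0) = real_of_int (n * int m)" by simp
      then have e: "int i - int j0 = n * int m" by (simp only: of_int_eq_iff)
      have il: "int i < 2 * int m" using i by simp
      have "n < 2"
      proof (rule ccontr)
        assume "\<not> n < 2"
        then have "2 * int m \<le> n * int m" by (intro mult_right_mono) auto
        then show False using e il by linarith
      qed
      moreover have "n > -1"
      proof (rule ccontr)
        assume "\<not> n > -1"
        then have "n * int m \<le> -1 * int m" by (intro mult_right_mono) auto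
        then show False using e j0 by simp
      qed
      ultimately have "n = 0 \<or> n = 1" by linarith
      then show "i \<in> {j0, j0 + m}" using e by auto
    next
      fix i assume i: "i \<in> {j0, j0 + m}"
      have "u (real j0 * \<phi>) = 0" using t tj by simp
      moreover have "u (real (j0 + m) * \<phi>) = 0"
        using u_pi[of t] t tj m by (simp add: algebra_simps)
      ultimately show "i \<in> {i \<in> {..<2 * m}. b \<bullet> g (real i * \<phi>) = 0}"
        using i j0 unfolding u_def by auto
    qed
    then show ?thesis using m by simp
  qed
  \<comment> \<open>Double counting of pairs of a root and a ray on which it vanishes; by rays, the
    values \<open>2 * card B\<close> and \<open>2 * card (\<Delta> - B)\<close> alternate.
    Comparison with \<open>card_roots\<close> identifies \<open>m\<close>.\<close>
  have "(\<Sum>i<2 * m. f i) = 2 * card \<Phi>"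
    unfolding f_def
    by (rule sum_multicount) (use two finite_roots in auto)
  then have "2 * card \<Phi> = m * (2 * card B + 2 * card (\<Delta> - B))" using sum_f[of m] f0 f1 by simp
  also have "\<dots> = 2 * (m * (card B + card (\<Delta> - B)))" by (simp add: algebra_simps)
  finally have "card \<Phi> = m * card \<Delta>" unfolding card_BC by simp
  then have mc: "m = cox" using card_roots card_simple by simp
  let ?c = "coxeter_element (bs @ ws)"
  have c_pow: "(?c ^^ i) (g t) = g (t - 2 * real i * \<phi>)" for i t
  proof (induction i)
    case (Suc i)
    then show ?case by (simp add: bw algebra_simps)
  qed simp
  have words: "set (concat (replicate i (bs @ ws))) \<subseteq> \<Delta>" for i using B(1) C(1) sub by auto
  \<comment> \<open>The \<open>m\<close>-th power rotates by \<open>2 * pi\<close> and so fixes the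
    regular point at the angle \<open>\<phi> / 2\<close>.\<close>
  have c_m: "?c ^^ m = id"
    unfolding coxeter_element_power
  proof (rule regular_fixed_trivial[OF words])
    show "b \<bullet> g (\<phi> / 2) > 0" if "b \<in> Pos" for b using dom[OF _ _ that, of "\<phi> / 2"] phi by simp
    have "(?c ^^ m) (g (\<phi> / 2)) = g (\<phi> / 2 - 2 * pi)" using c_pow[of m "\<phi> / 2"] m by (simp add: mult.assoc)
    also have "\<dots> = g (\<phi> / 2)" unfolding g_def by (simp add: cos_diff sin_diff)
    finally show "coxeter_element (concat (replicate m (bs @ ws))) (g (\<phi> / 2)) = g (\<phi> / 2)"
      unfolding coxeter_element_power .
  qed
  show ?thesis
  proof
    assume "cox dvd j"
    then obtain i where "j = m * i" using mc by auto
    then have "?c ^^ j = (?c ^^ m) ^^ i" by (simp add: funpow_mult mult.commute)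
    also have "\<dots> = id" unfolding c_m by simp
    finally show "?c ^^ j = id" .
  next
    assume "?c ^^ j = id"
    then have e: "g (\<phi> / 2 - 2 * real j * \<phi>) = g (\<phi> / 2)" using c_pow[of j "\<phi> / 2"] by simp
    \<comment> \<open>One root of each colour gives one sine equation. A single one would still
      allow the supplementary angle; their sum forces
      \<open>cos (2 * real j * \<phi>) = 1\<close>.\<close>
    have "sin (\<phi> / 2 - 2 * real j * \<phi>) = sin (\<phi> / 2)"
      using Bg[OF a0, of "\<phi> / 2 - 2 * real j * \<phi>"] Bg[OF a0, of "\<phi> / 2"] k[of a0] a0 sub e by auto
    moreover have "sin (\<phi> - (\<phi> / 2 - 2 * real j * \<phi>)) = sin (\<phi> - \<phi> / 2)"
      using Cg[OF c0, of "\<phi> / 2 - 2 * real j * \<phi>"] Cg[OF c0, of "\<phi> / 2"] k[of c0] c0 e by auto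
    moreover have "\<phi> - (\<phi> / 2 - 2 * real j * \<phi>) = \<phi> / 2 + 2 * real j * \<phi>" "\<phi> - \<phi> / 2 = \<phi> / 2"
      by (simp_all add: field_simps)
    ultimately have "sin (\<phi> / 2 - 2 * real j * \<phi>) + sin (\<phi> / 2 + 2 * real j * \<phi>) = 2 * sin (\<phi> / 2)"
      by simp
    then have "sin (\<phi> / 2) * cos (2 * real j * \<phi>) = sin (\<phi> / 2)"
      unfolding sin_diff sin_add by linarith
    moreover have "sin (\<phi> / 2) > 0" using phi pi_gt_zero by (intro sin_gt_zero) auto
    ultimately have "cos (2 * real j * \<phi>) = 1" by simp
    then obtain n :: int where "2 * real j * \<phi> = of_int n * 2 * pi" using cos_one_2pi_int by blast
    then have "real j * \<phi> = (of_int n * real m) * \<phi>" using m by simp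
    then have "real j = of_int n * real m" using phi(1) by simp
    then have "real_of_int (int j) = real_of_int (n * int m)" by simp
    then have "int j = n * int m" by (simp only: of_int_eq_iff)
    then have "int m dvd int j" by simp
    then show "cox dvd j" using mc by simp
  qed
qed

text \<open>The Coxeter plane requires both colour classes. If one is empty, the simple roots are
  pairwise orthogonal, connectedness leaves rank one, and a single reflection has order
  \<open>2 = cox\<close>.\<close>

lemma coxeter_order:
  assumes "distinct as" "set as = \<Delta>"
  shows "coxeter_element as ^^ j = id \<longleftrightarrow> cox dvd j"
proof -
  obtain B where B: "B \<subseteq> \<Delta>" "\<forall>x\<in>B. \<forall>y\<in>B. x \<noteq> y \<longrightarrow> x \<bullet> y = 0"
    "\<forall>x\<in>\<Delta> - B. \<forall>y\<in>\<Delta> - B. x \<noteq> y \<longrightarrow> x \<bullet> y = 0" using ex_bipartition[OF subset_refl] by blast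
  have mono: "\<exists>a. \<Delta> = {a}" if orth: "\<forall>x\<in>\<Delta>. \<forall>y\<in>\<Delta>. x \<noteq> y \<longrightarrow> x \<bullet> y = 0"
  proof -
    obtain a where a: "a \<in> \<Delta>" using simple_nonempty by auto
    have "{a} = \<Delta>" by (rule simple_connected) (use a orth in auto)
    then show ?thesis by auto
  qed
  show ?thesis
  proof (cases "B = {} \<or> \<Delta> - B = {}")
    case True
    then have "\<Delta> = B \<or> \<Delta> = \<Delta> - B" using B(1) by auto
    then have "\<forall>x\<in>\<Delta>. \<forall>y\<in>\<Delta>. x \<noteq> y \<longrightarrow> x \<bullet> y = 0" using B by metis
    then obtain a where a: "\<Delta> = {a}" using mono by auto
    have as: "as = [a]"
    proof (cases as)
      case (Cons b bs)
      then have "b = a" "set bs \<subseteq> {a}" "a \<notin> set bs" using assms a by auto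
      then show ?thesis using Cons by (cases bs) auto
    qed (use assms a in auto)
    have aP: "a \<in> \<Phi>" "a \<noteq> 0" using a simple_subset roots_nonzero by auto
    have "\<Phi> \<subseteq> span {a}" using span_simple a by auto
    then have "\<Phi> = {a, - a}" using roots_reduced[OF aP(1)] by auto
    moreover have "a \<noteq> - a" using not_pos_iff[OF aP(1)] simple_pos[of a] a by auto
    ultimately have "card \<Phi> = 2" by simp
    moreover have "DIM('a) = 1" using card_simple a by simp
    ultimately have cox: "cox = 2" using card_roots by simp
    have ss: "(reflection a ^^ 2) = id" by (rule ext) (simp add: numeral_2_eq_2)
    have "reflection a ^^ j = id \<longleftrightarrow> even j"
    proof
      assume "even j"
      then obtain i where "j = 2 * i" by auto
      then have "reflection a ^^ j = (reflection a ^^ 2) ^^ i" by (simp add: funpow_mult mult.commute)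
      then show "reflection a ^^ j = id" unfolding ss by simp
    next
      assume e: "reflection a ^^ j = id"
      show "even j"
      proof (rule ccontr)
        assume "odd j"
        then obtain i where "j = Suc (2 * i)" using oddE by fastforce
        then have "reflection a ^^ j = reflection a \<circ> (reflection a ^^ 2) ^^ i"
          by (simp add: funpow_mult mult.commute)
        then have "reflection a = id" unfolding ss using e by simp
        then have "reflection a a = a" by simp
        then show False using \<open>a \<noteq> - a\<close> by simp
      qed
    qed
    then show ?thesis using as cox by simp
  next
    case False
    have fin: "finite B" "finite (\<Delta> - B)" using B(1) finite_simple finite_subset by auto
    obtain bs where bs: "set bs = B" "distinct bs" using finite_distinct_list[OF fin(1)] by auto
    obtain ws where ws: "set ws = \<Delta> - B" "distinct ws" using finite_distinct_list[OF fin(2)] by auto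
    have "cox_eq as (bs @ ws)"
      by (rule coxeter_words_conjugate) (use assms bs ws B(1) in auto)
    then have "coxeter_element as ^^ j = id \<longleftrightarrow> coxeter_element (bs @ ws) ^^ j = id"
      by (rule cox_eq_power)
    also have "\<dots> \<longleftrightarrow> cox dvd j"
      by (rule bipartite_coxeter_order) (use bs ws B False in \<open>auto simp: pairwise_def orthogonal_def\<close>)
    finally show ?thesis .
  qed
qed

lemma coxeter_number_eq:
  assumes "distinct as" "set as = \<Delta>" shows "coxeter_number as = cox"
  unfolding coxeter_number_def
proof (rule Least_equality)
  show "0 < cox \<and> coxeter_element as ^^ cox = id"
    using coxeter_order[OF assms, of cox] by (simp add: cox_def del: funpow.simps)
  show "cox \<le> y" if "0 < y \<and> coxeter_element as ^^ y = id" for y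
    using that coxeter_order[OF assms, of y] dvd_imp_le by auto
qed

section \<open>Alcoves\<close>

abbreviation Lat :: "'a set" where "Lat \<equiv> coweight_lattice \<Delta>"

lemma lattice_root: "x \<in> Lat \<Longrightarrow> b \<in> \<Phi> \<Longrightarrow> b \<bullet> x \<in> \<int>"
  unfolding inner_expansion[of b x] coweight_lattice_def
  by (intro Ints_sum Ints_mult root_coeff_int) auto

lemma lattice_add: "x \<in> Lat \<Longrightarrow> y \<in> Lat \<Longrightarrow> x + y \<in> Lat"
  and lattice_diff: "x \<in> Lat \<Longrightarrow> y \<in> Lat \<Longrightarrow> x - y \<in> Lat"
  and lattice_scale: "x \<in> Lat \<Longrightarrow> of_int i *\<^sub>R x \<in> Lat"
  and lattice_zero: "0 \<in> Lat"
  unfolding coweight_lattice_def by (auto simp: inner_add_right inner_diff_right)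

lemma lattice_scale_nat: "x \<in> Lat \<Longrightarrow> real i *\<^sub>R x \<in> Lat"
  using lattice_scale[of x "int i"] by simp

lemma lattice_rho: "\<rho> \<in> Lat"
  unfolding coweight_lattice_def using simple_rho by auto

lemma lattice_coroot: "a \<in> \<Phi> \<Longrightarrow> (2 / (a \<bullet> a)) *\<^sub>R a \<in> Lat"
  unfolding coweight_lattice_def using roots_integral[of a] simple_subset
  by (auto simp: inner_commute)

lemma Sym_lattice: "w \<in> Sym \<Longrightarrow> x \<in> Lat \<Longrightarrow> w x \<in> Lat"
  using lattice_root Sym_root[OF Sym_inv] simple_subset Sym_adjoint
  unfolding coweight_lattice_def by (smt (verit) mem_Collect_eq subsetD)

lemma Sym_add: "w \<in> Sym \<Longrightarrow> w (x + y) = w x + w y"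
  and Sym_diff: "w \<in> Sym \<Longrightarrow> w (x - y) = w x - w y"
  and Sym_scale: "w \<in> Sym \<Longrightarrow> w (c *\<^sub>R x) = c *\<^sub>R w x"
  and Sym_neg: "w \<in> Sym \<Longrightarrow> w (- x) = - w x"
  using Sym_linear linear_add linear_diff linear_scale linear_neg by blast+

lemma cox_pos: "cox > 0"
  by (simp add: cox_def)

text \<open>The squared distance to \<open>p\<close> changes by a positive multiple of the product
  of the signed heights of \<open>y\<close> and \<open>p\<close> over the mirror; it drops exactly
  when the mirror separates them.\<close>

lemma affine_reflection_dist:
  assumes "a \<bullet> a > 0" "y' = y - ((a \<bullet> y - c) * (2 / (a \<bullet> a))) *\<^sub>R a"
  shows "(y' - p) \<bullet> (y' - p) = (y - p) \<bullet> (y - p) + 4 * (a \<bullet> y - c) * (a \<bullet> p - c) / (a \<bullet> a)"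
proof -
  define u where "u = 2 / (a \<bullet> a)"
  define d where "d = a \<bullet> y - c"
  have ua: "u * (a \<bullet> a) = 2" using assms(1) unfolding u_def by simp
  define r where "r = y - p"
  have e: "y' - p = r - (d * u) *\<^sub>R a" using assms(2) unfolding u_def d_def r_def by simp
  have "(y' - p) \<bullet> (y' - p) = r \<bullet> r - 2 * (d * u) * (a \<bullet> r) + (d * u) * (d * (u * (a \<bullet> a)))"
    unfolding e by (simp add: inner_diff_left inner_diff_right inner_commute algebra_simps)
  also have "\<dots> = (y - p) \<bullet> (y - p) + 2 * u * d * (d - a \<bullet> y + a \<bullet> p)"
    unfolding ua r_def by (simp add: inner_diff_right algebra_simps)
  also have "d - a \<bullet> y + a \<bullet> p = a \<bullet> p - c" unfolding d_def by simp
  finally show ?thesis unfolding u_def d_def by simp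
qed

lemma finite_bounded_coset:
  fixes q K c :: real
  assumes "q > 0" shows "finite {c - q * of_int i | i. \<bar>c - q * of_int i\<bar> \<le> K}"
proof (rule finite_subset)
  show "{c - q * of_int i | i. \<bar>c - q * of_int i\<bar> \<le> K} \<subseteq>
    (\<lambda>i. c - q * of_int i) ` {\<lfloor>(c - K) / q\<rfloor>..\<lceil>(c + K) / q\<rceil>}"
  proof
    fix u assume "u \<in> {c - q * of_int i | i. \<bar>c - q * of_int i\<bar> \<le> K}"
    then obtain i where i: "u = c - q * of_int i" "\<bar>c - q * of_int i\<bar> \<le> K" by auto
    then have "(c - K) / q \<le> of_int i" "of_int i \<le> (c + K) / q"
      using assms by (auto simp: field_simps)
    then have "\<lfloor>(c - K) / q\<rfloor> \<le> i" "i \<le> \<lceil>(c + K) / q\<rceil>" by linarith+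
    then show "u \<in> (\<lambda>i. c - q * of_int i) ` {\<lfloor>(c - K) / q\<rfloor>..\<lceil>(c + K) / q\<rceil>}" using i by auto
  qed
qed simp

text \<open>A point of the orbit of \<open>x\<close> nearest to the interior point \<open>(q / h) \<rho>\<close> of the dilated
  fundamental alcove lies in that alcove: otherwise a reflection in a wall brings it closer.\<close>

lemma alcove_reduction:
  fixes q :: real
  assumes q: "q > 0" and reg: "\<And>b i. b \<in> \<Phi> \<Longrightarrow> b \<bullet> x \<noteq> q * of_int i"
  obtains w z y where "w \<in> Sym" "z \<in> Lat" "x = w y + q *\<^sub>R z"
    "\<And>b. b \<in> Pos \<Longrightarrow> 0 < b \<bullet> y \<and> b \<bullet> y < q"
proof -
  define Orb where "Orb = {y. \<exists>w\<in>Sym. \<exists>z\<in>Lat. x = w y + q *\<^sub>R z}"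
  define p where "p = (q / real cox) *\<^sub>R \<rho>"
  define D where "D y = (y - p) \<bullet> (y - p)" for y
  have x_Orb: "x \<in> Orb" unfolding Orb_def using Sym_id(1) lattice_zero by force
  have coset: "\<exists>b\<in>\<Phi>. \<exists>i. a \<bullet> y = b \<bullet> x - q * of_int i" if y: "y \<in> Orb" and a: "a \<in> \<Phi>" for y a
  proof -
    obtain w z where wz: "w \<in> Sym" "z \<in> Lat" "x = w y + q *\<^sub>R z" using y unfolding Orb_def by auto
    have wa: "w a \<in> \<Phi>" using Sym_root wz a by auto
    obtain i where i: "w a \<bullet> z = of_int i" using lattice_root[OF wz(2) wa] by (auto elim!: Ints_cases)
    have "w a \<bullet> x = a \<bullet> y + q * of_int i"
      unfolding wz(3) using Sym_inner[OF wz(1)] i by (simp add: inner_add_right)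
    then show ?thesis using wa by (intro bexI[of _ "w a"] exI[of _ i]) auto
  qed
  \<comment> \<open>At each simple root the orbit takes values in finitely many cosets of the
    multiples of \<open>q\<close>, so a bounded part of it is finite and a nearest point
    exists.\<close>
  have fin: "finite {y \<in> Orb. D y \<le> D x}"
  proof -
    define K where "K = (\<Sum>a\<in>\<Delta>. norm a) * (norm p + sqrt (D x))"
    define F where "F = (\<Union>b\<in>\<Phi>. {b \<bullet> x - q * of_int i | i. \<bar>b \<bullet> x - q * of_int i\<bar> \<le> K})"
    have "finite F" unfolding F_def using finite_roots finite_bounded_coset[OF q] by blast
    have "{y \<in> Orb. D y \<le> D x} \<subseteq> {y. \<forall>a\<in>\<Delta>. a \<bullet> y \<in> F}"
    proof
      fix y assume y: "y \<in> {y \<in> Orb. D y \<le> D x}"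
      have "norm (y - p) \<le> sqrt (D x)" using y unfolding D_def
        by (simp add: norm_eq_sqrt_inner)
      then have ny: "norm y \<le> norm p + sqrt (D x)" using norm_triangle_sub[of y p] by linarith
      have "a \<bullet> y \<in> F" if a: "a \<in> \<Delta>" for a
      proof -
        have "\<bar>a \<bullet> y\<bar> \<le> norm a * norm y" by (rule Cauchy_Schwarz_ineq2)
        also have "\<dots> \<le> (\<Sum>a\<in>\<Delta>. norm a) * (norm p + sqrt (D x))"
          by (intro mult_mono ny member_le_sum sum_nonneg) (use a finite_simple in auto)
        finally have "\<bar>a \<bullet> y\<bar> \<le> K" unfolding K_def .
        then show ?thesis using coset[of y a] y a simple_subset unfolding F_def by force
      qed
      then show "y \<in> {y. \<forall>a\<in>\<Delta>. a \<bullet> y \<in> F}" by blast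
    qed
    then show ?thesis using finite_simple_coordinates[OF \<open>finite F\<close>] by (rule finite_subset)
  qed
  have "{y \<in> Orb. D y \<le> D x} \<noteq> {}" using x_Orb by auto
  from finite_has_max[OF fin this, of "\<lambda>y. - D y"]
  obtain y where y0: "y \<in> {y \<in> Orb. D y \<le> D x}"
    and mn0: "\<And>y'. y' \<in> {y \<in> Orb. D y \<le> D x} \<Longrightarrow> - D y' \<le> - D y" by blast
  from y0 have y: "y \<in> Orb" "D y \<le> D x" by auto
  have mn: "D y \<le> D y'" if "y' \<in> Orb" for y'
    using that mn0[of y'] y(2) by (cases "D y' \<le> D x") auto
  obtain w z where wz: "w \<in> Sym" "z \<in> Lat" "x = w y + q *\<^sub>R z" using y unfolding Orb_def by auto
  have side: "(a \<bullet> y - q * of_int i) * (a \<bullet> p - q * of_int i) \<ge> 0" if a: "a \<in> \<Phi>" for a i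
  proof (rule ccontr)
    assume neg: "\<not> ?thesis"
    define c where "c = q * of_int i"
    define y' where "y' = y - ((a \<bullet> y - c) * (2 / (a \<bullet> a))) *\<^sub>R a"
    have aa: "a \<bullet> a > 0" using inner_root_pos a by auto
    have "D y' = D y + 4 * ((a \<bullet> y - c) * (a \<bullet> p - c)) / (a \<bullet> a)"
      unfolding D_def using affine_reflection_dist[OF aa y'_def, of p] by (simp add: mult.assoc)
    moreover have "(a \<bullet> y - c) * (a \<bullet> p - c) < 0" using neg unfolding c_def by (rule not_le_imp_less)
    then have "4 * ((a \<bullet> y - c) * (a \<bullet> p - c)) / (a \<bullet> a) < 0"
      using aa by (intro divide_neg_pos) linarith+
    ultimately have "D y' < D y" by linarith
    moreover have "y' \<in> Orb"
    proof -
      \<comment> \<open>The affine reflection is the linear one followed by a translation by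
        \<open>q * i\<close> times the coroot \<open>u\<close>, a lattice vector; so
        \<open>y'\<close> stays in the orbit.\<close>
      define u where "u = (2 / (a \<bullet> a)) *\<^sub>R a"
      have "y' = reflection a y + c *\<^sub>R u"
        unfolding y'_def u_def reflection_def by (simp add: algebra_simps scaleR_left_diff_distrib diff_divide_distrib)
      then have "reflection a y' = y + c *\<^sub>R reflection a u"
        by (simp add: linear_add[OF reflection_linear] linear_scale[OF reflection_linear])
      also have "reflection a u = - u"
        unfolding u_def by (simp only: linear_scale[OF reflection_linear] reflection_self scaleR_minus_right)
      finally have "y = reflection a y' + c *\<^sub>R u" by simp
      then have "x = (w \<circ> reflection a) y' + q *\<^sub>R (of_int i *\<^sub>R w u + z)"
        using wz(3) Sym_add[OF wz(1)] Sym_scale[OF wz(1)] unfolding c_def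
        by (simp add: scaleR_add_right)
      moreover have "w \<circ> reflection a \<in> Sym" using Sym_compose wz Sym_reflection a by auto
      moreover have "of_int i *\<^sub>R w u + z \<in> Lat"
        using lattice_add lattice_scale Sym_lattice[OF wz(1) lattice_coroot[OF a]] wz unfolding u_def by auto
      ultimately show ?thesis unfolding Orb_def by blast
    qed
    ultimately show False using mn by force
  qed
  have yreg: "a \<bullet> y \<noteq> q * of_int i" if a: "a \<in> \<Phi>" for a i
  proof
    assume e: "a \<bullet> y = q * of_int i"
    obtain b j where b: "b \<in> \<Phi>" "a \<bullet> y = b \<bullet> x - q * of_int j" using coset[OF y(1) a] by auto
    then have "b \<bullet> x = q * of_int (i + j)" using e by (simp add: algebra_simps)
    then show False using reg b by blast
  qed
  have simple_y: "a \<bullet> y > 0" if a: "a \<in> \<Delta>" for a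
  proof -
    have "a \<bullet> p > 0" unfolding p_def using simple_rho[OF a] q cox_pos by simp
    moreover have "(a \<bullet> y) * (a \<bullet> p) \<ge> 0" using side[of a 0] a simple_subset by auto
    ultimately have "a \<bullet> y \<ge> 0" by (simp add: zero_le_mult_iff)
    moreover have "a \<bullet> y \<noteq> 0" using yreg[of a 0] a simple_subset by auto
    ultimately show ?thesis by linarith
  qed
  have theta_y: "\<theta> \<bullet> y < q"
  proof -
    have t: "\<theta> \<in> \<Phi>" using theta_pos pos_root by auto
    have "\<theta> \<bullet> p = (q / real cox) * (real cox - 1)" unfolding p_def using real_cox by simp
    also have "\<dots> < (q / real cox) * real cox" using q cox_pos by (intro mult_strict_left_mono) auto
    finally have "\<theta> \<bullet> p - q < 0" using cox_pos by simp
    moreover have "(\<theta> \<bullet> y - q) * (\<theta> \<bullet> p - q) \<ge> 0" using side[OF t, of 1] by simp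
    ultimately have "\<theta> \<bullet> y - q \<le> 0" by (simp add: zero_le_mult_iff)
    moreover have "\<theta> \<bullet> y \<noteq> q" using yreg[OF t, of 1] by simp
    ultimately show ?thesis by linarith
  qed
  have "0 < b \<bullet> y \<and> b \<bullet> y < q" if b: "b \<in> Pos" for b
  proof
    obtain a where a: "a \<in> \<Delta>" "b \<bullet> \<omega> a > 0" using pos_inner_simple[OF b] by auto
    have "0 < (\<Sum>a\<in>\<Delta>. (b \<bullet> \<omega> a) * (a \<bullet> y))"
      by (rule sum_pos2[OF finite_simple a(1)])
        (use a simple_y pos_coeff_nonneg[OF b] in \<open>auto intro: mult_nonneg_nonneg less_imp_le\<close>)
    then show "0 < b \<bullet> y" by (simp only: inner_expansion[of b y])
    have "b \<bullet> y \<le> \<theta> \<bullet> y"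
      unfolding inner_expansion[of b y] inner_expansion[of \<theta> y]
      by (intro sum_mono mult_right_mono theta_ge[OF b]) (use simple_y in \<open>auto intro: less_imp_le\<close>)
    then show "b \<bullet> y < q" using theta_y by linarith
  qed
  then show ?thesis using that wz by blast
qed

text \<open>Several pairs \<open>(w, z)\<close> may describe one alcove, since \<open>Sym\<close>
  contains the diagram automorphisms and \<open>z\<close> ranges over all coweights. They share the
  centre, so this set holds each alcove once; the factor \<open>cox\<close> makes the centres
  lattice points.\<close>

definition centres :: "'a set" where
  "centres = {w \<rho> + real cox *\<^sub>R z | w z. w \<in> Sym \<and> z \<in> Lat}"

lemma centres_lattice: "v \<in> centres \<Longrightarrow> v \<in> Lat"
  unfolding centres_def using lattice_add Sym_lattice lattice_rho lattice_scale_nat by auto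

lemma pos_rho_bounds: "b \<in> Pos \<Longrightarrow> 0 < b \<bullet> \<rho> \<and> b \<bullet> \<rho> < real cox"
  using pos_height[of b] theta_height[of b] real_cox by auto

lemma floor_div_unique:
  fixes u c :: real
  assumes "c > 0" "c * of_int i \<le> u" "u < c * (of_int i + 1)"
  shows "\<lfloor>u / c\<rfloor> = i"
  using assms by (intro floor_unique) (auto simp: field_simps)

text \<open>A negative \<open>inv w b\<close> takes values between \<open>- q\<close> and
  \<open>0\<close> at \<open>y\<close>, hence the correction by \<open>1\<close>. Applied to an
  arbitrary point and to \<rho> with \<open>q = cox\<close>, it shows that a point and the centre of
  its alcove have the same floors.\<close>

lemma alcove_position:
  assumes w: "w \<in> Sym" and z: "z \<in> Lat" and b: "b \<in> \<Phi>"
    and y: "\<And>b. b \<in> Pos \<Longrightarrow> 0 < b \<bullet> y \<and> b \<bullet> y < q"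
  defines "i \<equiv> (if inv w b \<in> Pos then \<lfloor>b \<bullet> z\<rfloor> else \<lfloor>b \<bullet> z\<rfloor> - 1)"
  shows "q * of_int i < b \<bullet> (w y + q *\<^sub>R z)" "b \<bullet> (w y + q *\<^sub>R z) < q * (of_int i + 1)"
proof -
  have e: "b \<bullet> (w y + q *\<^sub>R z) = inv w b \<bullet> y + q * of_int \<lfloor>b \<bullet> z\<rfloor>"
    using Sym_adjoint[OF w] lattice_root[OF z b] by (auto simp: inner_add_right elim!: Ints_cases)
  have "inv w b \<in> \<Phi>" using Sym_root[OF Sym_inv[OF w] b] .
  then show "q * of_int i < b \<bullet> (w y + q *\<^sub>R z)" "b \<bullet> (w y + q *\<^sub>R z) < q * (of_int i + 1)"
    using y[of "inv w b"] y[of "- inv w b"] not_pos_iff[of "inv w b"]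
    unfolding e i_def by (auto simp: algebra_simps)
qed

lemma centre_floor:
  assumes w: "w \<in> Sym" and z: "z \<in> Lat" and b: "b \<in> \<Phi>"
  shows "\<lfloor>b \<bullet> (w \<rho> + real cox *\<^sub>R z) / real cox\<rfloor> =
    (if inv w b \<in> Pos then \<lfloor>b \<bullet> z\<rfloor> else \<lfloor>b \<bullet> z\<rfloor> - 1)"
  using alcove_position[OF w z b pos_rho_bounds] cox_pos
  by (intro floor_div_unique) auto

lemma centre_bounds:
  assumes "v \<in> centres" "b \<in> \<Phi>"
  shows "real cox * of_int \<lfloor>b \<bullet> v / real cox\<rfloor> < b \<bullet> v"
    "b \<bullet> v < real cox * (of_int \<lfloor>b \<bullet> v / real cox\<rfloor> + 1)"
proof -
  obtain w z where v: "v = w \<rho> + real cox *\<^sub>R z" and wz: "w \<in> Sym" "z \<in> Lat"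
    using assms unfolding centres_def by auto
  show "real cox * of_int \<lfloor>b \<bullet> v / real cox\<rfloor> < b \<bullet> v"
    "b \<bullet> v < real cox * (of_int \<lfloor>b \<bullet> v / real cox\<rfloor> + 1)"
    using alcove_position[OF wz assms(2) pos_rho_bounds]
    unfolding v centre_floor[OF wz assms(2)] by auto
qed

text \<open>Every point lies in the half-open \<open>q\<close>-dilated alcove of some centre: move it slightly
  in the direction \<open>- \<rho>\<close> and reduce.\<close>

lemma ex_centre:
  fixes q :: real
  assumes q: "q > 0"
  shows "\<exists>v\<in>centres. \<forall>b\<in>Pos. q * of_int \<lfloor>b \<bullet> v / real cox\<rfloor> < b \<bullet> x \<and>
    b \<bullet> x \<le> q * (of_int \<lfloor>b \<bullet> v / real cox\<rfloor> + 1)"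
proof -
  \<comment> \<open>Ceiling minus one instead of the floor: a multiple of \<open>q\<close> belongs
    to the interval below it.\<close>
  define m where "m b = \<lceil>b \<bullet> x / q\<rceil> - 1" for b
  define \<delta> where "\<delta> b = b \<bullet> x - q * of_int (m b)" for b
  have m: "q * of_int (m b) < b \<bullet> x" "b \<bullet> x \<le> q * (of_int (m b) + 1)" for b
  proof -
    have "of_int (m b) < b \<bullet> x / q" "b \<bullet> x / q \<le> of_int (m b) + 1" unfolding m_def by linarith+
    then show "q * of_int (m b) < b \<bullet> x" "b \<bullet> x \<le> q * (of_int (m b) + 1)"
      using q by (auto simp: field_simps)
  qed
  have "Pos \<noteq> {}" using theta_pos by auto
  from finite_has_max[OF finite_pos this, of "\<lambda>b. - \<delta> b"]
  obtain b0 where b0: "b0 \<in> Pos" "\<And>b. b \<in> Pos \<Longrightarrow> - \<delta> b \<le> - \<delta> b0" by blast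
  have d0: "\<delta> b0 > 0" using m(1)[of b0] unfolding \<delta>_def by simp
  \<comment> \<open>Since \<open>b \<bullet> \<rho> < cox\<close>, the displacement stays below the
    least gap \<open>\<delta> b0\<close>.\<close>
  define \<epsilon> where "\<epsilon> = \<delta> b0 / real cox"
  have eps: "0 < \<epsilon> * (b \<bullet> \<rho>)" "\<epsilon> * (b \<bullet> \<rho>) < \<delta> b" if b: "b \<in> Pos" for b
  proof -
    have "\<epsilon> > 0" unfolding \<epsilon>_def using d0 cox_pos by simp
    then show "0 < \<epsilon> * (b \<bullet> \<rho>)" using pos_rho_bounds[OF b] by simp
    have "\<epsilon> * (b \<bullet> \<rho>) < \<epsilon> * real cox" using pos_rho_bounds[OF b] \<open>\<epsilon> > 0\<close> by simp
    also have "\<dots> = \<delta> b0" unfolding \<epsilon>_def using cox_pos by simp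
    finally show "\<epsilon> * (b \<bullet> \<rho>) < \<delta> b" using b0(2)[OF b] by linarith
  qed
  define x' where "x' = x - \<epsilon> *\<^sub>R \<rho>"
  have m': "q * of_int (m b) < b \<bullet> x'" "b \<bullet> x' < q * (of_int (m b) + 1)" if b: "b \<in> Pos" for b
    using eps[OF b] m[of b] unfolding x'_def \<delta>_def by (auto simp: inner_diff_right)
  have not_int: "b \<bullet> x' \<noteq> q * of_int i" if b: "b \<in> Pos" for b i
  proof
    assume "b \<bullet> x' = q * of_int i"
    then have "q * of_int (m b) < q * of_int i" "q * of_int i < q * of_int (m b + 1)" using m'[OF b] by auto
    then have "m b < i" "i < m b + 1" using q by (simp_all only: mult_less_cancel_left_pos of_int_less_iff)
    then show False by linarith
  qed
  have "b \<bullet> x' \<noteq> q * of_int i" if b: "b \<in> \<Phi>" for b i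
  proof (cases "b \<in> Pos")
    case False
    then have "- b \<in> Pos" using b not_pos_iff by auto
    from not_int[OF this, of "- i"] show ?thesis by simp
  qed (use not_int in auto)
  from alcove_reduction[OF q this] obtain w z y where wz: "w \<in> Sym" "z \<in> Lat" "x' = w y + q *\<^sub>R z"
    and y: "\<And>b. b \<in> Pos \<Longrightarrow> 0 < b \<bullet> y \<and> b \<bullet> y < q" by metis
  define v where "v = w \<rho> + real cox *\<^sub>R z"
  have "v \<in> centres" unfolding v_def centres_def using wz by auto
  moreover have "\<lfloor>b \<bullet> v / real cox\<rfloor> = m b" if b: "b \<in> Pos" for b
  proof -
    have bR: "b \<in> \<Phi>" using pos_root b by auto
    have "\<lfloor>b \<bullet> x' / q\<rfloor> = \<lfloor>b \<bullet> v / real cox\<rfloor>"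
      unfolding v_def centre_floor[OF wz(1,2) bR]
      using alcove_position[OF wz(1,2) bR y] q wz(3) by (intro floor_div_unique) auto
    moreover have "\<lfloor>b \<bullet> x' / q\<rfloor> = m b" using m'[OF b] q by (intro floor_div_unique) auto
    ultimately show ?thesis by simp
  qed
  ultimately show ?thesis using m by (intro bexI[of _ v]) auto
qed

text \<open>Moved back by the pair of \<open>v\<close>, the other centre becomes a lattice point
  \<open>u\<close> strictly inside the fundamental alcove dilated by \<open>cox\<close>. Then
  \<open>a \<bullet> u \<ge> 1\<close> at the simple roots and \<open>\<theta> \<bullet> u \<le> cox
  - 1 = \<theta> \<bullet> \<rho>\<close>, which leaves only \<rho>.\<close>

lemma centre_unique:
  assumes v: "v \<in> centres" and v': "v' \<in> centres"
    and eq: "\<And>b. b \<in> Pos \<Longrightarrow> \<lfloor>b \<bullet> v / real cox\<rfloor> = \<lfloor>b \<bullet> v' / real cox\<rfloor>"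
  shows "v = v'"
proof -
  have c: "real cox > 0" using cox_pos by simp
  have eqR: "\<lfloor>b \<bullet> v / real cox\<rfloor> = \<lfloor>b \<bullet> v' / real cox\<rfloor>" if b: "b \<in> \<Phi>" for b
  proof (cases "b \<in> Pos")
    case False
    then have nb: "- b \<in> Pos" using b not_pos_iff by auto
    have "\<lfloor>b \<bullet> u / real cox\<rfloor> = - \<lfloor>(- b) \<bullet> u / real cox\<rfloor> - 1" if u: "u \<in> centres" for u
      using centre_bounds[OF u uminus_root[OF b]] c
      by (intro floor_div_unique) (auto simp: algebra_simps)
    then show ?thesis using eq[OF nb] v v' by simp
  qed (use eq in auto)
  obtain w z where wz: "v = w \<rho> + real cox *\<^sub>R z" "w \<in> Sym" "z \<in> Lat" using v unfolding centres_def by auto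
  define u where "u = inv w (v' - real cox *\<^sub>R z)"
  have wu: "w u = v' - real cox *\<^sub>R z" unfolding u_def using Sym_inv_cancel[OF wz(2)] by simp
  have uL: "u \<in> Lat"
    unfolding u_def
    by (rule Sym_lattice[OF Sym_inv[OF wz(2)] lattice_diff[OF centres_lattice[OF v'] lattice_scale_nat[OF wz(3)]]])
  have au: "0 < a \<bullet> u" "a \<bullet> u < real cox" if a: "a \<in> Pos" for a
  proof -
    define b where "b = w a"
    have b: "b \<in> \<Phi>" unfolding b_def using Sym_root wz pos_root a by auto
    have "inv w b = a" unfolding b_def using Sym_inv_cancel[OF wz(2)] by simp
    then have f: "\<lfloor>b \<bullet> v' / real cox\<rfloor> = \<lfloor>b \<bullet> z\<rfloor>"
      using centre_floor[OF wz(2,3) b] a eqR[OF b] unfolding wz(1) by simp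
    have "a \<bullet> u = b \<bullet> w u" unfolding b_def using Sym_inner[OF wz(2)] by simp
    also have "\<dots> = b \<bullet> v' - real cox * of_int \<lfloor>b \<bullet> z\<rfloor>"
      unfolding wu using lattice_root[OF wz(3) b] by (auto simp: inner_diff_right elim!: Ints_cases)
    finally show "0 < a \<bullet> u" "a \<bullet> u < real cox"
      using centre_bounds[OF v' b] unfolding f by (auto simp: algebra_simps)
  qed
  have ge1: "a \<bullet> u - 1 \<ge> 0" if a: "a \<in> \<Delta>" for a
  proof -
    have "a \<bullet> u \<in> \<int>" using lattice_root[OF uL] a simple_subset by blast
    then show ?thesis using au(1)[OF simple_pos[OF a]] by (auto elim!: Ints_cases)
  qed
  obtain i where i: "\<theta> \<bullet> u = of_int i"
    using lattice_root[OF uL pos_root[OF theta_pos]] by (auto elim!: Ints_cases)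
  then have "real_of_int i < real_of_int (int cox)" using au(2)[OF theta_pos] by simp
  then have "i \<le> int cox - 1" by (simp only: of_int_less_iff)
  then have "\<theta> \<bullet> u \<le> real cox - 1" unfolding i by linarith
  then have "\<theta> \<bullet> u - \<theta> \<bullet> \<rho> \<le> 0" using real_cox by simp
  also have "\<theta> \<bullet> u - \<theta> \<bullet> \<rho> = (\<Sum>a\<in>\<Delta>. (\<theta> \<bullet> \<omega> a) * (a \<bullet> u - 1))"
    unfolding inner_expansion[of \<theta> u] rho_inner by (simp add: right_diff_distrib sum_subtractf)
  finally have le: "(\<Sum>a\<in>\<Delta>. (\<theta> \<bullet> \<omega> a) * (a \<bullet> u - 1)) \<le> 0" .
  have nn: "(\<theta> \<bullet> \<omega> a) * (a \<bullet> u - 1) \<ge> 0" if "a \<in> \<Delta>" for a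
    using ge1[OF that] theta_coeff[OF that] by simp
  then have "(\<Sum>a\<in>\<Delta>. (\<theta> \<bullet> \<omega> a) * (a \<bullet> u - 1)) = 0" using le by (intro antisym sum_nonneg) auto
  then have z: "\<forall>a\<in>\<Delta>. (\<theta> \<bullet> \<omega> a) * (a \<bullet> u - 1) = 0"
    using sum_nonneg_eq_0_iff[of \<Delta> "\<lambda>a. (\<theta> \<bullet> \<omega> a) * (a \<bullet> u - 1)", OF finite_simple nn] by blast
  have "u = \<rho>"
  proof (rule simple_eqI)
    fix a assume a: "a \<in> \<Delta>"
    then show "a \<bullet> u = a \<bullet> \<rho>" using z theta_coeff[OF a] simple_rho[OF a] by force
  qed
  then show ?thesis using wu wz(1) by simp
qed

section \<open>Counting\<close>

definition mark :: "'a \<Rightarrow> nat" where "mark a = nat \<lfloor>\<theta> \<bullet> \<omega> a\<rfloor>"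

lemma real_mark: "a \<in> \<Delta> \<Longrightarrow> real (mark a) = \<theta> \<bullet> \<omega> a"
  unfolding mark_def using pos_coeff[OF theta_pos, of a] by (auto elim!: Nats_cases)

lemma mark_pos: "a \<in> \<Delta> \<Longrightarrow> mark a > 0"
  using real_mark[of a] theta_coeff[of a] by simp

lemma sum_mark: "(\<Sum>a\<in>\<Delta>. int (mark a)) = int cox - 1"
proof -
  have "real (\<Sum>a\<in>\<Delta>. mark a) = real cox - 1"
    using real_cox by (simp add: rho_inner real_mark)
  then have "real_of_int (\<Sum>a\<in>\<Delta>. int (mark a)) = real_of_int (int cox - 1)" by simp
  then show ?thesis by (simp only: of_int_eq_iff)
qed

text \<open>Lower bounds for the distances of \<open>y\<close> to the walls \<open>a \<bullet> y = 0\<close> and \<open>\<theta> \<bullet> y = q\<close>.\<close>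

definition wall :: "('a \<Rightarrow> 'a) \<Rightarrow> int \<Rightarrow> int \<Rightarrow> 'a \<Rightarrow> int" where
  "wall w n k a = (if w a \<in> Pos then n + k + 1 else k)"

definition wall0 :: "('a \<Rightarrow> 'a) \<Rightarrow> int \<Rightarrow> int \<Rightarrow> int" where
  "wall0 w n k = (if w \<theta> \<in> Pos then k else n + k + 1)"

text \<open>The height of \<open>w x\<close> combines the heights of the \<open>w a\<close> with the
  coefficients of \<open>x\<close>. Stated for combinations because \<open>\<theta> - b\<close> is
  one of the applications.\<close>

lemma positive_image_has_positive_simple:
  assumes w: "w \<in> Sym" and c: "\<And>a. a \<in> \<Delta> \<Longrightarrow> x \<bullet> \<omega> a \<in> \<int>" "\<And>a. a \<in> \<Delta> \<Longrightarrow> x \<bullet> \<omega> a \<ge> 0"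
    and p: "w x \<bullet> \<rho> > 0"
  shows "\<exists>a\<in>\<Delta>. x \<bullet> \<omega> a \<ge> 1 \<and> w a \<in> Pos"
proof (rule ccontr)
  assume n: "\<not> ?thesis"
  have "w x \<bullet> \<rho> = x \<bullet> inv w \<rho>"
    using Sym_inner[OF w, of x "inv w \<rho>"] Sym_inv_cancel[OF w] by simp
  also have "\<dots> = (\<Sum>a\<in>\<Delta>. (x \<bullet> \<omega> a) * (a \<bullet> inv w \<rho>))" by (rule inner_expansion)
  also have "\<dots> = (\<Sum>a\<in>\<Delta>. (x \<bullet> \<omega> a) * (w a \<bullet> \<rho>))"
  proof -
    have "a \<bullet> inv w \<rho> = w a \<bullet> \<rho>" for a
      using Sym_inner[OF w, of a "inv w \<rho>"] Sym_inv_cancel[OF w] by simp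
    then show ?thesis by simp
  qed
  also have "\<dots> \<le> 0"
  proof (rule sum_nonpos)
    fix a assume a: "a \<in> \<Delta>"
    show "(x \<bullet> \<omega> a) * (w a \<bullet> \<rho>) \<le> 0"
    proof (cases "w a \<in> Pos")
      case True
      then have "x \<bullet> \<omega> a < 1" using n a by force
      then have "x \<bullet> \<omega> a = 0" using c[OF a] by (auto elim!: Ints_cases)
      then show ?thesis by simp
    next
      case False
      have "w a \<in> \<Phi>" using Sym_root[OF w] a simple_subset by blast
      then have "w a \<bullet> \<rho> \<le> 0" using False not_pos_iff[of "w a"] pos_height[of "- w a"] by auto
      then show ?thesis using c(2)[OF a] by (simp add: mult_nonneg_nonpos)
    qed
  qed
  finally show False using p by simp
qed

text \<open>The inequalities at all positive roots follow from those at the walls of the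
  fundamental alcove, because a root \<open>b\<close> (or \<open>\<theta> - b\<close>) sent to a positive (or negative) vector
  involves a simple root with the stronger bound.\<close>

lemma wall_inequalities:
  fixes n k q :: int
  assumes w: "w \<in> Sym" and n: "n \<ge> 0" and k: "k \<ge> 0"
  shows "(\<forall>b\<in>Pos. if w b \<in> Pos then of_int (n + k + 1) \<le> b \<bullet> y \<and> b \<bullet> y \<le> of_int (q - k)
      else of_int k \<le> b \<bullet> y \<and> b \<bullet> y \<le> of_int (q - n - k - 1)) \<longleftrightarrow>
    (\<forall>a\<in>\<Delta>. of_int (wall w n k a) \<le> a \<bullet> y) \<and> \<theta> \<bullet> y \<le> of_int (q - wall0 w n k)"
    (is "?L \<longleftrightarrow> ?R")
proof
  assume L: ?L
  have "of_int (wall w n k a) \<le> a \<bullet> y" if "a \<in> \<Delta>" for a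
    using L[rule_format, OF simple_pos[OF that]] unfolding wall_def by (auto split: if_splits)
  moreover have "\<theta> \<bullet> y \<le> of_int (q - wall0 w n k)"
    using L[rule_format, OF theta_pos] unfolding wall0_def by (auto split: if_splits)
  ultimately show ?R by blast
next
  assume R: ?R
  have ay: "a \<bullet> y \<ge> of_int k" "a \<bullet> y \<ge> 0" if "a \<in> \<Delta>" for a
    using R that n k unfolding wall_def by (force split: if_splits)+
  have ay': "a \<bullet> y \<ge> of_int (n + k + 1)" if "a \<in> \<Delta>" "w a \<in> Pos" for a
    using R that unfolding wall_def by (auto split: if_splits)
  have lower: "x \<bullet> y \<ge> c"
    if x: "\<And>a. a \<in> \<Delta> \<Longrightarrow> x \<bullet> \<omega> a \<ge> 0" and a: "a \<in> \<Delta>" "x \<bullet> \<omega> a \<ge> 1" "a \<bullet> y \<ge> c" for x a c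
  proof -
    have "c \<le> 1 * (a \<bullet> y)" using a by simp
    also have "\<dots> \<le> (x \<bullet> \<omega> a) * (a \<bullet> y)" by (rule mult_right_mono) (use a ay in auto)
    also have "\<dots> \<le> (\<Sum>a\<in>\<Delta>. (x \<bullet> \<omega> a) * (a \<bullet> y))"
      by (rule member_le_sum[of a \<Delta> "\<lambda>a. (x \<bullet> \<omega> a) * (a \<bullet> y)"]) (use a x ay finite_simple in auto)
    also have "\<dots> = x \<bullet> y" by (rule inner_expansion[symmetric])
    finally show ?thesis .
  qed
  have nonneg: "x \<bullet> y \<ge> 0" if x: "\<And>a. a \<in> \<Delta> \<Longrightarrow> x \<bullet> \<omega> a \<ge> 0" for x
    unfolding inner_expansion[of x y] by (intro sum_nonneg mult_nonneg_nonneg x ay)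
  show ?L
  proof
    fix b assume b: "b \<in> Pos"
    define d where "d = \<theta> - b"
    have d: "d \<bullet> \<omega> a \<in> \<int>" "d \<bullet> \<omega> a \<ge> 0" if "a \<in> \<Delta>" for a
      using theta_ge[OF b that] root_coeff_int[OF pos_root[OF b] that]
        root_coeff_int[OF pos_root[OF theta_pos] that]
      unfolding d_def by (auto simp: inner_diff_left)
    have by_eq: "b \<bullet> y = \<theta> \<bullet> y - d \<bullet> y" unfolding d_def by (simp add: inner_diff_left)
    have bint: "b \<bullet> \<omega> a \<in> \<int>" if "a \<in> \<Delta>" for a using root_coeff_int[OF pos_root[OF b] that] .
    show "if w b \<in> Pos then of_int (n + k + 1) \<le> b \<bullet> y \<and> b \<bullet> y \<le> of_int (q - k)
      else of_int k \<le> b \<bullet> y \<and> b \<bullet> y \<le> of_int (q - n - k - 1)"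
    proof (cases "w b \<in> Pos")
      case True
      then obtain a where a: "a \<in> \<Delta>" "b \<bullet> \<omega> a \<ge> 1" "w a \<in> Pos"
        using positive_image_has_positive_simple[OF w bint pos_coeff_nonneg[OF b]] pos_height[OF True] by force
      have "of_int (n + k + 1) \<le> b \<bullet> y"
        by (rule lower[OF pos_coeff_nonneg[OF b] a(1,2) ay'[OF a(1,3)]])
      moreover have "\<theta> \<bullet> y \<le> of_int (q - k)" using R n unfolding wall0_def by (force split: if_splits)
      then have "b \<bullet> y \<le> of_int (q - k)" using nonneg[of d, OF d(2)] unfolding by_eq by linarith
      ultimately show ?thesis using True by simp
    next
      case False
      obtain a where a: "a \<in> \<Delta>" "b \<bullet> \<omega> a > 0" using pos_inner_simple[OF b] by auto
      then have "b \<bullet> \<omega> a \<ge> 1" using bint[OF a(1)] by (auto elim!: Ints_cases)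
      then have "of_int k \<le> b \<bullet> y" using lower[OF pos_coeff_nonneg[OF b] a(1) _ ay(1)[OF a(1)]] by blast
      \<comment> \<open>If \<open>w \<theta>\<close> is positive, the bound on
        \<open>\<theta> \<bullet> y\<close> is the weak one, and the rest comes from a simple root
        in \<open>\<theta> - b\<close> with the strong lower bound.\<close>
      moreover have "b \<bullet> y \<le> of_int (q - n - k - 1)"
      proof (cases "w \<theta> \<in> Pos")
        case True
        have "w b \<in> \<Phi>" using Sym_root[OF w pos_root[OF b]] .
        then have "- w b \<in> Pos" using False not_pos_iff by auto
        then have "w d \<bullet> \<rho> > 0"
          using pos_height[OF True] pos_height[of "- w b"] unfolding d_def Sym_diff[OF w]
          by (simp add: inner_diff_left)
        then obtain e where e: "e \<in> \<Delta>" "d \<bullet> \<omega> e \<ge> 1" "w e \<in> Pos"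
          using positive_image_has_positive_simple[OF w d] by auto
        have "of_int (n + k + 1) \<le> d \<bullet> y" by (rule lower[OF d(2) e(1,2) ay'[OF e(1,3)]])
        moreover have "\<theta> \<bullet> y \<le> of_int q" using R True k unfolding wall0_def by force
        ultimately show ?thesis unfolding by_eq by simp
      next
        case F: False
        then have "\<theta> \<bullet> y \<le> of_int (q - n - k - 1)" using R unfolding wall0_def by (simp add: algebra_simps)
        then show ?thesis using nonneg[of d, OF d(2)] unfolding by_eq by linarith
      qed
      ultimately show ?thesis using False by simp
    qed
  qed
qed

text \<open>The lattice points of the half-open alcove with centre \<open>v\<close>, dilated by \<open>q\<close>, at which no root
  takes a value congruent to one of \<open>1 - k, ..., n + k\<close>; the floors say which alcove it is.\<close>

definition cell :: "'a \<Rightarrow> int \<Rightarrow> int \<Rightarrow> int \<Rightarrow> 'a set" where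
  "cell v n k q = {x \<in> Lat. \<forall>b\<in>Pos.
     of_int (n + k + 1) \<le> b \<bullet> x - of_int q * of_int \<lfloor>b \<bullet> v / real cox\<rfloor> \<and>
     b \<bullet> x - of_int q * of_int \<lfloor>b \<bullet> v / real cox\<rfloor> \<le> of_int (q - k)}"

text \<open>A positive root is \<open>w b\<close> or \<open>- w b\<close> with \<open>b\<close>
  positive. In the second case its value above the floor is \<open>q - b \<bullet> y\<close>, so the
  two bounds trade places.\<close>

lemma cell_iff:
  assumes wz: "w \<in> Sym" "z \<in> Lat" and n: "n \<ge> 0" and k: "k \<ge> 0"
    and v: "v = w \<rho> + real cox *\<^sub>R z" and x: "x = w y + of_int q *\<^sub>R z"
  shows "x \<in> cell v n k q \<longleftrightarrow> y \<in> Lat \<and> (\<forall>a\<in>\<Delta>. of_int (wall w n k a) \<le> a \<bullet> y) \<and>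
    \<theta> \<bullet> y \<le> of_int (q - wall0 w n k)"
proof -
  define Q where "Q \<beta> \<longleftrightarrow>
     of_int (n + k + 1) \<le> \<beta> \<bullet> x - of_int q * of_int \<lfloor>\<beta> \<bullet> v / real cox\<rfloor> \<and>
     \<beta> \<bullet> x - of_int q * of_int \<lfloor>\<beta> \<bullet> v / real cox\<rfloor> \<le> of_int (q - k)" for \<beta>
  define R where "R b \<longleftrightarrow> (if w b \<in> Pos then of_int (n + k + 1) \<le> b \<bullet> y \<and> b \<bullet> y \<le> of_int (q - k)
      else of_int k \<le> b \<bullet> y \<and> b \<bullet> y \<le> of_int (q - n - k - 1))" for b
  have lat: "x \<in> Lat \<longleftrightarrow> y \<in> Lat"
  proof
    assume "x \<in> Lat"
    moreover have "y = inv w (x - of_int q *\<^sub>R z)" unfolding x using Sym_inv_cancel[OF wz(1)] by simp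
    ultimately show "y \<in> Lat"
      using Sym_lattice[OF Sym_inv[OF wz(1)]] lattice_diff lattice_scale[OF wz(2)] by simp
  next
    assume "y \<in> Lat"
    then show "x \<in> Lat" unfolding x using lattice_add Sym_lattice[OF wz(1)] lattice_scale[OF wz(2)] by simp
  qed
  have val: "\<beta> \<bullet> x - of_int q * of_int \<lfloor>\<beta> \<bullet> v / real cox\<rfloor> =
      inv w \<beta> \<bullet> y + (if inv w \<beta> \<in> Pos then 0 else of_int q)" if "\<beta> \<in> \<Phi>" for \<beta>
  proof -
    have "\<beta> \<bullet> x = inv w \<beta> \<bullet> y + of_int q * of_int \<lfloor>\<beta> \<bullet> z\<rfloor>"
      unfolding x using Sym_adjoint[OF wz(1)] lattice_root[OF wz(2) that]
      by (auto simp: inner_add_right elim!: Ints_cases)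
    then show ?thesis unfolding v centre_floor[OF wz that] by (auto simp: algebra_simps)
  qed
  have QR1: "Q (w b) \<longleftrightarrow> R b" if b: "b \<in> Pos" "w b \<in> Pos" for b
    using val[OF pos_root[OF b(2)]] Sym_inv_cancel(1)[OF wz(1), of b] b unfolding Q_def R_def by simp
  have QR2: "Q (- w b) \<longleftrightarrow> R b" if b: "b \<in> Pos" "- w b \<in> Pos" for b
  proof -
    have i: "inv w (- w b) = - b" using Sym_neg[OF Sym_inv[OF wz(1)]] Sym_inv_cancel(1)[OF wz(1)] by simp
    have "- b \<notin> Pos" using b not_pos_iff[OF pos_root[OF b(1)]] not_pos_iff[OF uminus_root[OF pos_root[OF b(1)]]] by simp
    moreover have "w b \<notin> Pos" using b not_pos_iff[OF Sym_root[OF wz(1) pos_root[OF b(1)]]] by simp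
    ultimately show ?thesis
      using val[OF pos_root[OF b(2)]] unfolding i Q_def R_def by (auto simp: algebra_simps)
  qed
  have "(\<forall>\<beta>\<in>Pos. Q \<beta>) \<longleftrightarrow> (\<forall>b\<in>Pos. R b)"
  proof
    assume Q: "\<forall>\<beta>\<in>Pos. Q \<beta>"
    show "\<forall>b\<in>Pos. R b"
    proof
      fix b assume b: "b \<in> Pos"
      then show "R b" using QR1[OF b] QR2[OF b] Q not_pos_iff[OF Sym_root[OF wz(1) pos_root[OF b]]] by blast
    qed
  next
    assume R: "\<forall>b\<in>Pos. R b"
    show "\<forall>\<beta>\<in>Pos. Q \<beta>"
    proof
      fix \<beta> assume \<beta>: "\<beta> \<in> Pos"
      have wi: "w (inv w \<beta>) = \<beta>" using Sym_inv_cancel[OF wz(1)] by simp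
      show "Q \<beta>"
      proof (cases "inv w \<beta> \<in> Pos")
        case True
        then show ?thesis using QR1[of "inv w \<beta>"] R \<beta> wi by simp
      next
        case False
        then have "- inv w \<beta> \<in> Pos"
          using not_pos_iff[OF Sym_root[OF Sym_inv[OF wz(1)] pos_root[OF \<beta>]]] by simp
        then show ?thesis using QR2[of "- inv w \<beta>"] R \<beta> wi Sym_neg[OF wz(1)] by simp
      qed
    qed
  qed
  moreover have "x \<in> cell v n k q \<longleftrightarrow> y \<in> Lat \<and> (\<forall>\<beta>\<in>Pos. Q \<beta>)"
    unfolding cell_def Q_def using lat by simp
  ultimately show ?thesis
    using wall_inequalities[OF wz(1) n k, of y q] unfolding R_def by simp
qed

definition offset :: "('a \<Rightarrow> 'a) \<Rightarrow> int \<Rightarrow> int" where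
  "offset w n = (\<Sum>a\<in>\<Delta>. int (mark a) * wall w n 0 a) + wall0 w n 0"

text \<open>Every bound rises by \<open>k\<close>, and the weights, the marks together with
  \<open>1\<close> for the affine wall, add up to \<open>cox\<close>. This is the origin of the
  shift in the theorem.\<close>

lemma offset_shift: "(\<Sum>a\<in>\<Delta>. int (mark a) * wall w n k a) + wall0 w n k = offset w n + k * int cox"
proof -
  have "wall w n k a = wall w n 0 a + k" for a unfolding wall_def by simp
  then have "(\<Sum>a\<in>\<Delta>. int (mark a) * wall w n k a) =
      (\<Sum>a\<in>\<Delta>. int (mark a) * wall w n 0 a) + (\<Sum>a\<in>\<Delta>. int (mark a)) * k"
    by (simp add: distrib_left sum.distrib sum_distrib_right)
  moreover have "wall0 w n k = wall0 w n 0 + k" unfolding wall0_def by simp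
  ultimately show ?thesis unfolding offset_def sum_mark by (simp add: algebra_simps)
qed

text \<open>Measured by the excess \<open>t a\<close> over the simple walls, the point only has to
  satisfy the inequality at \<theta>, a bound on the weighted sum of the \<open>t a\<close>. So
  \<open>q\<close> and \<open>k\<close> enter through \<open>q - k * int cox\<close> alone.\<close>

lemma card_cell:
  assumes wz: "w \<in> Sym" "z \<in> Lat" and n: "n \<ge> 0" and k: "k \<ge> 0"
    and v: "v = w \<rho> + real cox *\<^sub>R z"
  shows "finite (cell v n k q) \<and>
    card (cell v n k q) = card (solutions \<Delta> mark (q - k * int cox - offset w n))"
proof -
  define L where "L = wall w n k"
  define Y where "Y t = (\<Sum>a\<in>\<Delta>. of_int (L a + int (t a)) *\<^sub>R \<omega> a)" for t
  let ?S = "solutions \<Delta> mark (q - k * int cox - offset w n)"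
  let ?f = "\<lambda>t. w (Y t) + of_int q *\<^sub>R z"
  have aY: "a \<bullet> Y t = of_int (L a + int (t a))" if "a \<in> \<Delta>" for a t
    unfolding Y_def by (rule simple_coweight_sum[OF that])
  have YL: "Y t \<in> Lat" for t unfolding coweight_lattice_def using aY by auto
  have theta_Y: "\<theta> \<bullet> Y t = of_int ((\<Sum>a\<in>\<Delta>. int (mark a) * L a) + int (\<Sum>a\<in>\<Delta>. mark a * t a))" for t
  proof -
    have "\<theta> \<bullet> Y t = (\<Sum>a\<in>\<Delta>. real (mark a) * of_int (L a + int (t a)))"
      unfolding inner_expansion[of \<theta> "Y t"] by (rule sum.cong) (auto simp: real_mark aY)
    then show ?thesis by (simp add: distrib_left sum.distrib)
  qed
  have cond: "\<theta> \<bullet> Y t \<le> of_int (q - wall0 w n k) \<longleftrightarrow>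
      int (\<Sum>a\<in>\<Delta>. mark a * t a) \<le> q - k * int cox - offset w n" for t
    unfolding theta_Y of_int_le_iff using offset_shift[of w n k] unfolding L_def by linarith
  have mem: "?f t \<in> cell v n k q \<longleftrightarrow> int (\<Sum>a\<in>\<Delta>. mark a * t a) \<le> q - k * int cox - offset w n" for t
    using cell_iff[OF wz n k v refl, of "Y t" q] YL[of t] cond[of t] aY unfolding L_def by auto
  have "inj_on ?f ?S"
  proof (rule inj_onI)
    fix t t' assume t: "t \<in> ?S" "t' \<in> ?S" and "?f t = ?f t'"
    then have "w (Y t) = w (Y t')" by simp
    then have e: "Y t = Y t'" by (metis Sym_inv_cancel(1)[OF wz(1)])
    show "t = t'"
    proof (rule PiE_ext)
      show "t \<in> PiE \<Delta> (\<lambda>_. UNIV)" "t' \<in> PiE \<Delta> (\<lambda>_. UNIV)" using t unfolding solutions_def by auto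
      fix a assume "a \<in> \<Delta>"
      then show "t a = t' a" using aY[of a t] aY[of a t'] e by simp
    qed
  qed
  moreover have "?f ` ?S = cell v n k q"
  proof (intro equalityI subsetI)
    fix x assume "x \<in> ?f ` ?S"
    then show "x \<in> cell v n k q" using mem unfolding solutions_def by auto
  next
    fix x assume x: "x \<in> cell v n k q"
    define y where "y = inv w (x - of_int q *\<^sub>R z)"
    have xy: "x = w y + of_int q *\<^sub>R z" unfolding y_def using Sym_inv_cancel[OF wz(1)] by simp
    have y: "y \<in> Lat" "\<And>a. a \<in> \<Delta> \<Longrightarrow> of_int (L a) \<le> a \<bullet> y"
      using cell_iff[OF wz n k v xy] x unfolding L_def by auto
    \<comment> \<open>\<open>nat\<close> truncates nothing, since \<open>y\<close> satisfies the
      lower bounds \<open>L a\<close>.\<close>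
    define t where "t = restrict (\<lambda>a. nat (\<lfloor>a \<bullet> y\<rfloor> - L a)) \<Delta>"
    have "Y t = y"
    proof (rule simple_eqI)
      fix a assume a: "a \<in> \<Delta>"
      have "a \<bullet> y \<in> \<int>" using lattice_root[OF y(1)] a simple_subset by blast
      then obtain i where i: "a \<bullet> y = of_int i" by (auto elim!: Ints_cases)
      then show "a \<bullet> Y t = a \<bullet> y" using aY[OF a, of t] y(2)[OF a] a unfolding t_def by simp
    qed
    then have fx: "?f t = x" unfolding xy by simp
    have "t \<in> PiE \<Delta> (\<lambda>_. UNIV)" unfolding t_def by auto
    then have "t \<in> ?S" using mem[of t] x unfolding fx solutions_def by auto
    then show "x \<in> ?f ` ?S" using fx by blast
  qed
  ultimately have "bij_betw ?f ?S (cell v n k q)" unfolding bij_betw_def by blast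
  moreover have "finite ?S" by (rule finite_solutions[OF finite_simple mark_pos])
  ultimately show ?thesis using bij_betw_finite bij_betw_same_card by metis
qed

section \<open>Residue classes as a disjoint union of cells\<close>

definition box_centres :: "'a set" where
  "box_centres = {v \<in> centres. \<forall>a\<in>\<Delta>. \<lfloor>a \<bullet> v / real cox\<rfloor> = 0}"

lemma finite_box_centres: "finite box_centres"
proof (rule finite_subset)
  show "box_centres \<subseteq> {v. \<forall>a\<in>\<Delta>. a \<bullet> v \<in> real_of_int ` {0..int cox}}"
  proof
    fix v assume v: "v \<in> box_centres"
    then have vc: "v \<in> centres" unfolding box_centres_def by auto
    have "a \<bullet> v \<in> real_of_int ` {0..int cox}" if a: "a \<in> \<Delta>" for a
    proof -
      have aR: "a \<in> \<Phi>" using a simple_subset by auto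
      obtain i where i: "a \<bullet> v = of_int i"
        using lattice_root[OF centres_lattice[OF vc] aR] by (auto elim!: Ints_cases)
      have z: "\<lfloor>a \<bullet> v / real cox\<rfloor> = 0" using v a unfolding box_centres_def by auto
      have "0 < a \<bullet> v" "a \<bullet> v < real_of_int (int cox)" using centre_bounds[OF vc aR] unfolding z by auto
      then have "0 < i" "i < int cox" unfolding i by (simp_all only: of_int_less_iff of_int_0_less_iff)
      then show ?thesis unfolding i by auto
    qed
    then show "v \<in> {v. \<forall>a\<in>\<Delta>. a \<bullet> v \<in> real_of_int ` {0..int cox}}" by blast
  qed
qed (simp add: finite_simple_coordinates)

text \<open>With \<open>r = i - q * m\<close> positive and at most \<open>q\<close>, the positive
  forbidden values remove \<open>1, ..., n + k\<close> at the bottom, the others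
  \<open>q + 1 - k, ..., q\<close> at the top. For \<open>k = 0\<close> nothing is removed at the
  top and \<open>r = q\<close> survives.\<close>

lemma avoids_residues_iff:
  fixes n k q i m :: int
  assumes n: "n \<ge> 1" and k: "k \<ge> 0" and i: "q * m < i" "i \<le> q * (m + 1)"
  shows "(\<forall>j\<in>{1 - k..n + k}. \<not> [real_of_int i = of_int j] (rmod of_int q)) \<longleftrightarrow>
    n + k + 1 \<le> i - q * m \<and> i - q * m \<le> q - k"
proof -
  have cong: "[real_of_int i = of_int j] (rmod of_int q) \<longleftrightarrow> (\<exists>s. j = i + s * q)" for j
  proof -
    have "real_of_int j = of_int i + of_int s * of_int q \<longleftrightarrow> j = i + s * q" for s
      by (simp flip: of_int_mult of_int_add)
    then show ?thesis unfolding rcong_altdef by simp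
  qed
  define r where "r = i - q * m"
  have r: "0 < r" "r \<le> q" using i unfolding r_def by (auto simp: algebra_simps)
  show ?thesis
    unfolding r_def[symmetric]
  proof
    assume A: "\<forall>j\<in>{1 - k..n + k}. \<not> [real_of_int i = of_int j] (rmod of_int q)"
    show "n + k + 1 \<le> r \<and> r \<le> q - k"
    proof (rule ccontr)
      assume "\<not> ?thesis"
      then consider "r \<le> n + k" | "r > q - k" by linarith
      then show False
      proof cases
        case 1
        have "r \<in> {1 - k..n + k}" using 1 r k by auto
        moreover have "r = i + (- m) * q" unfolding r_def by simp
        ultimately show False using A cong by blast
      next
        case 2
        have "r - q \<in> {1 - k..n + k}" using 2 r k n by auto
        moreover have "r - q = i + (- m - 1) * q" unfolding r_def by (simp add: algebra_simps)
        ultimately show False using A cong by blast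
      qed
    qed
  next
    assume B: "n + k + 1 \<le> r \<and> r \<le> q - k"
    show "\<forall>j\<in>{1 - k..n + k}. \<not> [real_of_int i = of_int j] (rmod of_int q)"
    proof (intro ballI notI)
      fix j assume j: "j \<in> {1 - k..n + k}" and "[real_of_int i = of_int j] (rmod of_int q)"
      then obtain s where "j = i + s * q" using cong by blast
      then have e: "r - j = q * (- (m + s))" unfolding r_def by (simp add: algebra_simps)
      have "0 < r - j" "r - j < q" using B j by auto
      then have "q * 0 < q * (- (m + s))" "q * (- (m + s)) < q * 1" unfolding e by auto
      then have "0 < - (m + s)" "- (m + s) < 1" using r by (simp_all only: mult_less_cancel_left_pos)
      then show False by linarith
    qed
  qed
qed

text \<open>The half-open box contains one representative of each class and is cut into cells by the
  alcoves with floor \<open>0\<close> at the simple roots, a finite set independent of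
  \<open>q\<close>, \<open>n\<close> and \<open>k\<close>.\<close>

lemma card_complement_mod:
  fixes n k q :: int
  assumes n: "n \<ge> 1" and k: "k \<ge> 0" and q: "q > 0"
  shows "card (complement_mod \<Phi> \<Delta> (1 - k) (n + k) q) = (\<Sum>v\<in>box_centres. card (cell v n k q))"
proof -
  define E where "E = {(x, y). x \<in> Lat \<and> y \<in> Lat \<and> (\<exists>z\<in>Lat. x - y = of_int q *\<^sub>R z)}"
  define good where "good x \<longleftrightarrow> (\<forall>b\<in>Pos. \<forall>j\<in>{1 - k..n + k}. \<not> [b \<bullet> x = of_int j] (rmod of_int q))" for x
  define reps where "reps = {x \<in> Lat. (\<forall>a\<in>\<Delta>. 0 < a \<bullet> x \<and> a \<bullet> x \<le> of_int q) \<and> good x}"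
  have qr: "real_of_int q > 0" using q by simp
  have E: "equiv Lat E"
  proof (rule equivI)
    show "E \<subseteq> Lat \<times> Lat" unfolding E_def by auto
    show "refl_on Lat E" unfolding refl_on_def E_def using lattice_zero by force
    show "sym E"
    proof (rule symI)
      fix x y assume "(x, y) \<in> E"
      then obtain z where z: "x \<in> Lat" "y \<in> Lat" "z \<in> Lat" "x - y = of_int q *\<^sub>R z" unfolding E_def by auto
      then have "y - x = of_int q *\<^sub>R (0 - z)" by (simp add: algebra_simps)
      then show "(y, x) \<in> E" using z lattice_diff[OF lattice_zero z(3)] unfolding E_def by blast
    qed
    show "trans E"
    proof (rule transI)
      fix x y u assume "(x, y) \<in> E" "(y, u) \<in> E"
      then obtain z z' where z: "x \<in> Lat" "u \<in> Lat" "z \<in> Lat" "z' \<in> Lat"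
        "x - y = of_int q *\<^sub>R z" "y - u = of_int q *\<^sub>R z'" unfolding E_def by auto
      have "x - u = (x - y) + (y - u)" by simp
      also have "\<dots> = of_int q *\<^sub>R (z + z')" unfolding z(5,6) by (simp add: scaleR_add_right)
      finally show "(x, u) \<in> E" using z lattice_add unfolding E_def by blast
    qed
  qed
  have good_E: "good y" if xy: "(x, y) \<in> E" and gx: "good x" for x y
    unfolding good_def
  proof (intro ballI notI)
    fix b j assume b: "b \<in> Pos" and j: "j \<in> {1 - k..n + k}" and c: "[b \<bullet> y = of_int j] (rmod of_int q)"
    obtain z where z: "z \<in> Lat" "x - y = of_int q *\<^sub>R z" using xy unfolding E_def by auto
    obtain i where i: "b \<bullet> z = of_int i" using lattice_root[OF z(1) pos_root[OF b]] by (auto elim!: Ints_cases)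
    have "b \<bullet> x = b \<bullet> y + b \<bullet> (x - y)" by (simp add: inner_diff_right)
    then have "b \<bullet> x = b \<bullet> y + of_int i * of_int q" unfolding z(2) using i by simp
    then have "b \<bullet> y = b \<bullet> x + of_int (- i) * of_int q" by simp
    then have "[b \<bullet> x = b \<bullet> y] (rmod of_int q)" unfolding rcong_altdef by blast
    then have "[b \<bullet> x = of_int j] (rmod of_int q)" using c rcong_trans by blast
    then show False using gx b j unfolding good_def by blast
  qed
  have comp: "complement_mod \<Phi> \<Delta> (1 - k) (n + k) q = {C \<in> Lat // E. \<forall>x\<in>C. good x}"
    unfolding complement_mod_def lattice_mod_def E_def good_def by blast
  have "bij_betw (\<lambda>x. E `` {x}) reps {C \<in> Lat // E. \<forall>x\<in>C. good x}"
    unfolding bij_betw_def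
  proof
    show "inj_on (\<lambda>x. E `` {x}) reps"
    proof (rule inj_onI)
      fix x y assume x: "x \<in> reps" and y: "y \<in> reps" and "E `` {x} = E `` {y}"
      then have "(x, y) \<in> E" using eq_equiv_class[OF _ E] unfolding reps_def by blast
      then obtain z where z: "z \<in> Lat" "x - y = of_int q *\<^sub>R z" unfolding E_def by blast
      have "z = 0"
      proof (rule simple_eqI)
        fix a assume a: "a \<in> \<Delta>"
        have "a \<bullet> z \<in> \<int>" using lattice_root[OF z(1)] a simple_subset by blast
        then obtain i where i: "a \<bullet> z = of_int i" by (auto elim!: Ints_cases)
        have "a \<bullet> x - a \<bullet> y = of_int q * of_int i"
          using arg_cong[OF z(2), of "\<lambda>u. a \<bullet> u"] i by (simp add: inner_diff_right)
        moreover have "0 < a \<bullet> x" "a \<bullet> x \<le> of_int q" "0 < a \<bullet> y" "a \<bullet> y \<le> of_int q"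
          using x y a unfolding reps_def by auto
        ultimately have "real_of_int q * of_int i < of_int q * 1" "of_int q * (- 1) < real_of_int q * of_int i"
          by linarith+
        then have "real_of_int i < 1" "- 1 < real_of_int i"
          using qr by (simp_all only: mult_less_cancel_left_pos)
        then have "i = 0" by linarith
        then show "a \<bullet> z = a \<bullet> 0" using i by simp
      qed
      then show "x = y" using z by simp
    qed
    show "(\<lambda>x. E `` {x}) ` reps = {C \<in> Lat // E. \<forall>x\<in>C. good x}"
    proof (intro equalityI subsetI)
      fix C assume "C \<in> (\<lambda>x. E `` {x}) ` reps"
      then show "C \<in> {C \<in> Lat // E. \<forall>x\<in>C. good x}"
        using good_E unfolding reps_def by (auto intro: quotientI)
    next
      fix C assume C: "C \<in> {C \<in> Lat // E. \<forall>x\<in>C. good x}"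
      then obtain x where x: "x \<in> Lat" "C = E `` {x}" by (auto elim: quotientE)
      define z where "z = (\<Sum>a\<in>\<Delta>. of_int (\<lceil>a \<bullet> x / of_int q\<rceil> - 1) *\<^sub>R \<omega> a)"
      have az: "a \<bullet> z = of_int (\<lceil>a \<bullet> x / of_int q\<rceil> - 1)" if "a \<in> \<Delta>" for a
        unfolding z_def by (rule simple_coweight_sum[OF that])
      have zL: "z \<in> Lat" unfolding coweight_lattice_def using az by auto
      define y where "y = x - of_int q *\<^sub>R z"
      have yL: "y \<in> Lat" unfolding y_def by (rule lattice_diff[OF x(1) lattice_scale[OF zL]])
      have xy: "(x, y) \<in> E" unfolding E_def using x(1) yL zL y_def by auto
      have "0 < a \<bullet> y \<and> a \<bullet> y \<le> of_int q" if a: "a \<in> \<Delta>" for a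
      proof -
        have "of_int (\<lceil>a \<bullet> x / of_int q\<rceil> - 1) < a \<bullet> x / of_int q"
          "a \<bullet> x / of_int q \<le> of_int (\<lceil>a \<bullet> x / of_int q\<rceil> - 1) + 1" by linarith+
        then have "of_int q * (a \<bullet> z) < a \<bullet> x" "a \<bullet> x \<le> of_int q * (a \<bullet> z + 1)"
          unfolding az[OF a, symmetric] using qr by (simp_all add: field_simps)
        then show ?thesis unfolding y_def by (simp add: inner_diff_right algebra_simps)
      qed
      moreover have "good y" using C x(2) xy by auto
      ultimately have "y \<in> reps" using yL unfolding reps_def by auto
      moreover have "C = E `` {y}" unfolding x(2) by (rule equiv_class_eq[OF E xy])
      ultimately show "C \<in> (\<lambda>x. E `` {x}) ` reps" by blast
    qed
  qed
  from bij_betw_same_card[OF this]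
  have "card (complement_mod \<Phi> \<Delta> (1 - k) (n + k) q) = card reps" unfolding comp by (rule sym)
  also have "reps = (\<Union>v\<in>box_centres. cell v n k q)"
  proof -
    have cell_good: "(\<forall>j\<in>{1 - k..n + k}. \<not> [b \<bullet> x = of_int j] (rmod of_int q)) \<longleftrightarrow>
       of_int (n + k + 1) \<le> b \<bullet> x - of_int q * of_int m \<and> b \<bullet> x - of_int q * of_int m \<le> of_int (q - k)"
      if x: "x \<in> Lat" and b: "b \<in> Pos"
        and m: "of_int q * of_int m < b \<bullet> x" "b \<bullet> x \<le> of_int q * (of_int m + 1)" for x b m
    proof -
      obtain i where i: "b \<bullet> x = of_int i" using lattice_root[OF x pos_root[OF b]] by (auto elim!: Ints_cases)
      have "real_of_int (q * m) < of_int i" "real_of_int i \<le> of_int (q * (m + 1))" using m i by auto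
      then have "q * m < i" "i \<le> q * (m + 1)" by (simp_all only: of_int_less_iff of_int_le_iff)
      from avoids_residues_iff[OF n k this]
      have "(\<forall>j\<in>{1 - k..n + k}. \<not> [b \<bullet> x = of_int j] (rmod of_int q)) \<longleftrightarrow>
        n + k + 1 \<le> i - q * m \<and> i - q * m \<le> q - k" unfolding i .
      also have "\<dots> \<longleftrightarrow> real_of_int (n + k + 1) \<le> of_int (i - q * m) \<and> real_of_int (i - q * m) \<le> of_int (q - k)"
        by (simp only: of_int_le_iff)
      finally show ?thesis unfolding i by simp
    qed
    show ?thesis
    proof (intro equalityI subsetI)
      fix x assume x: "x \<in> reps"
      obtain v where v: "v \<in> centres" and vb: "\<And>b. b \<in> Pos \<Longrightarrow>
          of_int q * of_int \<lfloor>b \<bullet> v / real cox\<rfloor> < b \<bullet> x \<and> b \<bullet> x \<le> of_int q * (of_int \<lfloor>b \<bullet> v / real cox\<rfloor> + 1)"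
        using ex_centre[OF qr, of x] by blast
      \<comment> \<open>At a simple root, box and alcove both confine \<open>x\<close> to an
        interval from \<open>q * m\<close> to \<open>q * (m + 1)\<close> closed at the upper end;
        such intervals coincide once they meet.\<close>
      have "\<lfloor>a \<bullet> v / real cox\<rfloor> = 0" if a: "a \<in> \<Delta>" for a
      proof -
        have "0 < a \<bullet> x" "a \<bullet> x \<le> of_int q" using x a unfolding reps_def by auto
        then have "real_of_int q * of_int \<lfloor>a \<bullet> v / real cox\<rfloor> < of_int q * 1"
          "real_of_int q * 0 < of_int q * (of_int \<lfloor>a \<bullet> v / real cox\<rfloor> + 1)"
          using vb[OF simple_pos[OF a]] by linarith+
        then have "real_of_int \<lfloor>a \<bullet> v / real cox\<rfloor> < 1" "0 < real_of_int \<lfloor>a \<bullet> v / real cox\<rfloor> + 1"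
          using qr by (simp_all only: mult_less_cancel_left_pos)
        then show ?thesis by linarith
      qed
      then have "v \<in> box_centres" using v unfolding box_centres_def by auto
      moreover have "x \<in> cell v n k q"
        unfolding cell_def using x cell_good vb unfolding reps_def good_def by blast
      ultimately show "x \<in> (\<Union>v\<in>box_centres. cell v n k q)" by blast
    next
      fix x assume "x \<in> (\<Union>v\<in>box_centres. cell v n k q)"
      then obtain v where v: "v \<in> box_centres" and x: "x \<in> cell v n k q" by blast
      have xL: "x \<in> Lat" using x unfolding cell_def by auto
      have bd: "of_int q * of_int \<lfloor>b \<bullet> v / real cox\<rfloor> < b \<bullet> x"
        "b \<bullet> x \<le> of_int q * (of_int \<lfloor>b \<bullet> v / real cox\<rfloor> + 1)" if b: "b \<in> Pos" for b
      proof -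
        have "of_int (n + k + 1) \<le> b \<bullet> x - of_int q * of_int \<lfloor>b \<bullet> v / real cox\<rfloor>"
          "b \<bullet> x - of_int q * of_int \<lfloor>b \<bullet> v / real cox\<rfloor> \<le> of_int (q - k)"
          using x b unfolding cell_def by auto
        moreover have "real_of_int (n + k + 1) > 0" "real_of_int (q - k) \<le> of_int q" using n k by auto
        ultimately show "of_int q * of_int \<lfloor>b \<bullet> v / real cox\<rfloor> < b \<bullet> x"
          "b \<bullet> x \<le> of_int q * (of_int \<lfloor>b \<bullet> v / real cox\<rfloor> + 1)" by (simp_all add: algebra_simps)
      qed
      have "0 < a \<bullet> x \<and> a \<bullet> x \<le> of_int q" if a: "a \<in> \<Delta>" for a
      proof -
        have z: "\<lfloor>a \<bullet> v / real cox\<rfloor> = 0" using v a unfolding box_centres_def by auto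
        show ?thesis using bd[OF simple_pos[OF a]] unfolding z by auto
      qed
      moreover have "good x" unfolding good_def
      proof
        fix b assume b: "b \<in> Pos"
        show "\<forall>j\<in>{1 - k..n + k}. \<not> [b \<bullet> x = of_int j] (rmod of_int q)"
          unfolding cell_good[OF xL b bd[OF b]] using x b unfolding cell_def by blast
      qed
      ultimately show "x \<in> reps" unfolding reps_def using xL by auto
    qed
  qed
  also have "card \<dots> = (\<Sum>v\<in>box_centres. card (cell v n k q))"
  proof (rule card_UN_disjoint[OF finite_box_centres])
    show "\<forall>v\<in>box_centres. finite (cell v n k q)"
    proof
      fix v assume "v \<in> box_centres"
      then obtain w z where "w \<in> Sym" "z \<in> Lat" "v = w \<rho> + real cox *\<^sub>R z"
        unfolding box_centres_def centres_def by auto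
      then show "finite (cell v n k q)" using card_cell[of w z n k v q] n k by auto
    qed
    show "\<forall>v\<in>box_centres. \<forall>v'\<in>box_centres. v \<noteq> v' \<longrightarrow> cell v n k q \<inter> cell v' n k q = {}"
    proof (intro ballI impI, rule ccontr)
      fix v v' assume v: "v \<in> box_centres" "v' \<in> box_centres" "v \<noteq> v'"
        and "cell v n k q \<inter> cell v' n k q \<noteq> {}"
      then obtain x where x: "x \<in> cell v n k q" "x \<in> cell v' n k q" by auto
      have "v = v'"
      proof (rule centre_unique)
        fix b assume b: "b \<in> Pos"
        define i j where "i = \<lfloor>b \<bullet> v / real cox\<rfloor>" and "j = \<lfloor>b \<bullet> v' / real cox\<rfloor>"
        have "of_int (n + k + 1) \<le> b \<bullet> x - of_int q * of_int i" "b \<bullet> x - of_int q * of_int i \<le> of_int (q - k)"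
          "of_int (n + k + 1) \<le> b \<bullet> x - of_int q * of_int j" "b \<bullet> x - of_int q * of_int j \<le> of_int (q - k)"
          using x b unfolding cell_def i_def j_def by auto
        moreover have "real_of_int (n + k + 1) > 0" "real_of_int (q - k) \<le> of_int q" using n k by auto
        ultimately have "of_int q * real_of_int i < of_int q * (of_int j + 1)"
          "of_int q * real_of_int j < of_int q * (of_int i + 1)" by (simp_all only: distrib_left)
        then have "real_of_int i < of_int j + 1" "real_of_int j < of_int i + 1"
          using qr by (simp_all only: mult_less_cancel_left_pos)
        then show "\<lfloor>b \<bullet> v / real cox\<rfloor> = \<lfloor>b \<bullet> v' / real cox\<rfloor>"
          unfolding i_def[symmetric] j_def[symmetric] by linarith
      qed (use v in \<open>auto simp: box_centres_def\<close>)
      then show False using v by simp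
    qed
  qed
  finally show ?thesis .
qed

text \<open>One \<open>f\<close> serves all \<open>k\<close>, as the box, the chosen
  \<open>W v\<close> and the offsets do not involve \<open>k\<close>. The theorem compares a given
  \<open>k\<close> with \<open>k = 0\<close>.\<close>

lemma complement_quasi_polynomial:
  assumes n: "n \<ge> 1"
  obtains f where "quasi_polynomial f"
    "\<And>k. k \<ge> 0 \<Longrightarrow> \<forall>\<^sub>F q in at_top.
      f (q - k * int cox) = int (card (complement_mod \<Phi> \<Delta> (1 - k) (n + k) q))"
proof -
  have "\<forall>v\<in>box_centres. \<exists>w. w \<in> Sym \<and> (\<exists>z. z \<in> Lat \<and> v = w \<rho> + real cox *\<^sub>R z)"
    unfolding box_centres_def centres_def by blast
  from bchoice[OF this] obtain W
    where W: "\<And>v. v \<in> box_centres \<Longrightarrow> W v \<in> Sym \<and> (\<exists>z. z \<in> Lat \<and> v = W v \<rho> + real cox *\<^sub>R z)" by blast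
  obtain g where g: "quasi_polynomial g" "\<And>N. N \<ge> 0 \<Longrightarrow> g N = int (card (solutions \<Delta> mark N))"
    using quasi_polynomial_solutions[of \<Delta> mark] finite_simple mark_pos by blast
  define f where "f q = (\<Sum>v\<in>box_centres. g (q - offset (W v) n))" for q
  have qf: "quasi_polynomial f"
    unfolding f_def by (intro quasi_polynomial_sum quasi_polynomial_shift g)
  moreover have "\<forall>\<^sub>F q in at_top. f (q - k * int cox) = int (card (complement_mod \<Phi> \<Delta> (1 - k) (n + k) q))"
    if k: "k \<ge> 0" for k
  proof -
    \<comment> \<open>Beyond \<open>b\<close> every argument of \<open>g\<close> is nonnegative,
      where \<open>g\<close> agrees with the count, and \<open>q\<close> is positive.\<close>
    define b where "b = 1 + (\<Sum>v\<in>box_centres. \<bar>k * int cox + offset (W v) n\<bar>)"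
    have "f (q - k * int cox) = int (card (complement_mod \<Phi> \<Delta> (1 - k) (n + k) q))" if q: "q \<ge> b" for q
    proof -
      have "(\<Sum>v\<in>box_centres. \<bar>k * int cox + offset (W v) n\<bar>) \<ge> 0" by (rule sum_nonneg) simp
      then have "q > 0" using q unfolding b_def by linarith
      have "g (q - k * int cox - offset (W v) n) = int (card (cell v n k q))" if v: "v \<in> box_centres" for v
      proof -
        obtain z where z: "z \<in> Lat" "v = W v \<rho> + real cox *\<^sub>R z" using W[OF v] by blast
        have "\<bar>k * int cox + offset (W v) n\<bar> \<le> (\<Sum>v\<in>box_centres. \<bar>k * int cox + offset (W v) n\<bar>)"
          by (rule member_le_sum) (use v finite_box_centres in auto)
        then have "q - k * int cox - offset (W v) n \<ge> 0" using q unfolding b_def by linarith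
        then show ?thesis using g(2) card_cell[of "W v" z n k v q] W[OF v] z n k by simp
      qed
      then show ?thesis unfolding f_def card_complement_mod[OF n k \<open>q > 0\<close>] by simp
    qed
    then show ?thesis unfolding eventually_at_top_linorder by blast
  qed
  ultimately show ?thesis by (rule that)
qed

lemma characteristic_quasi_polynomial_eqI:
  assumes "quasi_polynomial f" "\<forall>\<^sub>F q in at_top. f q = int (card (complement_mod \<Phi> \<Delta> a b q))"
  shows "characteristic_quasi_polynomial \<Phi> \<Delta> a b = f"
  unfolding characteristic_quasi_polynomial_def
proof (rule the_equality)
  fix g assume g: "quasi_polynomial g \<and> (\<forall>\<^sub>F q in at_top. g q = int (card (complement_mod \<Phi> \<Delta> a b q)))"
  then have "\<forall>\<^sub>F q in at_top. g q = int (card (complement_mod \<Phi> \<Delta> a b q))" by blast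
  then have "\<forall>\<^sub>F q in at_top. g q = f q" using assms(2) by eventually_elim simp
  then show "g = f" using g assms(1) quasi_polynomial_unique by blast
qed (use assms in blast)

end

theorem theorem5p3:
  fixes \<Phi> :: "'a::euclidean_space set" and \<alpha>s :: "'a list" and n k q :: int
  assumes "irreducible_root_system \<Phi>"
    and "distinct \<alpha>s" and "simple_roots \<Phi> (set \<alpha>s)"
    and "n \<ge> 1" and "k \<ge> 0"
  shows "characteristic_quasi_polynomial \<Phi> (set \<alpha>s) (1 - k) (n + k) q =
         characteristic_quasi_polynomial \<Phi> (set \<alpha>s) 1 n (q - k * int (coxeter_number \<alpha>s))"
proof -
  interpret irreducible_based_roots \<Phi> "set \<alpha>s"
    using assms(1,3) by unfold_locales (auto simp: irreducible_root_system_def)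
  have h: "coxeter_number \<alpha>s = cox" by (rule coxeter_number_eq[OF assms(2) refl])
  obtain f where f: "quasi_polynomial f"
    and ev: "\<And>k. k \<ge> 0 \<Longrightarrow> \<forall>\<^sub>F q in at_top.
      f (q - k * int cox) = int (card (complement_mod \<Phi> (set \<alpha>s) (1 - k) (n + k) q))"
    using complement_quasi_polynomial[OF assms(4)] by blast
  have "characteristic_quasi_polynomial \<Phi> (set \<alpha>s) (1 - k) (n + k) = (\<lambda>q. f (q - k * int cox))"
    by (rule characteristic_quasi_polynomial_eqI[OF quasi_polynomial_shift[OF f] ev[OF assms(5)]])
  moreover have "characteristic_quasi_polynomial \<Phi> (set \<alpha>s) 1 n = f"
    by (rule characteristic_quasi_polynomial_eqI[OF f]) (use ev[of 0] in simp)
  ultimately show ?thesis by (simp add: h)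
qed

end
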